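(* Let $G$ be a locally compact abelian group, let $\mu,\nu$ be translation bounded measures on $G$ and let $\mathcal A=(A_i)_{i\in I}$ be a van Hove net in $G$ such that the autocorrelations $\gamma_\mu$ of $\mu$ and $\gamma_\nu$ of $\nu$ exist with respect to $\mathcal A$. If the diffraction measures satisfy $\widehat{\gamma_\mu}\perp\widehat{\gamma_\nu}$ (i.e. are mutually singular), then the reflected Eberlein convolution $\langle\!\langle \mu,\nu\rangle\!\rangle_{\mathcal A}$ exists and satisfies $\langle\!\langle \mu,\nu\rangle\!\rangle_{\mathcal A}=0$.
   Context: $G$ is written additively with neutral element $0$; a Haar measure is fixed, $|A|$ is the Haar measure of $A$ and $\int_G f(s)\,ds$ the integral. $\widehat G$ is the group of continuous homomorphisms $\xi:G\to\mathbb T$ ($\mathbb T$ = unit circle), with its usual locally compact topology. $C_c(G)$ is the space of compactly supported continuous complex functions. A measure on $G$ is a linear functional $\mu:C_c(G)\to\mathbb C$ such that for each compact $K\subseteq G$ there is $C_K\ge0$ with $|\mu(\varphi)|\le C_K\|\varphi\|_\infty$ for all $\varphi\in C_c(G)$ supported in $K$; $|\mu|$ is its total variation, $\mu|_A$ its restriction to a Borel set $A$. $\mu$ is translation bounded if $\sup_{t\in G}|\mu|(t+V)<\infty$ for one (equivalently every) nonempty open $V$ with compact closure. $\tilde\varphi(x)=\overline{\varphi(-x)}$, $\tilde\mu(\varphi)=\overline{\mu(\tilde\varphi)}$. For finite measures, $(\mu*\nu)(\varphi)=\int\int\varphi(s+t)\,d\mu(s)\,d\nu(t)$. For $\varphi\in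 C_c(G)$, $(\mu*\varphi)(t)=\int_G\varphi(t-s)\,d\mu(s)$. For compact $K$, $\partial^KA:=(\overline{A+K}\setminus A)\cup(((G\setminus A)-K)\cap\overline A)$. A van Hove net is a net $\mathcal A=(A_i)_{i\in I}$ of open subsets of $G$ with compact closure (with $|A_i|>0$) such that $\lim_i|\partial^KA_i|/|A_i|=0$ for every compact $K\subseteq G$. For translation bounded $\mu,\nu$, if $\frac1{|A_i|}\,\mu|_{A_i}*\widetilde{\nu|_{A_i}}$ converges vaguely (pointwise on $C_c(G)$), the limit is called the reflected Eberlein convolution and denoted $\langle\!\langle\mu,\nu\rangle\!\rangle_{\mathcal A}$. If it exists, $\gamma_\mu:=\langle\!\langle\mu,\mu\rangle\!\rangle_{\mathcal A}$ is the autocorrelation of $\mu$; it is positive definite, i.e. $\gamma_\mu*\varphi*\tilde\varphi(0)\ge0$ for all $\varphi\in C_c(G)$. For positive definite $\gamma$, $\widehat\gamma$ is the unique positive measure on $\widehat G$ with $\gamma*\varphi*\tilde\varphi(0)=\int_{\widehat G}|\widehat\varphi|^2\,d\widehat\gamma$ for all $\varphi\in C_c(G)$, where $\widehat\varphi(\xi)=\int_G\overline{\xi(t)}\varphi(t)\,dt$. $\widehat{\gamma_\mu}$ is the diffraction measure of $\mu$. Positive measures $\rho,\sigma$ on $\widehat G$ are mutually singular if there are disjoint measurable $A,B\subseteq\widehat G$ with $\rho(\widehat G\setminus A)=0=\sigma(\widehat G\setminus B)$. *)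

theory Defs
  imports "HOL-Analysis.Analysis"
begin

text \<open>
  Throughout, a locally compact abelian group is a type of class \<open>topological_ab_group_add\<close> and
  \<open>t2_space\<close> whose topology satisfies \<open>locally_compact_space euclidean\<close>.
\<close>

definition Cc :: "('a::topological_space \<Rightarrow> complex) set" where
  "Cc = {\<phi>. continuous_on UNIV \<phi> \<and> compact (closure {x. \<phi> x \<noteq> 0})}"

text \<open>Functionals are total HOL functions; only their values on \<open>Cc\<close> are meaningful.\<close>

type_synonym 'a functional = "('a \<Rightarrow> complex) \<Rightarrow> complex"

definition is_measure :: "'a::topological_space functional \<Rightarrow> bool" where
  "is_measure \<mu> \<longleftrightarrow>
     (\<forall>\<phi>\<in>Cc. \<forall>\<psi>\<in>Cc. \<mu> (\<lambda>x. \<phi> x + \<psi> x) = \<mu> \<phi> + \<mu> \<psi>) \<and>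
     (\<forall>c. \<forall>\<phi>\<in>Cc. \<mu> (\<lambda>x. c * \<phi> x) = c * \<mu> \<phi>) \<and>
     (\<forall>K. compact K \<longrightarrow>
        (\<exists>C\<ge>0. \<forall>\<phi>\<in>Cc. closure {x. \<phi> x \<noteq> 0} \<subseteq> K \<longrightarrow> cmod (\<mu> \<phi>) \<le> C * (SUP x. cmod (\<phi> x))))"

text \<open>
  Integration with respect to \<open>\<mu>\<close> and \<open>|\<mu>|\<close> is extended from \<open>Cc\<close> as in Bourbaki.  On \<open>\<phi> \<ge> 0\<close> in
  \<open>Cc\<close> the variation \<open>|\<mu>|\<close> is the supremum of \<open>|\<mu>(\<psi>)|\<close> over \<open>\<psi>\<close> in \<open>Cc\<close> with \<open>|\<psi>| \<le> \<phi>\<close>; for lower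
  semicontinuous \<open>g \<ge> 0\<close> one takes the supremum of \<open>|\<mu>|(\<phi>)\<close> over \<open>0 \<le> \<phi> \<le> g\<close>, which amounts to the
  supremum of \<open>|\<mu>(\<psi>)|\<close> over \<open>|\<psi>| \<le> g\<close>; for arbitrary \<open>f \<ge> 0\<close> the upper integral is the infimum over
  lower semicontinuous majorants.
\<close>

definition lower_semicont :: "('a::topological_space \<Rightarrow> ennreal) \<Rightarrow> bool" where
  "lower_semicont g \<longleftrightarrow> (\<forall>c. open {x. c < g x})"

definition variation_lsc :: "'a::topological_space functional \<Rightarrow> ('a \<Rightarrow> ennreal) \<Rightarrow> ennreal" where
  "variation_lsc \<mu> g =
     (SUP \<psi>\<in>{\<psi>\<in>Cc. \<forall>x. ennreal (cmod (\<psi> x)) \<le> g x}. ennreal (cmod (\<mu> \<psi>)))"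

definition variation_upper_integral ::
    "'a::topological_space functional \<Rightarrow> ('a \<Rightarrow> ennreal) \<Rightarrow> ennreal" where
  "variation_upper_integral \<mu> f =
     (INF g\<in>{g. lower_semicont g \<and> (\<forall>x. f x \<le> g x)}. variation_lsc \<mu> g)"

text \<open>An outer measure, equal to the total variation measure \<open>|\<mu>|\<close> on relatively compact Borel sets.\<close>

definition total_variation :: "'a::topological_space functional \<Rightarrow> 'a set \<Rightarrow> ennreal" where
  "total_variation \<mu> E = variation_upper_integral \<mu> (indicator E)"

text \<open>
  The integral against \<open>\<mu>\<close> is the continuous extension of \<open>\<mu>\<close> from \<open>Cc\<close> to the closure of \<open>Cc\<close> for the
  seminorm \<open>f \<mapsto> \<integral>\<^sup>* |f| d|\<mu>|\<close>, that is, to the \<open>|\<mu>|\<close>-integrable functions.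
\<close>

definition has_integral_against ::
    "'a::topological_space functional \<Rightarrow> ('a \<Rightarrow> complex) \<Rightarrow> complex \<Rightarrow> bool" where
  "has_integral_against \<mu> f c \<longleftrightarrow>
     (\<forall>e>0. \<exists>\<phi>\<in>Cc. variation_upper_integral \<mu> (\<lambda>x. ennreal (cmod (f x - \<phi> x))) < ennreal e
                   \<and> cmod (\<mu> \<phi> - c) < e)"

definition integral_against :: "'a::topological_space functional \<Rightarrow> ('a \<Rightarrow> complex) \<Rightarrow> complex" where
  "integral_against \<mu> f = (THE c. has_integral_against \<mu> f c)"

definition restrict_functional ::
    "'a::topological_space functional \<Rightarrow> 'a set \<Rightarrow> 'a functional" where
  "restrict_functional \<mu> A = (\<lambda>\<phi>. integral_against \<mu> (\<lambda>x. indicator A x * \<phi> x))"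

definition translation_bounded ::
    "'a::{topological_space, ab_group_add} functional \<Rightarrow> bool" where
  "translation_bounded \<mu> \<longleftrightarrow>
     is_measure \<mu> \<and>
     (\<exists>V. open V \<and> V \<noteq> {} \<and> compact (closure V) \<and> (SUP t. total_variation \<mu> ((+) t ` V)) < \<infinity>)"

definition reflect_fun :: "('a::ab_group_add \<Rightarrow> complex) \<Rightarrow> 'a \<Rightarrow> complex" where
  "reflect_fun \<phi> = (\<lambda>x. cnj (\<phi> (- x)))"

definition reflect_functional :: "'a::ab_group_add functional \<Rightarrow> 'a functional" where
  "reflect_functional \<mu> = (\<lambda>\<phi>. cnj (\<mu> (reflect_fun \<phi>)))"

definition conv_finite ::
    "'a::{topological_space, ab_group_add} functional \<Rightarrow> 'a functional \<Rightarrow> 'a functional" where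
  "conv_finite \<mu> \<nu> =
     (\<lambda>\<phi>. integral_against \<nu> (\<lambda>t. integral_against \<mu> (\<lambda>s. \<phi> (s + t))))"

text \<open>\<open>\<mu> * \<phi>\<close> for \<open>\<phi>\<close> in \<open>Cc\<close>; then \<open>s \<mapsto> \<phi> (t - s)\<close> is in \<open>Cc\<close> as well.\<close>

definition conv_fun :: "'a::ab_group_add functional \<Rightarrow> ('a \<Rightarrow> complex) \<Rightarrow> 'a \<Rightarrow> complex" where
  "conv_fun \<mu> \<phi> t = \<mu> (\<lambda>s. \<phi> (t - s))"

definition fun_conv ::
    "'a::ab_group_add measure \<Rightarrow> ('a \<Rightarrow> complex) \<Rightarrow> ('a \<Rightarrow> complex) \<Rightarrow> 'a \<Rightarrow> complex" where
  "fun_conv m f g t = (LINT s|m. f s * g (t - s))"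

text \<open>
  Positive measures are represented by the Borel measures that are finite on compact sets and inner
  regular on all Borel sets; on a locally compact Hausdorff space these correspond bijectively to the
  positive functionals on \<open>Cc\<close>.  The outer regular representative can differ from this one only on
  sets of infinite outer regular measure, and its null sets are null here too.
\<close>

definition radon_measure :: "'a::topological_space measure \<Rightarrow> bool" where
  "radon_measure M \<longleftrightarrow>
     sets M = sets borel \<and>
     (\<forall>K. compact K \<longrightarrow> emeasure M K < \<infinity>) \<and>
     (\<forall>B\<in>sets borel. emeasure M B = (SUP K\<in>{K\<in>sets borel. compact K \<and> K \<subseteq> B}. emeasure M K))"

definition haar_measure :: "'a::{topological_space, ab_group_add} measure \<Rightarrow> bool" where
  "haar_measure m \<longleftrightarrow>
     radon_measure m \<and> emeasure m UNIV \<noteq> 0 \<and>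
     (\<forall>t. \<forall>B\<in>sets borel. emeasure m ((+) t ` B) = emeasure m B)"

definition mutually_singular :: "'a measure \<Rightarrow> 'a measure \<Rightarrow> bool" where
  "mutually_singular \<rho> \<sigma> \<longleftrightarrow>
     (\<exists>A\<in>sets \<rho>. \<exists>B\<in>sets \<sigma>. A \<inter> B = {} \<and>
        emeasure \<rho> (space \<rho> - A) = 0 \<and> emeasure \<sigma> (space \<sigma> - B) = 0)"

typedef (overloaded) ('a::topological_ab_group_add) dual =
    "{\<xi> :: 'a \<Rightarrow> complex. continuous_on UNIV \<xi> \<and> (\<forall>x. cmod (\<xi> x) = 1) \<and>
        (\<forall>x y. \<xi> (x + y) = \<xi> x * \<xi> y)}"
  morphisms char_of Abs_dual
  by (rule exI[of _ "\<lambda>_. 1"]) auto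

instantiation dual :: (topological_ab_group_add) topological_space
begin

text \<open>The compact-open topology.\<close>

definition open_dual :: "'a dual set \<Rightarrow> bool" where
  "open_dual = generate_topology
     {{\<xi>. char_of \<xi> ` K \<subseteq> U} | K U. compact K \<and> open (U :: complex set)}"

instance
proof -
  have "class.topological_space (open :: 'a dual set \<Rightarrow> bool)"
    unfolding open_dual_def by (rule topological_space_generate_topology)
  then show "OFCLASS('a dual, topological_space_class)"
    by intro_classes (auto simp: class.topological_space_def)
qed

end

definition fourier ::
    "'a::topological_ab_group_add measure \<Rightarrow> ('a \<Rightarrow> complex) \<Rightarrow> 'a dual \<Rightarrow> complex" where
  "fourier m \<phi> \<xi> = (LINT t|m. cnj (char_of \<xi> t) * \<phi> t)"

text \<open>
  Stated as a relation because the transform is only defined for positive definite \<open>\<gamma>\<close>; it determines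
  \<open>\<sigma>\<close> uniquely.  The iterated convolution \<open>\<gamma> * \<phi> * \<phi>~\<close> is read as \<open>\<gamma> * (\<phi> * \<phi>~)\<close>.
\<close>

definition has_fourier_transform ::
    "'a::topological_ab_group_add measure \<Rightarrow> 'a functional \<Rightarrow> 'a dual measure \<Rightarrow> bool" where
  "has_fourier_transform m \<gamma> \<sigma> \<longleftrightarrow>
     radon_measure \<sigma> \<and>
     (\<forall>\<phi>\<in>Cc. has_bochner_integral \<sigma> (\<lambda>\<xi>. complex_of_real ((cmod (fourier m \<phi> \<xi>))\<^sup>2))
               (conv_fun \<gamma> (fun_conv m \<phi> (reflect_fun \<phi>)) 0))"

definition directed :: "'i set \<Rightarrow> ('i \<Rightarrow> 'i \<Rightarrow> bool) \<Rightarrow> bool" where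
  "directed I le \<longleftrightarrow>
     I \<noteq> {} \<and> (\<forall>i\<in>I. le i i) \<and>
     (\<forall>i\<in>I. \<forall>j\<in>I. \<forall>k\<in>I. le i j \<longrightarrow> le j k \<longrightarrow> le i k) \<and>
     (\<forall>i\<in>I. \<forall>j\<in>I. \<exists>k\<in>I. le i k \<and> le j k)"

text \<open>The filter of tails; limits along it are limits of nets indexed by \<open>I\<close>.\<close>

definition net_filter :: "'i set \<Rightarrow> ('i \<Rightarrow> 'i \<Rightarrow> bool) \<Rightarrow> 'i filter" where
  "net_filter I le = (INF i\<in>I. principal {j\<in>I. le i j})"

definition van_hove_boundary ::
    "'a::{topological_space, ab_group_add} set \<Rightarrow> 'a set \<Rightarrow> 'a set" where
  "van_hove_boundary K A =
     (closure {a + k | a k. a \<in> A \<and> k \<in> K} - A) \<union> ({b - k | b k. b \<notin> A \<and> k \<in> K} \<inter> closure A)"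

definition van_hove_net ::
    "'a::{topological_space, ab_group_add} measure \<Rightarrow> 'i set \<Rightarrow> ('i \<Rightarrow> 'i \<Rightarrow> bool)
      \<Rightarrow> ('i \<Rightarrow> 'a set) \<Rightarrow> bool" where
  "van_hove_net m I le A \<longleftrightarrow>
     directed I le \<and>
     (\<forall>i\<in>I. open (A i) \<and> compact (closure (A i)) \<and> measure m (A i) > 0) \<and>
     (\<forall>K. compact K \<longrightarrow>
        ((\<lambda>i. measure m (van_hove_boundary K (A i)) / measure m (A i)) \<longlongrightarrow> 0) (net_filter I le))"

text \<open>
  A relation expressing that the vague limit exists and equals \<open>\<gamma>\<close>; it determines \<open>\<gamma>\<close> on \<open>Cc\<close>.
\<close>

definition has_reflected_eberlein ::
    "'a::{topological_space, ab_group_add} measure \<Rightarrow> 'i set \<Rightarrow> ('i \<Rightarrow> 'i \<Rightarrow> bool)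
      \<Rightarrow> ('i \<Rightarrow> 'a set) \<Rightarrow> 'a functional \<Rightarrow> 'a functional \<Rightarrow> 'a functional \<Rightarrow> bool" where
  "has_reflected_eberlein m I le A \<mu> \<nu> \<gamma> \<longleftrightarrow>
     is_measure \<gamma> \<and>
     (\<forall>\<phi>\<in>Cc. ((\<lambda>i. complex_of_real (1 / measure m (A i)) *
                  conv_finite (restrict_functional \<mu> (A i))
                    (reflect_functional (restrict_functional \<nu> (A i))) \<phi>)
               \<longlongrightarrow> \<gamma> \<phi>) (net_filter I le))"

definition has_autocorrelation ::
    "'a::{topological_space, ab_group_add} measure \<Rightarrow> 'i set \<Rightarrow> ('i \<Rightarrow> 'i \<Rightarrow> bool)
      \<Rightarrow> ('i \<Rightarrow> 'a set) \<Rightarrow> 'a functional \<Rightarrow> 'a functional \<Rightarrow> bool" where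
  "has_autocorrelation m I le A \<mu> \<gamma> \<longleftrightarrow> has_reflected_eberlein m I le A \<mu> \<mu> \<gamma>"

end

theory Submission
  imports Defs
begin

text \<open>
  Let \<open>M\<close> and \<open>N\<close> be the restrictions of \<open>\<mu>\<close> and \<open>\<nu>\<close> to a set \<open>A\<^sub>i\<close> of the van Hove net. The
  starting point is an identity (\<open>conv_finite_correlation\<close>): on the correlation
  \<open>s \<mapsto> \<integral> f(u) cnj (g(u + s)) du\<close> of two test functions, the convolution of \<open>M\<close> with the reflection
  of \<open>N\<close> takes the value \<open>\<langle>M * f, N * g\<rangle>\<close>, the inner product in \<open>L\<^sup>2\<close> of the Haar measure. For
  \<open>\<mu> = \<nu>\<close> and \<open>f = g\<close>, existence of the autocorrelation together with the definition of its Fourier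
  transform therefore says that the energies \<open>\<parallel>M * f\<parallel>\<^sup>2 / |A\<^sub>i|\<close> converge to the integral of
  \<open>|f^|\<^sup>2\<close> against the diffraction measure (\<open>autocorrelation_energy\<close>). By Cauchy--Schwarz, the mixed
  inner products are then controlled by both diffraction measures.

  Mutual singularity enters through multipliers. A trigonometric polynomial \<open>p\<close> on the dual group
  acts on test functions as a finite linear combination \<open>S\<close> of translations with \<open>(S f)^ = p f^\<close>.
  Since Haar measure is invariant, \<open>S\<close> has an adjoint \<open>T\<close> of the same kind, with the conjugate
  multiplier (\<open>trig_poly_multiplier\<close>), and
  \<open>\<langle>M * f, N * g\<rangle> = \<langle>M * (f - S f), N * g\<rangle> + \<langle>M * f, N * T g\<rangle>\<close>. After division by \<open>|A\<^sub>i|\<close> the two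
  summands are, in the limit, small together with the integral of \<open>|1 - p|\<^sup>2 |f^|\<^sup>2\<close> against the
  first diffraction measure and that of \<open>|p|\<^sup>2 |g^|\<^sup>2\<close> against the second one. The finite measures
  with these densities \<open>|f^|\<^sup>2\<close> and \<open>|g^|\<^sup>2\<close> are nearly carried by disjoint compact sets
  (\<open>radon_compact_concentration\<close>), and Stone--Weierstrass provides a \<open>p\<close> that is close to \<open>1\<close> on the
  first set, close to \<open>0\<close> on the second, and bounded by \<open>2\<close> everywhere
  (\<open>trig_poly_separates_compacts\<close>). So the inner products, divided by \<open>|A\<^sub>i|\<close>, tend to \<open>0\<close>
  (\<open>pairing_singular_tendsto_0\<close>).

  It remains to pass from correlations to all test functions. The correlation of a bump function
  with the conjugate of \<open>\<theta>\<close> approximates \<open>\<theta>\<close> uniformly and with supports in a fixed compact set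
  (\<open>correlation_approximation\<close>), and translation boundedness and the van Hove property make the
  normalised convolutions uniformly bounded on functions supported there
  (\<open>conv_finite_uniform_bound\<close>).

  Two general facts carry the technical load. The restriction of a measure to an open set with
  compact closure is approximated by products of the measure with cutoff functions
  (\<open>restrict_functional_approx\<close>), and a functional on test functions may be interchanged with a Haar
  integral (\<open>integral_measure_Fubini\<close>).
\<close>

section \<open>Test functions and functionals\<close>

lemma Cc_iff:
  fixes \<phi> :: "'a::t2_space \<Rightarrow> complex"
  shows "\<phi> \<in> Cc \<longleftrightarrow> continuous_on UNIV \<phi> \<and> (\<exists>K. compact K \<and> (\<forall>x. \<phi> x \<noteq> 0 \<longrightarrow> x \<in> K))"
proof
  assume "\<phi> \<in> Cc"
  then show "continuous_on UNIV \<phi> \<and> (\<exists>K. compact K \<and> (\<forall>x. \<phi> x \<noteq> 0 \<longrightarrow> x \<in> K))"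
    using closure_subset[of "{x. \<phi> x \<noteq> 0}"] unfolding Cc_def by blast
next
  assume r: "continuous_on UNIV \<phi> \<and> (\<exists>K. compact K \<and> (\<forall>x. \<phi> x \<noteq> 0 \<longrightarrow> x \<in> K))"
  then obtain K where K: "compact K" "\<And>x. \<phi> x \<noteq> 0 \<Longrightarrow> x \<in> K" by blast
  have "closure {x. \<phi> x \<noteq> 0} \<subseteq> K"
    by (rule closure_minimal) (use K in \<open>auto intro: compact_imp_closed\<close>)
  then have "closure {x. \<phi> x \<noteq> 0} \<inter> K = closure {x. \<phi> x \<noteq> 0}" by blast
  moreover have "compact (closure {x. \<phi> x \<noteq> 0} \<inter> K)"
    using K(1) by (rule closed_Int_compact[OF closed_closure])
  ultimately show "\<phi> \<in> Cc" using r unfolding Cc_def by simp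
qed

lemma CcI:
  fixes \<phi> :: "'a::t2_space \<Rightarrow> complex"
  assumes "continuous_on UNIV \<phi>" "compact K" "\<And>x. \<phi> x \<noteq> 0 \<Longrightarrow> x \<in> K"
  shows "\<phi> \<in> Cc"
  using assms unfolding Cc_iff by blast

lemma CcE:
  fixes \<phi> :: "'a::t2_space \<Rightarrow> complex"
  assumes "\<phi> \<in> Cc"
  obtains K where "compact K" "\<And>x. \<phi> x \<noteq> 0 \<Longrightarrow> x \<in> K"
  using assms unfolding Cc_iff by blast

lemma Cc_cont: "\<phi> \<in> Cc \<Longrightarrow> continuous_on UNIV \<phi>"
  by (simp add: Cc_def)

lemma Cc_comp_cont: "\<phi> \<in> Cc \<Longrightarrow> continuous_on S f \<Longrightarrow> continuous_on S (\<lambda>x. \<phi> (f x))"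
  by (rule continuous_on_compose2[OF Cc_cont]) auto

lemma Cc_zero [simp]: "(\<lambda>_. 0) \<in> (Cc :: ('a::t2_space \<Rightarrow> complex) set)"
  by (rule CcI[of _ "{}"]) auto

abbreviation cutoff :: "('a \<Rightarrow> real) \<Rightarrow> ('a \<Rightarrow> complex) \<Rightarrow> 'a \<Rightarrow> complex" where
  "cutoff h \<phi> \<equiv> \<lambda>x. complex_of_real (h x) * \<phi> x"

lemma Cc_mult_cont:
  fixes \<phi> :: "'a::t2_space \<Rightarrow> complex"
  assumes "continuous_on UNIV f" "\<phi> \<in> Cc"
  shows "(\<lambda>x. f x * \<phi> x) \<in> Cc"
  using assms by (auto simp: Cc_iff intro!: continuous_intros)

lemma Cc_cmult: "\<phi> \<in> Cc \<Longrightarrow> (\<lambda>x. c * \<phi> x) \<in> (Cc :: ('a::t2_space \<Rightarrow> complex) set)"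
  by (rule Cc_mult_cont) auto

lemma Cc_add:
  fixes \<phi> \<psi> :: "'a::t2_space \<Rightarrow> complex"
  assumes "\<phi> \<in> Cc" "\<psi> \<in> Cc"
  shows "(\<lambda>x. \<phi> x + \<psi> x) \<in> Cc"
proof -
  obtain K where K: "compact K" "\<And>x. \<phi> x \<noteq> 0 \<Longrightarrow> x \<in> K" using CcE[OF assms(1)] by blast
  obtain L where L: "compact L" "\<And>x. \<psi> x \<noteq> 0 \<Longrightarrow> x \<in> L" using CcE[OF assms(2)] by blast
  show ?thesis
  proof (rule CcI[of _ "K \<union> L"])
    show "continuous_on UNIV (\<lambda>x. \<phi> x + \<psi> x)"
      by (intro continuous_on_add Cc_cont assms)
    show "x \<in> K \<union> L" if "\<phi> x + \<psi> x \<noteq> 0" for x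
      using that K(2)[of x] L(2)[of x] by (cases "\<phi> x = 0") auto
  qed (intro compact_Un K L)
qed

lemma Cc_diff:
  fixes \<phi> \<psi> :: "'a::t2_space \<Rightarrow> complex"
  assumes "\<phi> \<in> Cc" "\<psi> \<in> Cc"
  shows "(\<lambda>x. \<phi> x - \<psi> x) \<in> Cc"
  using Cc_add[OF assms(1) Cc_cmult[OF assms(2), of "-1"]] by simp

lemma Cc_sum:
  fixes \<phi> :: "'b \<Rightarrow> 'a::t2_space \<Rightarrow> complex"
  assumes "\<And>j. j \<in> J \<Longrightarrow> \<phi> j \<in> Cc"
  shows "(\<lambda>x. \<Sum>j\<in>J. \<phi> j x) \<in> Cc"
  using assms by (induction J rule: infinite_finite_induct) (auto intro: Cc_add)

lemma Cc_cnj: "\<phi> \<in> Cc \<Longrightarrow> (\<lambda>x. cnj (\<phi> x)) \<in> (Cc :: ('a::t2_space \<Rightarrow> complex) set)"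
  by (auto simp: Cc_iff intro!: continuous_intros)

lemma Cc_translate:
  fixes \<phi> :: "'a::{topological_ab_group_add, t2_space} \<Rightarrow> complex"
  assumes "\<phi> \<in> Cc"
  shows "(\<lambda>s. \<phi> (s + t)) \<in> Cc"
proof -
  obtain K where K: "compact K" "\<And>x. \<phi> x \<noteq> 0 \<Longrightarrow> x \<in> K" using CcE[OF assms] by blast
  show ?thesis
  proof (rule CcI[of _ "(\<lambda>k. k - t) ` K"])
    show "continuous_on UNIV (\<lambda>s. \<phi> (s + t))"
      by (intro Cc_comp_cont[OF assms] continuous_intros)
    show "compact ((\<lambda>k. k - t) ` K)"
      by (intro compact_continuous_image continuous_intros K)
  qed (use K in \<open>force simp: image_iff\<close>)
qed

lemma Cc_translate_diff:
  fixes \<phi> :: "'a::{topological_ab_group_add, t2_space} \<Rightarrow> complex"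
  shows "\<phi> \<in> Cc \<Longrightarrow> (\<lambda>s. \<phi> (s - t)) \<in> Cc"
  using Cc_translate[of \<phi> "-t"] by simp

lemma Cc_uminus:
  fixes \<phi> :: "'a::{topological_ab_group_add, t2_space} \<Rightarrow> complex"
  assumes "\<phi> \<in> Cc"
  shows "(\<lambda>s. \<phi> (- s)) \<in> Cc"
proof -
  obtain K where K: "compact K" "\<And>x. \<phi> x \<noteq> 0 \<Longrightarrow> x \<in> K" using CcE[OF assms] by blast
  show ?thesis
  proof (rule CcI[of _ "uminus ` K"])
    show "continuous_on UNIV (\<lambda>s. \<phi> (- s))"
      by (intro Cc_comp_cont[OF assms] continuous_intros)
    show "compact (uminus ` K)"
      by (intro compact_continuous_image continuous_intros K)
  qed (use K in \<open>force simp: image_iff\<close>)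
qed

lemma Cc_reflect_translate:
  fixes \<phi> :: "'a::{topological_ab_group_add, t2_space} \<Rightarrow> complex"
  shows "\<phi> \<in> Cc \<Longrightarrow> (\<lambda>s. \<phi> (t - s)) \<in> Cc"
  using Cc_translate_diff[OF Cc_uminus, of \<phi> t] by (simp add: algebra_simps)

lemma Cc_reflect_fun:
  fixes \<phi> :: "'a::{topological_ab_group_add, t2_space} \<Rightarrow> complex"
  shows "\<phi> \<in> Cc \<Longrightarrow> reflect_fun \<phi> \<in> Cc"
  unfolding reflect_fun_def by (intro Cc_cnj Cc_uminus)

lemma Cc_bounded:
  fixes \<phi> :: "'a::t2_space \<Rightarrow> complex"
  assumes "\<phi> \<in> Cc"
  obtains B where "B \<ge> 0" "\<And>x. cmod (\<phi> x) \<le> B"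
proof -
  obtain K where K: "compact K" "\<And>x. \<phi> x \<noteq> 0 \<Longrightarrow> x \<in> K" using CcE[OF assms] by blast
  have "compact (\<phi> ` K)"
    by (intro compact_continuous_image K continuous_on_subset[OF Cc_cont[OF assms]]) auto
  then obtain B where B: "\<And>x. x \<in> K \<Longrightarrow> cmod (\<phi> x) \<le> B"
    using compact_imp_bounded bounded_iff by (metis imageI)
  have "cmod (\<phi> x) \<le> max B 0" for x
    using B[of x] K(2)[of x] by (cases "\<phi> x = 0") auto
  then show ?thesis using that[of "max B 0"] by auto
qed

text \<open>
  A majorant \<open>B\<close> is easier to produce than a supremum over the group, and on \<open>Cc\<close> both versions of
  the bound are equivalent because the supremum is attained.
\<close>

lemma is_measure_bound:
  fixes \<mu> :: "'a::t2_space functional"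
  assumes "is_measure \<mu>" "compact K"
  obtains C where "C \<ge> 0"
    "\<And>\<phi> B. \<phi> \<in> Cc \<Longrightarrow> (\<And>x. \<phi> x \<noteq> 0 \<Longrightarrow> x \<in> K) \<Longrightarrow> (\<And>x. cmod (\<phi> x) \<le> B) \<Longrightarrow> cmod (\<mu> \<phi>) \<le> C * B"
proof -
  obtain C where C: "C \<ge> 0" "\<forall>\<phi>\<in>Cc. closure {x. \<phi> x \<noteq> 0} \<subseteq> K \<longrightarrow> cmod (\<mu> \<phi>) \<le> C * (SUP x. cmod (\<phi> x))"
    using assms unfolding is_measure_def by blast
  show ?thesis
  proof (rule that[OF C(1)])
    fix \<phi> :: "'a \<Rightarrow> complex" and B
    assume \<phi>: "\<phi> \<in> Cc" "\<And>x. \<phi> x \<noteq> 0 \<Longrightarrow> x \<in> K" and B: "\<And>x. cmod (\<phi> x) \<le> B"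
    have "closure {x. \<phi> x \<noteq> 0} \<subseteq> K"
      by (rule closure_minimal) (use \<phi> assms in \<open>auto intro: compact_imp_closed\<close>)
    then have "cmod (\<mu> \<phi>) \<le> C * (SUP x. cmod (\<phi> x))" using C \<phi> by blast
    also have "\<dots> \<le> C * B" by (intro mult_left_mono cSUP_least B C) auto
    finally show "cmod (\<mu> \<phi>) \<le> C * B" .
  qed
qed

lemma is_measureI:
  fixes \<mu> :: "'a::t2_space functional"
  assumes "\<And>\<phi> \<psi>. \<phi> \<in> Cc \<Longrightarrow> \<psi> \<in> Cc \<Longrightarrow> \<mu> (\<lambda>x. \<phi> x + \<psi> x) = \<mu> \<phi> + \<mu> \<psi>"
    and "\<And>c \<phi>. \<phi> \<in> Cc \<Longrightarrow> \<mu> (\<lambda>x. c * \<phi> x) = c * \<mu> \<phi>"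
    and bd: "\<And>K. compact K \<Longrightarrow> \<exists>C\<ge>0. \<forall>\<phi>\<in>Cc. \<forall>B. (\<forall>x. \<phi> x \<noteq> 0 \<longrightarrow> x \<in> K) \<longrightarrow> (\<forall>x. cmod (\<phi> x) \<le> B)
              \<longrightarrow> cmod (\<mu> \<phi>) \<le> C * B"
  shows "is_measure \<mu>"
  unfolding is_measure_def
proof (intro conjI ballI allI impI)
  fix K :: "'a set" assume K: "compact K"
  obtain C where C: "C \<ge> 0" "\<forall>\<phi>\<in>Cc. \<forall>B. (\<forall>x. \<phi> x \<noteq> 0 \<longrightarrow> x \<in> K) \<longrightarrow> (\<forall>x. cmod (\<phi> x) \<le> B)
              \<longrightarrow> cmod (\<mu> \<phi>) \<le> C * B" using bd[OF K] by blast
  show "\<exists>C\<ge>0. \<forall>\<phi>\<in>Cc. closure {x. \<phi> x \<noteq> 0} \<subseteq> K \<longrightarrow> cmod (\<mu> \<phi>) \<le> C * (SUP x. cmod (\<phi> x))"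
  proof (intro exI[of _ C] conjI ballI impI C)
    fix \<phi> :: "'a \<Rightarrow> complex" assume \<phi>: "\<phi> \<in> Cc" "closure {x. \<phi> x \<noteq> 0} \<subseteq> K"
    obtain B where B: "\<And>x. cmod (\<phi> x) \<le> B" using Cc_bounded[OF \<phi>(1)] by blast
    have "cmod (\<phi> x) \<le> (SUP x. cmod (\<phi> x))" for x
      by (rule cSUP_upper) (auto intro!: bdd_aboveI2[of _ _ B] B)
    moreover have "\<forall>x. \<phi> x \<noteq> 0 \<longrightarrow> x \<in> K"
      using \<phi>(2) closure_subset[of "{x. \<phi> x \<noteq> 0}"] by blast
    ultimately show "cmod (\<mu> \<phi>) \<le> C * (SUP x. cmod (\<phi> x))" using C \<phi>(1) by blast
  qed
qed (use assms in auto)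

lemma is_measure_add: "is_measure \<mu> \<Longrightarrow> \<phi> \<in> Cc \<Longrightarrow> \<psi> \<in> Cc \<Longrightarrow> \<mu> (\<lambda>x. \<phi> x + \<psi> x) = \<mu> \<phi> + \<mu> \<psi>"
  by (simp add: is_measure_def)

lemma is_measure_cmult: "is_measure \<mu> \<Longrightarrow> \<phi> \<in> Cc \<Longrightarrow> \<mu> (\<lambda>x. c * \<phi> x) = c * \<mu> \<phi>"
  by (simp add: is_measure_def)

lemma is_measure_zero: "is_measure (\<mu> :: 'a::t2_space functional) \<Longrightarrow> \<mu> (\<lambda>_. 0) = 0"
  using is_measure_cmult[of \<mu> "\<lambda>_. 0" 0] by simp

lemma is_measure_diff:
  "is_measure (\<mu> :: 'a::t2_space functional) \<Longrightarrow> \<phi> \<in> Cc \<Longrightarrow> \<psi> \<in> Cc \<Longrightarrow> \<mu> (\<lambda>x. \<phi> x - \<psi> x) = \<mu> \<phi> - \<mu> \<psi>"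
  using is_measure_add[of \<mu> \<phi> "\<lambda>x. (-1) * \<psi> x"] is_measure_cmult[of \<mu> \<psi> "-1"] Cc_cmult[of \<psi> "-1"] by simp

lemma is_measure_sum:
  fixes \<mu> :: "'a::t2_space functional"
  assumes "is_measure \<mu>" "\<And>j. j \<in> J \<Longrightarrow> \<phi> j \<in> Cc"
  shows "\<mu> (\<lambda>x. \<Sum>j\<in>J. \<phi> j x) = (\<Sum>j\<in>J. \<mu> (\<phi> j))"
  using assms
  by (induction J rule: infinite_finite_induct)
    (auto simp: is_measure_zero is_measure_add[OF _ _ Cc_sum])

lemma is_measure_reflect:
  fixes \<mu> :: "'a::{topological_ab_group_add, t2_space} functional"
  assumes "is_measure \<mu>"
  shows "is_measure (reflect_functional \<mu>)"
proof (rule is_measureI)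
  fix \<phi> \<psi> :: "'a \<Rightarrow> complex" assume "\<phi> \<in> Cc" "\<psi> \<in> Cc"
  then show "reflect_functional \<mu> (\<lambda>x. \<phi> x + \<psi> x) = reflect_functional \<mu> \<phi> + reflect_functional \<mu> \<psi>"
    using is_measure_add[OF assms Cc_reflect_fun Cc_reflect_fun, of \<phi> \<psi>]
    by (simp add: reflect_functional_def reflect_fun_def)
next
  fix c and \<phi> :: "'a \<Rightarrow> complex" assume "\<phi> \<in> Cc"
  then show "reflect_functional \<mu> (\<lambda>x. c * \<phi> x) = c * reflect_functional \<mu> \<phi>"
    using is_measure_cmult[OF assms Cc_reflect_fun, of \<phi> "cnj c"]
    by (simp add: reflect_functional_def reflect_fun_def)
next
  fix K :: "'a set" assume "compact K"
  then have "compact (uminus ` K)" by (intro compact_continuous_image continuous_intros)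
  from is_measure_bound[OF assms this] obtain C where C: "C \<ge> 0"
    "\<And>\<phi> B. \<phi> \<in> Cc \<Longrightarrow> (\<And>x. \<phi> x \<noteq> 0 \<Longrightarrow> x \<in> uminus ` K) \<Longrightarrow> (\<And>x. cmod (\<phi> x) \<le> B) \<Longrightarrow> cmod (\<mu> \<phi>) \<le> C * B"
    by blast
  show "\<exists>C\<ge>0. \<forall>\<phi>\<in>Cc. \<forall>B. (\<forall>x. \<phi> x \<noteq> 0 \<longrightarrow> x \<in> K) \<longrightarrow> (\<forall>x. cmod (\<phi> x) \<le> B)
      \<longrightarrow> cmod (reflect_functional \<mu> \<phi>) \<le> C * B"
  proof (intro exI[of _ C] conjI ballI allI impI C(1))
    fix \<phi> :: "'a \<Rightarrow> complex" and B
    assume *: "\<phi> \<in> Cc" "\<forall>x. \<phi> x \<noteq> 0 \<longrightarrow> x \<in> K" "\<forall>x. cmod (\<phi> x) \<le> B"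
    have "cmod (\<mu> (reflect_fun \<phi>)) \<le> C * B"
    proof (rule C(2)[OF Cc_reflect_fun[OF *(1)]])
      fix x assume "reflect_fun \<phi> x \<noteq> 0"
      then have "- x \<in> K" using * by (auto simp: reflect_fun_def)
      then show "x \<in> uminus ` K" by (metis imageI minus_minus)
    qed (use * in \<open>auto simp: reflect_fun_def\<close>)
    then show "cmod (reflect_functional \<mu> \<phi>) \<le> C * B" by (simp add: reflect_functional_def)
  qed
qed

section \<open>Subadditivity of the variation\<close>

lemma Hausdorff_space_euclidean_t2: "Hausdorff_space (euclidean :: 'a::t2_space topology)"
  unfolding Hausdorff_space_def disjnt_def by simp (meson hausdorff)

text \<open>
  Locally compact Hausdorff spaces are completely regular; this supplies every continuous function
  used below.
\<close>

lemma lc_urysohn: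
  fixes x :: "'a::t2_space"
  assumes lc: "locally_compact_space (euclidean :: 'a topology)" and "open U" "x \<in> U"
  obtains f :: "'a \<Rightarrow> real" where "continuous_on UNIV f" "\<And>y. 0 \<le> f y" "\<And>y. f y \<le> 1" "f x = 1"
    "\<And>y. y \<notin> U \<Longrightarrow> f y = 0"
proof -
  have "completely_regular_space (euclidean :: 'a topology)"
    using lc Hausdorff_space_euclidean_t2 locally_compact_regular_imp_completely_regular_space by blast
  moreover have "closedin euclidean (- U)" using assms by auto
  ultimately obtain f :: "'a \<Rightarrow> real" where
    f: "continuous_map euclidean (top_of_set {0..1}) f" "f x = 0" "f ` (- U) \<subseteq> {1}"
    using assms(3) unfolding completely_regular_space_def
        by (metis Compl_iff DiffI UNIV_I topspace_euclidean)
  have "continuous_on UNIV f" "\<And>y. f y \<in> {0..1}"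
    using f(1) by (auto simp: continuous_map_in_subtopology)
  then show ?thesis
    using f by (intro that[of "\<lambda>y. 1 - f y"]) (auto intro!: continuous_intros simp: image_subset_iff)
qed

lemma lc_bump:
  fixes x :: "'a::t2_space"
  assumes lc: "locally_compact_space (euclidean :: 'a topology)" and "open U" "x \<in> U"
  obtains f :: "'a \<Rightarrow> real" and K where "continuous_on UNIV f" "\<And>y. 0 \<le> f y" "\<And>y. f y \<le> 1" "f x = 1"
    "compact K" "K \<subseteq> U" "\<And>y. f y \<noteq> 0 \<Longrightarrow> y \<in> K"
proof -
  obtain V C where VC: "open V" "compact C" "x \<in> V" "V \<subseteq> C" "C \<subseteq> U"
  proof -
    have "neighbourhood_base_of (compactin euclidean) (euclidean :: 'a topology)"
      using lc Hausdorff_space_euclidean_t2 locally_compact_space_neighbourhood_base by blast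
    then show thesis
      using assms(2,3) that unfolding neighbourhood_base_of
      by (metis compactin_euclidean_iff open_openin)
  qed
  obtain f :: "'a \<Rightarrow> real" where f: "continuous_on UNIV f" "\<And>y. 0 \<le> f y" "\<And>y. f y \<le> 1" "f x = 1"
    "\<And>y. y \<notin> V \<Longrightarrow> f y = 0"
    using lc_urysohn[OF lc VC(1,3)] by blast
  show ?thesis by (rule that[of f C]) (use VC f in \<open>blast+\<close>)
qed

lemma variation_lsc_upper:
  assumes "\<psi> \<in> Cc" "\<And>x. ennreal (cmod (\<psi> x)) \<le> g x"
  shows "ennreal (cmod (\<mu> \<psi>)) \<le> variation_lsc \<mu> g"
  unfolding variation_lsc_def by (rule SUP_upper) (use assms in auto)

lemma variation_lsc_least:
  assumes "\<And>\<psi>. \<psi> \<in> Cc \<Longrightarrow> (\<And>x. ennreal (cmod (\<psi> x)) \<le> g x) \<Longrightarrow> ennreal (cmod (\<mu> \<psi>)) \<le> C"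
  shows "variation_lsc \<mu> g \<le> C"
  unfolding variation_lsc_def by (rule SUP_least) (use assms in auto)

text \<open>
  A lower semicontinuous function is the supremum of its continuous minorants: below the value at
  \<open>x\<close>, scale a Urysohn function that lives where \<open>g\<close> is still larger.
\<close>

lemma lower_semicont_cont_minorant:
  fixes g :: "'a::t2_space \<Rightarrow> ennreal"
  assumes lc: "locally_compact_space (euclidean :: 'a topology)"
    and g: "lower_semicont g" and r: "0 \<le> r" "ennreal r \<le> g x" and "e > 0"
  obtains \<phi> :: "'a \<Rightarrow> real" where "continuous_on UNIV \<phi>" "\<And>y. 0 \<le> \<phi> y" "\<And>y. ennreal (\<phi> y) \<le> g y"
      "\<phi> x > r - e"
proof (cases "r - e/2 \<le> 0")
  case True
  then show ?thesis using \<open>e > 0\<close> by (intro that[of "\<lambda>_. 0"]) auto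
next
  case False
  define a where "a = r - e/2"
  have a: "a > 0" "a < r" "a > r - e" using False \<open>e > 0\<close> by (auto simp: a_def)
  have "open {y. ennreal a < g y}" using g by (simp add: lower_semicont_def)
  moreover have "x \<in> {y. ennreal a < g y}"
    using less_le_trans[OF ennreal_lessI r(2), of a] a by auto
  ultimately obtain f :: "'a \<Rightarrow> real" where f: "continuous_on UNIV f" "\<And>y. 0 \<le> f y" "\<And>y. f y \<le> 1"
      "f x = 1"
    "\<And>y. y \<notin> {y. ennreal a < g y} \<Longrightarrow> f y = 0"
    using lc_urysohn[OF lc] by metis
  show ?thesis
  proof (rule that[of "\<lambda>y. a * f y"])
    fix y
    show "ennreal (a * f y) \<le> g y"
    proof (cases "ennreal a < g y")
      case True
      have "a * f y \<le> a" using a f(3)[of y] by (simp add: mult_left_le)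
      then show ?thesis using True by (meson ennreal_leI le_less_trans less_imp_le)
    qed (use f(5)[of y] in auto)
  qed (use a f in \<open>auto intro!: continuous_intros\<close>)
qed

text \<open>
  Subadditivity makes the integral of \<open>has_integral_against\<close> well defined. Given \<open>|\<psi>| \<le> g\<^sub>1 + g\<^sub>2\<close>,
  compactness of the support of \<open>\<psi>\<close> yields continuous minorants \<open>\<phi>\<^sub>j \<le> g\<^sub>j\<close> with
  \<open>|\<psi>| \<le> \<phi>\<^sub>1 + \<phi>\<^sub>2 + e\<close>. Then \<open>\<psi>\<close> is the sum of the parts \<open>\<psi> \<phi>\<^sub>1 / w\<close>, \<open>\<psi> \<phi>\<^sub>2 / w\<close> and \<open>\<psi> e / w\<close>,
  where \<open>w = \<phi>\<^sub>1 + \<phi>\<^sub>2 + e\<close>: the first two are dominated by \<open>g\<^sub>1\<close> and \<open>g\<^sub>2\<close>, and the third is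
  bounded by \<open>e\<close> on a fixed compact set.
\<close>

lemma variation_lsc_add:
  fixes \<mu> :: "'a::t2_space functional"
  assumes lc: "locally_compact_space (euclidean :: 'a topology)" and \<mu>: "is_measure \<mu>"
    and g: "lower_semicont g\<^sub>1" "lower_semicont g\<^sub>2"
  shows "variation_lsc \<mu> (\<lambda>x. g\<^sub>1 x + g\<^sub>2 x) \<le> variation_lsc \<mu> g\<^sub>1 + variation_lsc \<mu> g\<^sub>2"
proof (rule variation_lsc_least)
  fix \<psi> :: "'a \<Rightarrow> complex"
  assume \<psi>: "\<psi> \<in> Cc" and le: "\<And>x. ennreal (cmod (\<psi> x)) \<le> g\<^sub>1 x + g\<^sub>2 x"
  obtain K where K: "compact K" "\<And>x. \<psi> x \<noteq> 0 \<Longrightarrow> x \<in> K" using CcE[OF \<psi>] by blast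
  obtain C where C: "C \<ge> 0"
    "\<And>\<phi> B. \<phi> \<in> Cc \<Longrightarrow> (\<And>x. \<phi> x \<noteq> 0 \<Longrightarrow> x \<in> K) \<Longrightarrow> (\<And>x. cmod (\<phi> x) \<le> B) \<Longrightarrow> cmod (\<mu> \<phi>) \<le> C * B"
    using is_measure_bound[OF \<mu> K(1)] by blast
  \<comment> \<open>pairs of admissible minorants; they are closed under pointwise maxima\<close>
  define adm where "adm \<phi>\<^sub>1 \<phi>\<^sub>2 \<longleftrightarrow> continuous_on UNIV \<phi>\<^sub>1 \<and> continuous_on UNIV \<phi>\<^sub>2 \<and>
      (\<forall>y. 0 \<le> \<phi>\<^sub>1 y \<and> 0 \<le> \<phi>\<^sub>2 y \<and> ennreal (\<phi>\<^sub>1 y) \<le> g\<^sub>1 y \<and> ennreal (\<phi>\<^sub>2 y) \<le> g\<^sub>2 y)"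
    for \<phi>\<^sub>1 \<phi>\<^sub>2 :: "'a \<Rightarrow> real"
  have split: "ennreal (cmod (\<mu> \<psi>)) \<le> variation_lsc \<mu> g\<^sub>1 + variation_lsc \<mu> g\<^sub>2 + ennreal (C * e)"
      if e: "e > 0" for e
  proof -
    have "\<exists>\<phi>\<^sub>1 \<phi>\<^sub>2. adm \<phi>\<^sub>1 \<phi>\<^sub>2 \<and> cmod (\<psi> x) < \<phi>\<^sub>1 x + \<phi>\<^sub>2 x + e" for x
    proof -
      obtain r\<^sub>1 r\<^sub>2 where r: "0 \<le> r\<^sub>1" "0 \<le> r\<^sub>2" "ennreal r\<^sub>1 \<le> g\<^sub>1 x" "ennreal r\<^sub>2 \<le> g\<^sub>2 x" "r\<^sub>1
          + r\<^sub>2 = cmod (\<psi> x)"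
      proof (cases "ennreal (cmod (\<psi> x)) \<le> g\<^sub>1 x")
        case True
        then show ?thesis using that[of "cmod (\<psi> x)" 0] by auto
      next
        case False
        then obtain r where r: "g\<^sub>1 x = ennreal r" "0 \<le> r" "r < cmod (\<psi> x)"
          by (cases "g\<^sub>1 x") (auto simp: not_le ennreal_less_iff)
        have "ennreal (cmod (\<psi> x) - r) \<le> g\<^sub>2 x"
          using le[of x] r by (cases "g\<^sub>2 x") (auto simp: ennreal_plus[symmetric] simp del: ennreal_plus)
        then show ?thesis using that[of r "cmod (\<psi> x) - r"] r by auto
      qed
      obtain \<phi>\<^sub>1 :: "'a \<Rightarrow> real" where 1: "continuous_on UNIV \<phi>\<^sub>1" "\<And>y. 0 \<le> \<phi>\<^sub>1 y"
          "\<And>y. ennreal (\<phi>\<^sub>1 y) \<le> g\<^sub>1 y" "\<phi>\<^sub>1 x > r\<^sub>1 - e/2"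
        using lower_semicont_cont_minorant[OF lc g(1) r(1,3), of "e/2"] e by auto
      obtain \<phi>\<^sub>2 :: "'a \<Rightarrow> real" where 2: "continuous_on UNIV \<phi>\<^sub>2" "\<And>y. 0 \<le> \<phi>\<^sub>2 y"
          "\<And>y. ennreal (\<phi>\<^sub>2 y) \<le> g\<^sub>2 y" "\<phi>\<^sub>2 x > r\<^sub>2 - e/2"
        using lower_semicont_cont_minorant[OF lc g(2) r(2,4), of "e/2"] e by auto
      show ?thesis
        using 1 2 r(5) by (intro exI[of _ \<phi>\<^sub>1] exI[of _ \<phi>\<^sub>2]) (auto simp: adm_def)
    qed
    then obtain P Q where PQ: "\<And>x. adm (P x) (Q x)" "\<And>x. cmod (\<psi> x) < P x x + Q x x + e"
      by metis
    have op: "open {y. cmod (\<psi> y) < P x y + Q x y + e}" for x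
      using PQ(1)[of x] by (intro open_Collect_less continuous_intros Cc_cont \<psi>) (auto simp: adm_def)
    have cov: "K \<subseteq> (\<Union>x\<in>K. {y. cmod (\<psi> y) < P x y + Q x y + e})"
      using PQ(2) by blast
    obtain F where F: "finite F" "F \<subseteq> K" "K \<subseteq> (\<Union>x\<in>F. {y. cmod (\<psi> y) < P x y + Q x y + e})"
      by (rule compactE_image[OF K(1) _ cov]) (use op in auto)
    have "\<exists>\<phi>\<^sub>1 \<phi>\<^sub>2. adm \<phi>\<^sub>1 \<phi>\<^sub>2 \<and> (\<forall>x\<in>F. \<forall>y. P x y \<le> \<phi>\<^sub>1 y \<and> Q x y \<le> \<phi>\<^sub>2 y)"
      using F(1)
    proof (induction F)
      case empty
      show ?case by (intro exI[of _ "\<lambda>_. 0"]) (auto simp: adm_def)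
    next
      case (insert x F)
      then obtain \<phi>\<^sub>1 \<phi>\<^sub>2 where *: "adm \<phi>\<^sub>1 \<phi>\<^sub>2" "\<forall>x\<in>F. \<forall>y. P x y \<le> \<phi>\<^sub>1 y \<and> Q x y \<le> \<phi>\<^sub>2 y" by blast
      have "adm (\<lambda>y. max (P x y) (\<phi>\<^sub>1 y)) (\<lambda>y. max (Q x y) (\<phi>\<^sub>2 y))"
        using *(1) PQ(1)[of x] by (auto simp: adm_def max_def intro!: continuous_on_max[unfolded max_def])
      then show ?case using *(2)
        by (intro exI[of _ "\<lambda>y. max (P x y) (\<phi>\<^sub>1 y)"] exI[of _ "\<lambda>y. max (Q x y) (\<phi>\<^sub>2 y)"])
          (auto simp: le_max_iff_disj)
    qed
    then obtain \<phi>\<^sub>1 \<phi>\<^sub>2 where \<phi>: "adm \<phi>\<^sub>1 \<phi>\<^sub>2" "\<And>x y. x \<in> F \<Longrightarrow> P x y \<le> \<phi>\<^sub>1 y" "\<And>x y. x \<in> F \<Longrightarrow> Q x y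
        \<le> \<phi>\<^sub>2 y"
      by blast
    have nn: "0 \<le> \<phi>\<^sub>1 y" "0 \<le> \<phi>\<^sub>2 y" for y using \<phi>(1) by (auto simp: adm_def)
    have big: "cmod (\<psi> y) \<le> \<phi>\<^sub>1 y + \<phi>\<^sub>2 y + e" for y
    proof (cases "y \<in> K")
      case True
      then obtain x where "x \<in> F" "cmod (\<psi> y) < P x y + Q x y + e" using F(3) by blast
      then show ?thesis using \<phi>(2,3)[of x y] by linarith
    next
      case False
      then show ?thesis using K(2)[of y] nn[of y] e by fastforce
    qed
    define w where "w y = \<phi>\<^sub>1 y + \<phi>\<^sub>2 y + e" for y
    have wpos: "w y > 0" for y using nn[of y] e by (auto simp: w_def)
    have contw: "continuous_on UNIV w" "continuous_on UNIV \<phi>\<^sub>1" "continuous_on UNIV \<phi>\<^sub>2"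
      using \<phi>(1) by (auto simp: w_def adm_def intro!: continuous_intros)
    have part: "(\<lambda>y. complex_of_real (f y / w y) * \<psi> y) \<in> Cc" if "continuous_on UNIV f" for f
      using wpos by (intro Cc_mult_cont \<psi> continuous_intros that contw) (auto simp: less_le)
    have ratio: "cmod (complex_of_real (f y / w y) * \<psi> y) \<le> f y" if "f y \<ge> 0" for f y
    proof -
      have "cmod (complex_of_real (f y / w y) * \<psi> y) = f y * (cmod (\<psi> y) / w y)"
        using that wpos[of y] by (simp add: norm_mult norm_divide)
      also have "\<dots> \<le> f y * 1"
        using big[of y] wpos[of y] that by (intro mult_left_mono) (auto simp: w_def)
      finally show ?thesis by simp
    qed
    have sum: "\<psi> = (\<lambda>y. complex_of_real (\<phi>\<^sub>1 y / w y) * \<psi> y + (complex_of_real (\<phi>\<^sub>2 y / w y) * \<psi> y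
        + complex_of_real (e / w y) * \<psi> y))"
    proof
      fix y
      have "\<phi>\<^sub>1 y / w y + \<phi>\<^sub>2 y / w y + e / w y = 1"
        using wpos[of y] by (simp add: w_def add_divide_distrib[symmetric])
      then have "complex_of_real (\<phi>\<^sub>1 y / w y) + complex_of_real (\<phi>\<^sub>2 y / w y) + complex_of_real (e
          / w y) = 1"
        by (metis of_real_1 of_real_add)
      then show "\<psi> y = complex_of_real (\<phi>\<^sub>1 y / w y) * \<psi> y + (complex_of_real (\<phi>\<^sub>2 y / w y) * \<psi> y
        + complex_of_real (e / w y) * \<psi> y)"
        by (metis add.assoc distrib_right mult_1)
    qed
    let ?p = "\<lambda>f y. complex_of_real (f y / w y) * \<psi> y"
    have "\<mu> \<psi> = \<mu> (?p \<phi>\<^sub>1) + (\<mu> (?p \<phi>\<^sub>2) + \<mu> (?p (\<lambda>_. e)))"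
      by (subst sum, subst is_measure_add[OF \<mu> part Cc_add[OF part part]]; (subst is_measure_add[OF \<mu> part part])?)
         (use contw in auto)
    then have "cmod (\<mu> \<psi>) = cmod (\<mu> (?p \<phi>\<^sub>1) + (\<mu> (?p \<phi>\<^sub>2) + \<mu> (?p (\<lambda>_. e))))" by simp
    then have "cmod (\<mu> \<psi>) \<le> cmod (\<mu> (?p \<phi>\<^sub>1)) + cmod (\<mu> (?p \<phi>\<^sub>2)) + cmod (\<mu> (?p (\<lambda>_. e)))"
      using norm_triangle_ineq[of "\<mu> (?p \<phi>\<^sub>1)" "\<mu> (?p \<phi>\<^sub>2) + \<mu> (?p (\<lambda>_. e))"]
        norm_triangle_ineq[of "\<mu> (?p \<phi>\<^sub>2)" "\<mu> (?p (\<lambda>_. e))"] by linarith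
    moreover have "cmod (\<mu> (?p (\<lambda>_. e))) \<le> C * e"
      by (rule C(2)[OF part]) (use ratio[of "\<lambda>_. e"] K e in auto)
    ultimately have "cmod (\<mu> \<psi>) \<le> cmod (\<mu> (?p \<phi>\<^sub>1)) + cmod (\<mu> (?p \<phi>\<^sub>2)) + C * e" by linarith
    then have "ennreal (cmod (\<mu> \<psi>)) \<le> ennreal (cmod (\<mu> (?p \<phi>\<^sub>1)) + cmod (\<mu> (?p \<phi>\<^sub>2)) + C * e)"
      by (rule ennreal_leI)
    also have "\<dots> = ennreal (cmod (\<mu> (?p \<phi>\<^sub>1))) + ennreal (cmod (\<mu> (?p \<phi>\<^sub>2))) + ennreal (C * e)"
      using C e by (simp add: ennreal_plus)
    also have "\<dots> \<le> variation_lsc \<mu> g\<^sub>1 + variation_lsc \<mu> g\<^sub>2 + ennreal (C * e)"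
    proof (intro add_mono variation_lsc_upper part contw order_refl)
      fix y
      show "ennreal (cmod (?p \<phi>\<^sub>1 y)) \<le> g\<^sub>1 y"
        using ratio[OF nn(1)] \<phi>(1) by (meson adm_def ennreal_leI order_trans)
      show "ennreal (cmod (?p \<phi>\<^sub>2 y)) \<le> g\<^sub>2 y"
        using ratio[OF nn(2)] \<phi>(1) by (meson adm_def ennreal_leI order_trans)
    qed
    finally show ?thesis .
  qed
  show "ennreal (cmod (\<mu> \<psi>)) \<le> variation_lsc \<mu> g\<^sub>1 + variation_lsc \<mu> g\<^sub>2"
  proof (rule ennreal_le_epsilon)
    fix e :: real assume "e > 0"
    have "ennreal (cmod (\<mu> \<psi>)) \<le> variation_lsc \<mu> g\<^sub>1 + variation_lsc \<mu> g\<^sub>2 + ennreal (C * (e / (C + 1)))"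
      using \<open>e > 0\<close> C(1) by (intro split) auto
    also have "\<dots> \<le> variation_lsc \<mu> g\<^sub>1 + variation_lsc \<mu> g\<^sub>2 + ennreal e"
      using \<open>e > 0\<close> C(1) by (intro add_left_mono ennreal_leI) (auto simp: field_simps)
    finally show "ennreal (cmod (\<mu> \<psi>)) \<le> variation_lsc \<mu> g\<^sub>1 + variation_lsc \<mu> g\<^sub>2 + ennreal e" .
  qed
qed

lemma variation_lsc_zero:
  fixes \<mu> :: "'a::t2_space functional"
  assumes "is_measure \<mu>"
  shows "variation_lsc \<mu> (\<lambda>x. 0) = 0"
proof -
  have "variation_lsc \<mu> (\<lambda>x. 0) \<le> 0"
  proof (rule variation_lsc_least)
    fix \<psi> :: "'a \<Rightarrow> complex" assume "\<And>x. ennreal (cmod (\<psi> x)) \<le> 0"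
    then have "\<psi> = (\<lambda>_. 0)" by auto
    then show "ennreal (cmod (\<mu> \<psi>)) \<le> 0" using is_measure_zero[OF assms] by simp
  qed
  then show ?thesis by simp
qed

lemma variation_lsc_cmult:
  fixes \<mu> :: "'a::t2_space functional"
  assumes \<mu>: "is_measure \<mu>" and c: "0 \<le> c"
  shows "variation_lsc \<mu> (\<lambda>x. ennreal c * g x) \<le> ennreal c * variation_lsc \<mu> g"
proof (rule variation_lsc_least)
  fix \<psi> :: "'a \<Rightarrow> complex" assume \<psi>: "\<psi> \<in> Cc" "\<And>x. ennreal (cmod (\<psi> x)) \<le> ennreal c * g x"
  show "ennreal (cmod (\<mu> \<psi>)) \<le> ennreal c * variation_lsc \<mu> g"
  proof (cases "c = 0")
    case True
    then have "\<psi> = (\<lambda>_. 0)" using \<psi>(2) by auto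
    then show ?thesis using is_measure_zero[OF \<mu>] by simp
  next
    case False
    then have c: "c > 0" using c by simp
    let ?\<phi> = "\<lambda>x. complex_of_real (1/c) * \<psi> x"
    have "ennreal (cmod (?\<phi> x)) \<le> g x" for x
    proof -
      have "ennreal (cmod (?\<phi> x)) = ennreal (1/c) * ennreal (cmod (\<psi> x))"
        using c by (simp add: norm_mult norm_divide ennreal_mult[symmetric])
      also have "\<dots> \<le> ennreal (1/c) * (ennreal c * g x)" by (intro mult_left_mono \<psi>) auto
      also have "\<dots> = g x" using c by (simp add: mult.assoc[symmetric] ennreal_mult[symmetric])
      finally show ?thesis .
    qed
    then have "ennreal (cmod (\<mu> ?\<phi>)) \<le> variation_lsc \<mu> g"
      by (intro variation_lsc_upper Cc_cmult \<psi>)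
    then have "ennreal c * ennreal (cmod (\<mu> ?\<phi>)) \<le> ennreal c * variation_lsc \<mu> g"
      by (rule mult_left_mono) auto
    also have "ennreal c * ennreal (cmod (\<mu> ?\<phi>)) = ennreal (cmod (\<mu> \<psi>))"
      unfolding is_measure_cmult[OF \<mu> \<psi>(1)]
      using c by (simp add: norm_mult norm_divide ennreal_mult[symmetric])
    finally show ?thesis .
  qed
qed

text \<open>
  In \<open>ennreal\<close> the strict inequality \<open>c < g x + h x\<close> can be split into \<open>a < g x\<close> and \<open>b < h x\<close> with
  \<open>c < a + b\<close> when both values are positive; a vanishing summand is kept at \<open>0\<close> and imposes no
  condition.
\<close>

lemma lower_semicont_add:
  assumes "lower_semicont g" "lower_semicont h"
  shows "lower_semicont (\<lambda>x. g x + h x)"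
  unfolding lower_semicont_def
proof
  fix c
  show "open {x. c < g x + h x}"
  proof (subst open_subopen, safe)
    fix x assume c: "c < g x + h x"
    have "\<exists>a b. (a < g x \<or> a = 0) \<and> (b < h x \<or> b = 0) \<and> c < a + b"
    proof -
      consider "g x = 0" | "h x = 0" | "g x > 0" "h x > 0" using zero_less_iff_neq_zero by blast
      then show ?thesis
      proof cases
        case 1
        then obtain b where "c < b" "b < h x" using c dense by auto
        then show ?thesis by (intro exI[of _ 0] exI[of _ b]) auto
      next
        case 2
        then obtain b where "c < b" "b < g x" using c dense by auto
        then show ?thesis by (intro exI[of _ b] exI[of _ 0]) auto
      next
        case 3
        have sup: "(SUP a\<in>{..<y}. a) = y" for y :: ennreal
          by (rule antisym) (auto intro: SUP_least dense_le SUP_upper less_imp_le)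
        have "c < (SUP a\<in>{..<g x}. a) + h x" using c sup by simp
        also have "\<dots> = (SUP a\<in>{..<g x}. a + h x)" using 3 by (subst ennreal_SUP_add_left) auto
        finally obtain a where a: "a < g x" "c < a + h x" unfolding less_SUP_iff by auto
        have "c < (SUP b\<in>{..<h x}. b) + a" using a sup by (simp add: add.commute)
        also have "\<dots> = (SUP b\<in>{..<h x}. b + a)" using 3 by (subst ennreal_SUP_add_left) auto
        finally obtain b where "b < h x" "c < b + a" unfolding less_SUP_iff by auto
        with a show ?thesis by (intro exI[of _ a] exI[of _ b]) (auto simp: add.commute)
      qed
    qed
    then obtain a b where ab: "a < g x \<or> a = 0" "b < h x \<or> b = 0" "c < a + b" by blast
    define U where "U = (if a = 0 then UNIV else {y. a < g y})"
    define V where "V = (if b = 0 then UNIV else {y. b < h y})"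
    have "open (U \<inter> V)" using assms by (auto simp: U_def V_def lower_semicont_def)
    moreover have "x \<in> U \<inter> V" using ab by (auto simp: U_def V_def)
    moreover have "c < g y + h y" if "y \<in> U \<inter> V" for y
    proof -
      have "a + b \<le> g y + h y" using that by (intro add_mono) (auto simp: U_def V_def split: if_splits)
      then show ?thesis using ab by simp
    qed
    ultimately show "\<exists>T. open T \<and> x \<in> T \<and> T \<subseteq> {x. c < g x + h x}"
      by (intro exI[of _ "U \<inter> V"]) auto
  qed
qed


section \<open>Restriction to open sets with compact closure\<close>

lemma variation_upper_integral_ge:
  assumes "\<psi> \<in> Cc" "\<And>x. ennreal (cmod (\<psi> x)) \<le> f x"
  shows "ennreal (cmod (\<mu> \<psi>)) \<le> variation_upper_integral \<mu> f"
  unfolding variation_upper_integral_def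
  by (rule INF_greatest) (auto intro!: variation_lsc_upper assms intro: order_trans[OF assms(2)])

lemma variation_upper_integral_le:
  assumes "lower_semicont g" "\<And>x. f x \<le> g x"
  shows "variation_upper_integral \<mu> f \<le> variation_lsc \<mu> g"
  unfolding variation_upper_integral_def by (rule INF_lower) (use assms in auto)

lemma has_integral_against_unique:
  fixes \<mu> :: "'a::t2_space functional"
  assumes lc: "locally_compact_space (euclidean :: 'a topology)" and \<mu>: "is_measure \<mu>"
    and c: "has_integral_against \<mu> f c" and d: "has_integral_against \<mu> f d"
  shows "c = d"
proof -
  have *: "\<exists>\<phi>\<in>Cc. \<exists>g. lower_semicont g \<and> (\<forall>x. ennreal (cmod (f x - \<phi> x)) \<le> g x)
      \<and> variation_lsc \<mu> g < ennreal e \<and> cmod (\<mu> \<phi> - c) < e"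
    if "has_integral_against \<mu> f c" "e > 0" for c e
    using that unfolding has_integral_against_def variation_upper_integral_def INF_less_iff by fastforce
  have "dist c d \<le> e" if e: "e > 0" for e
  proof -
    have e4: "e/4 > 0" using e by simp
    obtain \<phi> g where 1: "\<phi> \<in> Cc" "lower_semicont g" "\<And>x. ennreal (cmod (f x - \<phi> x)) \<le> g x"
      "variation_lsc \<mu> g < ennreal (e/4)" "cmod (\<mu> \<phi> - c) < e/4"
      using *[OF c e4] by blast
    obtain \<psi> h where 2: "\<psi> \<in> Cc" "lower_semicont h" "\<And>x. ennreal (cmod (f x - \<psi> x)) \<le> h x"
      "variation_lsc \<mu> h < ennreal (e/4)" "cmod (\<mu> \<psi> - d) < e/4"
      using *[OF d e4] by blast
    have "ennreal (cmod (\<phi> x - \<psi> x)) \<le> g x + h x" for x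
    proof -
      have "cmod (\<phi> x - \<psi> x) \<le> cmod (f x - \<phi> x) + cmod (f x - \<psi> x)"
        by (metis norm_minus_commute norm_triangle_sub dist_norm dist_triangle)
      then have "ennreal (cmod (\<phi> x - \<psi> x)) \<le> ennreal (cmod (f x - \<phi> x)) + ennreal (cmod (f x - \<psi> x))"
        by (metis ennreal_leI ennreal_plus norm_ge_zero)
      then show ?thesis using add_mono[OF 1(3) 2(3)] order_trans by blast
    qed
    then have "ennreal (cmod (\<mu> (\<lambda>x. \<phi> x - \<psi> x))) \<le> variation_lsc \<mu> (\<lambda>x. g x + h x)"
      by (intro variation_lsc_upper Cc_diff 1 2)
    also have "\<dots> \<le> variation_lsc \<mu> g + variation_lsc \<mu> h"
      by (rule variation_lsc_add[OF lc \<mu> 1(2) 2(2)])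
    also have "\<dots> \<le> ennreal (e/4) + ennreal (e/4)"
      using 1(4) 2(4) by (intro add_mono) auto
    also have "\<dots> = ennreal (e/2)" using e by (simp flip: ennreal_plus)
    finally have "cmod (\<mu> \<phi> - \<mu> \<psi>) \<le> e/2"
      using e by (simp add: is_measure_diff[OF \<mu> 1(1) 2(1)] ennreal_le_iff)
    moreover have "dist c d \<le> dist c (\<mu> \<phi>) + dist (\<mu> \<phi>) (\<mu> \<psi>) + dist (\<mu> \<psi>) d"
      using dist_triangle[of c d "\<mu> \<phi>"] dist_triangle[of "\<mu> \<phi>" d "\<mu> \<psi>"] by linarith
    ultimately show ?thesis using 1(5) 2(5) by (simp add: dist_norm norm_minus_commute)
  qed
  then show ?thesis using dist_le_zero_iff field_le_epsilon[of "dist c d" 0] by fastforce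
qed

lemma integral_against_eqI:
  fixes \<mu> :: "'a::t2_space functional"
  assumes "locally_compact_space (euclidean :: 'a topology)" "is_measure \<mu>" "has_integral_against \<mu> f c"
  shows "integral_against \<mu> f = c"
  unfolding integral_against_def using assms has_integral_against_unique by blast

lemma integral_against_Cc:
  fixes \<mu> :: "'a::t2_space functional"
  assumes "locally_compact_space (euclidean :: 'a topology)" "is_measure \<mu>" "\<phi> \<in> Cc"
  shows "integral_against \<mu> \<phi> = \<mu> \<phi>"
proof (rule integral_against_eqI[OF assms(1,2)])
  have "variation_upper_integral \<mu> (\<lambda>x. 0) \<le> variation_lsc \<mu> (\<lambda>x. 0)"
    by (rule variation_upper_integral_le) (auto simp: lower_semicont_def)
  also have "\<dots> = 0" by (rule variation_lsc_zero[OF assms(2)])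
  finally have 0: "variation_upper_integral \<mu> (\<lambda>x. 0) = 0" by simp
  show "has_integral_against \<mu> \<phi> (\<mu> \<phi>)"
    unfolding has_integral_against_def
    by (intro allI impI bexI[of _ \<phi>] assms(3)) (auto simp: 0)
qed

text \<open>
  For open \<open>A\<close> with compact closure the variation of \<open>A\<close> is finite. Choose \<open>\<psi>\<close> with \<open>|\<psi>| \<le> 1\<^sub>A\<close> for
  which \<open>|\<mu>(\<psi>)|\<close> nearly attains it and put \<open>h = |\<psi>|\<close>. A function \<open>\<eta>\<close> with \<open>|\<eta>| \<le> 1\<^sub>A - h\<close>,
  multiplied by a suitable phase, can be added to \<open>\<psi>\<close>, and \<open>|\<mu>(\<psi>)| + |\<mu>(\<eta>)|\<close> stays below the
  variation of \<open>A\<close>; so \<open>|\<mu>(\<eta>)|\<close> is small.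
\<close>

lemma restrict_cutoff:
  fixes \<mu> :: "'a::t2_space functional"
  assumes \<mu>: "is_measure \<mu>" and A: "open A" "compact (closure A)" and e: "e > 0"
  obtains h :: "'a \<Rightarrow> real" where "continuous_on UNIV h" "\<And>x. 0 \<le> h x" "\<And>x. h x \<le> indicator A x"
    "variation_lsc \<mu> (\<lambda>x. ennreal (indicator A x - h x)) \<le> ennreal e"
proof -
  let ?P = "\<lambda>\<psi>. \<psi> \<in> Cc \<and> (\<forall>x. cmod (\<psi> x) \<le> indicator A x)"
  obtain C where C: "C \<ge> 0" "\<And>\<phi> B. \<phi> \<in> Cc \<Longrightarrow> (\<And>x. \<phi> x \<noteq> 0 \<Longrightarrow> x \<in> closure A) \<Longrightarrow>
      (\<And>x. cmod (\<phi> x) \<le> B) \<Longrightarrow> cmod (\<mu> \<phi>) \<le> C * B"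
    using is_measure_bound[OF \<mu> A(2)] by blast
  have bd: "cmod (\<mu> \<psi>) \<le> C" if \<psi>: "?P \<psi>" for \<psi>
  proof -
    have "cmod (\<mu> \<psi>) \<le> C * 1"
    proof (rule C(2))
      show "x \<in> closure A" if "\<psi> x \<noteq> 0" for x
      proof -
        have "0 < cmod (\<psi> x)" "cmod (\<psi> x) \<le> indicator A x" using that \<psi> by auto
        then have "x \<in> A" by (cases "x \<in> A") auto
        then show ?thesis using closure_subset by blast
      qed
      show "cmod (\<psi> x) \<le> 1" for x
        using \<psi> order_trans[of "cmod (\<psi> x)" "indicator A x" 1] by (auto simp: indicator_def)
    qed (use \<psi> in auto)
    then show ?thesis by simp
  qed
  define v where "v = (SUP \<psi>\<in>Collect ?P. cmod (\<mu> \<psi>))"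
  have bdd: "bdd_above ((\<lambda>\<psi>. cmod (\<mu> \<psi>)) ` Collect ?P)" using bd by (auto intro!: bdd_aboveI2[of _ _ C])
  have v: "cmod (\<mu> \<psi>) \<le> v" if "?P \<psi>" for \<psi>
    unfolding v_def by (rule cSUP_upper[OF _ bdd]) (use that in auto)
  have "?P (\<lambda>_. 0)" by auto
  then have "Collect ?P \<noteq> {}" by blast
  then obtain \<psi> where \<psi>: "?P \<psi>" "v - e < cmod (\<mu> \<psi>)"
    using less_cSUP_iff[OF _ bdd, of "v - e"] e unfolding v_def[symmetric] by auto
  show ?thesis
  proof (rule that[of "\<lambda>x. cmod (\<psi> x)"])
    show "continuous_on UNIV (\<lambda>x. cmod (\<psi> x))" using \<psi> by (intro continuous_intros Cc_cont) auto
    show "variation_lsc \<mu> (\<lambda>x. ennreal (indicator A x - cmod (\<psi> x))) \<le> ennreal e"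
    proof (rule variation_lsc_least)
      fix \<eta> :: "'a \<Rightarrow> complex"
      assume \<eta>: "\<eta> \<in> Cc" "\<And>x. ennreal (cmod (\<eta> x)) \<le> ennreal (indicator A x - cmod (\<psi> x))"
      have \<eta>': "cmod (\<eta> x) \<le> indicator A x - cmod (\<psi> x)" for x
        using \<eta>(2)[of x] \<psi>(1) by (simp add: ennreal_le_iff)
      \<comment> \<open>the phase that aligns the two values\<close>
      obtain c where c: "cmod c = 1" "cmod (\<mu> \<psi> + c * \<mu> \<eta>) = cmod (\<mu> \<psi>) + cmod (\<mu> \<eta>)"
      proof -
        have ex: "\<exists>w. cmod w = 1 \<and> z = complex_of_real (cmod z) * w" for z
        proof (cases "z = 0")
          case False
          then show ?thesis by (intro exI[of _ "sgn z"]) (auto simp: sgn_eq norm_divide)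
        qed (auto intro!: exI[of _ 1])
        obtain w where w: "cmod w = 1" "\<mu> \<psi> = complex_of_real (cmod (\<mu> \<psi>)) * w" using ex[of "\<mu> \<psi>"]
            by auto
        obtain u where u: "cmod u = 1" "\<mu> \<eta> = complex_of_real (cmod (\<mu> \<eta>)) * u" using ex[of "\<mu> \<eta>"]
            by auto
        have uu: "u * cnj u = 1" using u(1) complex_norm_square[of u] by simp
        have "w * cnj u * \<mu> \<eta> = w * cnj u * (complex_of_real (cmod (\<mu> \<eta>)) * u)" using u(2) by simp
        also have "\<dots> = complex_of_real (cmod (\<mu> \<eta>)) * w * (u * cnj u)" by (simp only: ac_simps)
        finally have "\<mu> \<psi> + w * cnj u * \<mu> \<eta> = complex_of_real (cmod (\<mu> \<psi>)) * w
            + complex_of_real (cmod (\<mu> \<eta>)) * w"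
          using uu w(2) by simp
        also have "\<dots> = complex_of_real (cmod (\<mu> \<psi>) + cmod (\<mu> \<eta>)) * w" by (simp add: distrib_right)
        finally have "cmod (\<mu> \<psi> + w * cnj u * \<mu> \<eta>) = cmod (\<mu> \<psi>) + cmod (\<mu> \<eta>)"
          using w(1) by (simp only: norm_mult norm_of_real) simp
        then show thesis using that[of "w * cnj u"] w(1) u(1) by (simp add: norm_mult)
      qed
      have "?P (\<lambda>x. \<psi> x + c * \<eta> x)"
      proof (intro conjI allI Cc_add Cc_cmult)
        fix x
        show "cmod (\<psi> x + c * \<eta> x) \<le> indicator A x"
          using norm_triangle_ineq[of "\<psi> x" "c * \<eta> x"] c(1) \<eta>'[of x] by (simp add: norm_mult)
      qed (use \<psi> \<eta> in auto)
      from v[OF this] have "cmod (\<mu> \<psi>) + cmod (\<mu> \<eta>) \<le> v"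
        using \<psi> \<eta> c by (simp add: is_measure_add[OF \<mu> _ Cc_cmult] is_measure_cmult[OF \<mu>])
      then show "ennreal (cmod (\<mu> \<eta>)) \<le> ennreal e" using \<psi>(2) by (intro ennreal_leI) linarith
    qed
  qed (use \<psi> in auto)
qed

text \<open>
  The restriction to \<open>A\<close> is a limit of the functionals \<open>\<phi> \<mapsto> \<mu>(h \<phi>)\<close>, with the same cutoff \<open>h\<close> for
  all \<open>\<phi>\<close>. The uniformity in \<open>\<phi>\<close> lets linearity and all norm bounds pass from \<open>\<mu>\<close> to its
  restriction.
\<close>

lemma restrict_functional_approx:
  fixes \<mu> :: "'a::t2_space functional"
  assumes lc: "locally_compact_space (euclidean :: 'a topology)"
    and \<mu>: "is_measure \<mu>" and A: "open A" "compact (closure A)" and e: "e > 0"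
  shows "\<exists>h :: 'a \<Rightarrow> real. continuous_on UNIV h \<and> (\<forall>x. 0 \<le> h x \<and> h x \<le> indicator A x) \<and>
    (\<forall>\<phi>\<in>Cc. \<forall>B. (\<forall>x. cmod (\<phi> x) \<le> B) \<longrightarrow>
       cmod (restrict_functional \<mu> A \<phi> - \<mu> (cutoff h \<phi>)) \<le> e * B)"
proof -
  let ?good = "\<lambda>h n. continuous_on UNIV h \<and> (\<forall>x. 0 \<le> h x \<and> h x \<le> indicator A x) \<and>
     variation_lsc \<mu> (\<lambda>x. ennreal (indicator A x - h x)) \<le> ennreal (1 / Suc n)"
  have "\<exists>h :: 'a \<Rightarrow> real. ?good h n" for n
    using restrict_cutoff[OF \<mu> A, of "1 / Suc n"]
        by (metis of_nat_0_less_iff zero_less_Suc zero_less_divide_1_iff)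
  then obtain h :: "nat \<Rightarrow> 'a \<Rightarrow> real" where h: "\<And>n. ?good (h n) n" by metis
  have lsc: "lower_semicont (\<lambda>x. ennreal b * ennreal (indicator A x - h n x))" for n b
    unfolding lower_semicont_def
  proof
    fix c
    have eq: "ennreal b * ennreal (indicator A x - h n x) = (if x \<in> A then ennreal (max 0 b
        * (1 - h n x)) else 0)" for x
    proof -
      have "h n x \<le> indicator A x" using h by auto
      then have "ennreal (max 0 b) * ennreal (indicator A x - h n x) = ennreal (max 0 b
          * (indicator A x - h n x))"
        by (intro ennreal_mult[symmetric]) auto
      moreover have "ennreal (max 0 b) = ennreal b" by (simp add: max_def ennreal_neg)
      moreover have "h n x \<ge> 0" using h by auto
      ultimately show ?thesis by (auto simp: indicator_def intro!: ennreal_neg mult_nonneg_nonpos)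
    qed
    have "{x. c < ennreal b * ennreal (indicator A x - h n x)} = A \<inter> {x. c < ennreal (max 0 b
        * (1 - h n x))}"
      unfolding eq by auto
    also have "open \<dots>"
      using h[of n] A
      by (intro open_Int open_Collect_less continuous_intros continuous_on_ennreal) auto
    finally show "open {x. c < ennreal b * ennreal (indicator A x - h n x)}" .
  qed
  have vle: "variation_lsc \<mu> (\<lambda>x. ennreal B * ennreal (indicator A x - h n x)) \<le> ennreal (B
      / Suc n)" if "B \<ge> 0" for B n
  proof -
    have "variation_lsc \<mu> (\<lambda>x. ennreal B * ennreal (indicator A x - h n x)) \<le> ennreal B
        * ennreal (1 / Suc n)"
      by (rule order_trans[OF variation_lsc_cmult[OF \<mu> that] mult_left_mono]) (use h in auto)
    then show ?thesis using that by (simp add: ennreal_mult[symmetric])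
  qed
  let ?m = "\<lambda>n \<phi>. \<mu> (cutoff (h n) \<phi>)"
  have Cc: "cutoff (h n) \<phi> \<in> Cc" if "\<phi> \<in> Cc" for n \<phi>
    using h[of n] that by (intro Cc_mult_cont continuous_intros) auto
  \<comment> \<open>the approximations form a Cauchy sequence, since \<open>|h\<^sub>n - h\<^sub>k| \<le> (1\<^sub>A - h\<^sub>n) + (1\<^sub>A - h\<^sub>k)\<close>\<close>
  have near: "cmod (?m n \<phi> - ?m k \<phi>) \<le> B / Suc n + B / Suc k"
    if \<phi>: "\<phi> \<in> Cc" "\<And>x. cmod (\<phi> x) \<le> B" for \<phi> B n k
  proof -
    have B: "B \<ge> 0" using \<phi>(2) norm_ge_zero order_trans by blast
    have "ennreal (cmod (complex_of_real (h n x) * \<phi> x - complex_of_real (h k x) * \<phi> x))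
      \<le> ennreal B * ennreal (indicator A x - h n x) + ennreal B * ennreal (indicator A x - h k x)" for x
    proof -
      have hx: "h n x \<le> indicator A x" "h k x \<le> indicator A x" using h by auto
      have "cmod (complex_of_real (h n x) * \<phi> x - complex_of_real (h k x) * \<phi> x) = \<bar>h n x - h k x\<bar>
          * cmod (\<phi> x)"
        by (metis left_diff_distrib norm_mult norm_of_real of_real_diff)
      also have "\<dots> \<le> ((indicator A x - h n x) + (indicator A x - h k x)) * B"
        using hx by (intro mult_mono \<phi>) (auto simp: abs_le_iff)
      finally have "ennreal (cmod (complex_of_real (h n x) * \<phi> x - complex_of_real (h k x) * \<phi> x))
          \<le> ennreal (B * (indicator A x - h n x) + B * (indicator A x - h k x))"
        by (intro ennreal_leI) (simp add: algebra_simps)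
      also have "\<dots> = ennreal B * ennreal (indicator A x - h n x) + ennreal B
          * ennreal (indicator A x - h k x)"
        using hx B by (simp add: ennreal_mult)
      finally show ?thesis .
    qed
    then have "ennreal (cmod (\<mu> (\<lambda>x. complex_of_real (h n x) * \<phi> x - complex_of_real (h k x) * \<phi> x)))
      \<le> variation_lsc \<mu> (\<lambda>x. ennreal B * ennreal (indicator A x - h n x) + ennreal B
          * ennreal (indicator A x - h k x))"
      by (intro variation_lsc_upper Cc_diff Cc \<phi>)
    also have "\<dots> \<le> ennreal (B / Suc n) + ennreal (B / Suc k)"
      by (rule order_trans[OF variation_lsc_add[OF lc \<mu> lsc lsc] add_mono[OF vle[OF B] vle[OF B]]])
    also have "\<dots> = ennreal (B / Suc n + B / Suc k)" using B by simp
    finally show ?thesis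
      using B by (subst (asm) is_measure_diff[OF \<mu> Cc Cc]) (auto simp: \<phi> ennreal_le_iff simp del: ennreal_plus)
  qed
  have main: "cmod (restrict_functional \<mu> A \<phi> - ?m n \<phi>) \<le> B / Suc n"
    if \<phi>: "\<phi> \<in> Cc" "\<And>x. cmod (\<phi> x) \<le> B" for \<phi> B n
  proof -
    have B: "B \<ge> 0" using \<phi>(2) norm_ge_zero order_trans by blast
    have lim0: "(\<lambda>n. B / real (Suc n)) \<longlonglongrightarrow> 0"
      by (rule LIMSEQ_Suc[OF lim_const_over_n])
    have "Cauchy (\<lambda>n. ?m n \<phi>)"
    proof (rule metric_CauchyI)
      fix e :: real assume "e > 0"
      then have "\<forall>\<^sub>F n in sequentially. B / real (Suc n) < e/2" using lim0 by (intro order_tendstoD) auto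
      then obtain N where N: "\<And>n. n \<ge> N \<Longrightarrow> B / real (Suc n) < e/2" by (auto simp: eventually_sequentially)
      show "\<exists>M. \<forall>m\<ge>M. \<forall>n\<ge>M. dist (?m m \<phi>) (?m n \<phi>) < e"
      proof (intro exI[of _ N] allI impI)
        fix m n assume "m \<ge> N" "n \<ge> N"
        then show "dist (?m m \<phi>) (?m n \<phi>) < e"
          using N[of m] N[of n] near[OF \<phi>, of m n] unfolding dist_norm by linarith
      qed
    qed
    then obtain c where c: "(\<lambda>n. ?m n \<phi>) \<longlonglongrightarrow> c"
      using Cauchy_convergent convergent_def by blast
    have cb: "cmod (c - ?m n \<phi>) \<le> B / Suc n" for n
    proof (rule tendsto_le[of sequentially])
      show "(\<lambda>k. cmod (?m k \<phi> - ?m n \<phi>)) \<longlonglongrightarrow> cmod (c - ?m n \<phi>)" by (intro tendsto_intros c)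
      show "(\<lambda>k. B / Suc k + B / Suc n) \<longlonglongrightarrow> B / Suc n"
        using tendsto_add[OF lim0 tendsto_const] by simp
    qed (use near[OF \<phi>] in \<open>auto intro!: always_eventually simp del: of_nat_Suc\<close>)
    have "has_integral_against \<mu> (\<lambda>x. indicator A x * \<phi> x) c"
      unfolding has_integral_against_def
    proof (intro allI impI)
      fix e :: real assume "e > 0"
      then have "\<forall>\<^sub>F n in sequentially. B / real (Suc n) < e" using lim0 by (intro order_tendstoD) auto
      then obtain n where n: "B / real (Suc n) < e" by (auto simp: eventually_sequentially)
      have "variation_upper_integral \<mu> (\<lambda>x. ennreal (cmod (indicator A x
          * \<phi> x - complex_of_real (h n x) * \<phi> x)))
        \<le> variation_lsc \<mu> (\<lambda>x. ennreal B * ennreal (indicator A x - h n x))"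
      proof (rule variation_upper_integral_le[OF lsc])
        fix x
        have "cmod (indicator A x * \<phi> x - complex_of_real (h n x) * \<phi> x)
            = cmod (complex_of_real (indicator A x - h n x) * \<phi> x)"
          by (simp add: indicator_def algebra_simps)
        also have "\<dots> = (indicator A x - h n x) * cmod (\<phi> x)"
          using h[of n] by (simp only: norm_mult norm_of_real) simp
        also have "\<dots> \<le> (indicator A x - h n x) * B" using h[of n] by (intro mult_left_mono \<phi>) simp
        finally show "ennreal (cmod (indicator A x * \<phi> x - complex_of_real (h n x) * \<phi> x))
            \<le> ennreal B * ennreal (indicator A x - h n x)"
          using B h[of n] by (simp add: ennreal_mult[symmetric] mult.commute)
      qed
      also have "\<dots> \<le> ennreal (B / Suc n)" by (rule vle[OF B])
      also have "\<dots> < ennreal e" using n B by (intro ennreal_lessI) (auto simp: \<open>e > 0\<close>)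
      finally show "\<exists>\<psi>\<in>Cc. variation_upper_integral \<mu> (\<lambda>x. ennreal (cmod (indicator A x
          * \<phi> x - \<psi> x))) < ennreal e
                   \<and> cmod (\<mu> \<psi> - c) < e"
        using cb[of n] n by (intro bexI[OF _ Cc[OF \<phi>(1), of n]]) (auto simp: norm_minus_commute)
    qed
    from integral_against_eqI[OF lc \<mu> this] show ?thesis using cb[of n]
        by (simp add: restrict_functional_def)
  qed
  obtain n where n: "1 / real (Suc n) < e" using e nat_approx_posE by blast
  have "cmod (restrict_functional \<mu> A \<phi> - ?m n \<phi>) \<le> e * B"
    if \<phi>: "\<phi> \<in> Cc" "\<forall>x. cmod (\<phi> x) \<le> B" for \<phi> B
  proof -
    have B: "B \<ge> 0" using \<phi>(2) norm_ge_zero order_trans by blast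
    have "B / Suc n \<le> e * B" using mult_right_mono[OF less_imp_le[OF n] B] by simp
    moreover have "cmod (restrict_functional \<mu> A \<phi> - ?m n \<phi>) \<le> B / Suc n"
      by (rule main) (use \<phi> in auto)
    ultimately show ?thesis by linarith
  qed
  then show ?thesis using h[of n] by (intro exI[of _ "h n"]) auto
qed

lemma norm_cutoff_le:
  fixes z :: complex
  assumes "0 \<le> r" "r \<le> indicator A x" "cmod z \<le> B"
  shows "cmod (complex_of_real r * z) \<le> B"
proof -
  have "r \<le> 1" using order_trans[OF assms(2) indicator_le_1] .
  then have "r * cmod z \<le> 1 * cmod z" by (rule mult_right_mono) simp
  then show ?thesis using assms(1,3) by (simp add: norm_mult)
qed

lemma restrict_functional_le:
  fixes \<mu> :: "'a::t2_space functional"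
  assumes lc: "locally_compact_space (euclidean :: 'a topology)"
    and \<mu>: "is_measure \<mu>" and A: "open A" "compact (closure A)" and \<phi>: "\<phi> \<in> Cc"
    and C: "\<And>h :: 'a \<Rightarrow> real. continuous_on UNIV h \<Longrightarrow> (\<And>x. 0 \<le> h x) \<Longrightarrow> (\<And>x. h x \<le> indicator A x)
        \<Longrightarrow> cmod (\<mu> (cutoff h \<phi>)) \<le> C"
  shows "cmod (restrict_functional \<mu> A \<phi>) \<le> C"
proof (rule field_le_epsilon)
  fix e :: real assume e: "e > 0"
  obtain B where B: "B \<ge> 0" "\<And>x. cmod (\<phi> x) \<le> B" using Cc_bounded[OF \<phi>] by blast
  have eB: "e / (B + 1) > 0" using e B by simp
  obtain h :: "'a \<Rightarrow> real" where h: "continuous_on UNIV h" "\<forall>x. 0 \<le> h x \<and> h x \<le> indicator A x"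
    "cmod (restrict_functional \<mu> A \<phi> - \<mu> (cutoff h \<phi>)) \<le> e / (B + 1) * B"
    using restrict_functional_approx[OF lc \<mu> A eB] \<phi> B(2) by blast
  have "cmod (\<mu> (cutoff h \<phi>)) \<le> C" by (rule C) (use h in auto)
  moreover have "e / (B + 1) * B \<le> e" using B e by (simp add: field_simps)
  ultimately show "cmod (restrict_functional \<mu> A \<phi>) \<le> C + e"
    using h(3) norm_triangle_sub[of "restrict_functional \<mu> A \<phi>" "\<mu> (cutoff h \<phi>)"]
    by linarith
qed

lemma restrict_functional_zero:
  fixes \<mu> :: "'a::t2_space functional"
  assumes "locally_compact_space (euclidean :: 'a topology)"
    and \<mu>: "is_measure \<mu>" and "open A" "compact (closure A)" "\<phi> \<in> Cc" and z: "\<And>x. x \<in> A \<Longrightarrow> \<phi> x = 0"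
  shows "restrict_functional \<mu> A \<phi> = 0"
proof -
  have "cmod (restrict_functional \<mu> A \<phi>) \<le> 0"
  proof (rule restrict_functional_le[OF assms(1-5)])
    fix h :: "'a \<Rightarrow> real" assume h: "\<And>x. 0 \<le> h x" "\<And>x. h x \<le> indicator A x"
    have "h x * cmod (\<phi> x) = 0" for x
    proof (cases "x \<in> A")
      case False
      then have "h x \<le> 0" using h(2)[of x] by simp
      then show ?thesis using h(1)[of x] by simp
    qed (simp add: z)
    then have "cutoff h \<phi> = (\<lambda>_. 0)" by (intro ext) simp
    then have "\<mu> (cutoff h \<phi>) = 0" by (simp only: is_measure_zero[OF \<mu>])
    then show "cmod (\<mu> (cutoff h \<phi>)) \<le> 0" by (simp only: norm_zero order_refl)
  qed
  then show ?thesis by simp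
qed

lemma norm_zero_of_epsilon:
  fixes z :: complex
  assumes "\<And>e. e > 0 \<Longrightarrow> cmod z \<le> D * e"
  shows "z = 0"
proof -
  have "((\<lambda>e. D * e) \<longlongrightarrow> D * 0) (at_right 0)" by (intro tendsto_intros)
  then have "cmod z \<le> D * 0"
    by (rule tendsto_lowerbound) (auto intro!: eventually_at_right_less[THEN eventually_mono] assms)
  then show ?thesis by simp
qed

lemma is_measure_restrict:
  fixes \<mu> :: "'a::t2_space functional"
  assumes lc: "locally_compact_space (euclidean :: 'a topology)"
    and \<mu>: "is_measure \<mu>" and A: "open A" "compact (closure A)"
  shows "is_measure (restrict_functional \<mu> A)"
proof -
  let ?M = "restrict_functional \<mu> A"
  have Cch: "cutoff h \<phi> \<in> Cc"
    if "continuous_on UNIV h" "\<phi> \<in> Cc" for h and \<phi> :: "'a \<Rightarrow> complex"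
    using that by (intro Cc_mult_cont continuous_on_of_real)
  show ?thesis
  proof (rule is_measureI)
    fix \<phi> \<psi> :: "'a \<Rightarrow> complex" assume \<phi>: "\<phi> \<in> Cc" "\<psi> \<in> Cc"
    obtain B where B: "B \<ge> 0" "\<And>x. cmod (\<phi> x) \<le> B" using Cc_bounded[OF \<phi>(1)] by blast
    obtain D where D: "D \<ge> 0" "\<And>x. cmod (\<psi> x) \<le> D" using Cc_bounded[OF \<phi>(2)] by blast
    have BD: "cmod (\<phi> x + \<psi> x) \<le> B + D" for x
      using norm_triangle_mono[OF B(2) D(2)] by blast
    have "?M (\<lambda>x. \<phi> x + \<psi> x) - (?M \<phi> + ?M \<psi>) = 0"
    proof (rule norm_zero_of_epsilon)
      fix e :: real assume e: "e > 0"
      obtain h :: "'a \<Rightarrow> real" where h: "continuous_on UNIV h"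
        "\<forall>\<phi>\<in>Cc. \<forall>B. (\<forall>x. cmod (\<phi> x) \<le> B) \<longrightarrow>
           cmod (?M \<phi> - \<mu> (cutoff h \<phi>)) \<le> e * B"
        using restrict_functional_approx[OF lc \<mu> A e] by blast
      have "\<mu> (\<lambda>x. complex_of_real (h x) * (\<phi> x + \<psi> x)) =
          \<mu> (cutoff h \<phi>) + \<mu> (cutoff h \<psi>)"
        using is_measure_add[OF \<mu> Cch[OF h(1) \<phi>(1)] Cch[OF h(1) \<phi>(2)]] by (simp add: distrib_left)
      then have "?M (\<lambda>x. \<phi> x + \<psi> x) - (?M \<phi> + ?M \<psi>) =
          (?M (\<lambda>x. \<phi> x + \<psi> x) - \<mu> (\<lambda>x. complex_of_real (h x) * (\<phi> x + \<psi> x)))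
          - (?M \<phi> - \<mu> (cutoff h \<phi>)) - (?M \<psi> - \<mu> (cutoff h \<psi>))" by simp
      also have "cmod \<dots> \<le> e * (B + D) + e * B + e * D"
        by (intro order_trans[OF norm_triangle_ineq4] add_mono h(2)[rule_format] Cc_add \<phi> B D BD)
      finally show "cmod (?M (\<lambda>x. \<phi> x + \<psi> x) - (?M \<phi> + ?M \<psi>)) \<le> (2 * (B + D)) * e"
        by (simp add: algebra_simps)
    qed
    then show "?M (\<lambda>x. \<phi> x + \<psi> x) = ?M \<phi> + ?M \<psi>" by simp
  next
    fix c and \<phi> :: "'a \<Rightarrow> complex" assume \<phi>: "\<phi> \<in> Cc"
    obtain B where B: "B \<ge> 0" "\<And>x. cmod (\<phi> x) \<le> B" using Cc_bounded[OF \<phi>] by blast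
    have cB: "cmod (c * \<phi> x) \<le> cmod c * B" for x
      using B by (simp add: norm_mult mult_left_mono)
    have "?M (\<lambda>x. c * \<phi> x) - c * ?M \<phi> = 0"
    proof (rule norm_zero_of_epsilon)
      fix e :: real assume e: "e > 0"
      obtain h :: "'a \<Rightarrow> real" where h: "continuous_on UNIV h"
        "\<forall>\<phi>\<in>Cc. \<forall>B. (\<forall>x. cmod (\<phi> x) \<le> B) \<longrightarrow>
           cmod (?M \<phi> - \<mu> (cutoff h \<phi>)) \<le> e * B"
        using restrict_functional_approx[OF lc \<mu> A e] by blast
      have "\<mu> (\<lambda>x. complex_of_real (h x) * (c * \<phi> x)) = c * \<mu> (cutoff h \<phi>)"
        using is_measure_cmult[OF \<mu> Cch[OF h(1) \<phi>], of c] by (simp add: algebra_simps)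
      then have eq: "?M (\<lambda>x. c * \<phi> x) - c * ?M \<phi> =
          (?M (\<lambda>x. c * \<phi> x) - \<mu> (\<lambda>x. complex_of_real (h x) * (c * \<phi> x)))
          - c * (?M \<phi> - \<mu> (cutoff h \<phi>))" by (simp add: algebra_simps)
      have "cmod (?M (\<lambda>x. c * \<phi> x) - c * ?M \<phi>)
          \<le> cmod (?M (\<lambda>x. c * \<phi> x) - \<mu> (\<lambda>x. complex_of_real (h x) * (c * \<phi> x)))
          + cmod c * cmod (?M \<phi> - \<mu> (cutoff h \<phi>))"
        unfolding eq by (rule order_trans[OF norm_triangle_ineq4]) (simp add: norm_mult)
      moreover have "cmod (?M (\<lambda>x. c * \<phi> x) - \<mu> (\<lambda>x. complex_of_real (h x) * (c * \<phi> x))) \<le> e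
          * (cmod c * B)"
        by (rule h(2)[rule_format, OF Cc_cmult[OF \<phi>] cB])
      moreover have "cmod c * cmod (?M \<phi> - \<mu> (cutoff h \<phi>)) \<le> cmod c * (e * B)"
        by (rule mult_left_mono[OF h(2)[rule_format, OF \<phi> B(2)] norm_ge_zero])
      moreover have "e * (cmod c * B) + cmod c * (e * B) = (2 * cmod c * B) * e"
          by (simp add: algebra_simps)
      ultimately show "cmod (?M (\<lambda>x. c * \<phi> x) - c * ?M \<phi>) \<le> (2 * cmod c * B) * e" by linarith
    qed
    then show "?M (\<lambda>x. c * \<phi> x) = c * ?M \<phi>" by simp
  next
    fix K :: "'a set" assume "compact K"
    then obtain C where C: "C \<ge> 0" "\<And>\<phi> B. \<phi> \<in> Cc \<Longrightarrow> (\<And>x. \<phi> x \<noteq> 0 \<Longrightarrow> x \<in> K) \<Longrightarrow>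
      (\<And>x. cmod (\<phi> x) \<le> B) \<Longrightarrow> cmod (\<mu> \<phi>) \<le> C * B"
      using is_measure_bound[OF \<mu>] by blast
    show "\<exists>C\<ge>0. \<forall>\<phi>\<in>Cc. \<forall>B. (\<forall>x. \<phi> x \<noteq> 0 \<longrightarrow> x \<in> K) \<longrightarrow> (\<forall>x. cmod (\<phi> x) \<le> B) \<longrightarrow> cmod (?M \<phi>) \<le> C * B"
    proof (intro exI[of _ C] conjI ballI allI impI C(1) restrict_functional_le[OF lc \<mu> A] C(2))
      fix \<phi> :: "'a \<Rightarrow> complex" and B x and h :: "'a \<Rightarrow> real"
      assume \<phi>: "\<forall>x. cmod (\<phi> x) \<le> B" and h: "\<And>x. 0 \<le> h x" "\<And>x. h x \<le> indicator A x"
      show "cmod (complex_of_real (h x) * \<phi> x) \<le> B" by (rule norm_cutoff_le[OF h \<phi>[rule_format]])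
    qed (auto intro: Cch)
  qed
qed


section \<open>Translation bounded measures\<close>

lemma variation_lsc_sum_le:
  fixes \<mu> :: "'a::t2_space functional"
  assumes lc: "locally_compact_space (euclidean :: 'a topology)" and \<mu>: "is_measure \<mu>"
    and "finite J" and "\<And>j. j \<in> J \<Longrightarrow> lower_semicont (g j)"
    and "\<And>j. j \<in> J \<Longrightarrow> variation_lsc \<mu> (g j) \<le> ennreal c"
  shows "variation_lsc \<mu> (\<lambda>x. \<Sum>j\<in>J. g j x) \<le> of_nat (card J) * ennreal c"
    and "lower_semicont (\<lambda>x. \<Sum>j\<in>J. g j x)"
proof -
  have "variation_lsc \<mu> (\<lambda>x. \<Sum>j\<in>J. g j x) \<le> of_nat (card J) * ennreal c
      \<and> lower_semicont (\<lambda>x. \<Sum>j\<in>J. g j x)"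
    using assms(3-5)
  proof (induction J)
    case empty
    show ?case by (simp add: lower_semicont_def variation_lsc_zero[OF \<mu>])
  next
    case (insert j J)
    then have IH: "variation_lsc \<mu> (\<lambda>x. \<Sum>j\<in>J. g j x) \<le> of_nat (card J) * ennreal c"
      "lower_semicont (\<lambda>x. \<Sum>j\<in>J. g j x)" by auto
    have "variation_lsc \<mu> (\<lambda>x. g j x + (\<Sum>j\<in>J. g j x)) \<le> ennreal c + of_nat (card J) * ennreal c"
      by (rule order_trans[OF variation_lsc_add[OF lc \<mu> _ IH(2)] add_mono[OF _ IH(1)]]) (use insert in auto)
    then show ?case using insert lower_semicont_add[OF _ IH(2), of "g j"] by (simp add: distrib_right)
  qed
  then show "variation_lsc \<mu> (\<lambda>x. \<Sum>j\<in>J. g j x) \<le> of_nat (card J) * ennreal c"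
    "lower_semicont (\<lambda>x. \<Sum>j\<in>J. g j x)" by auto
qed

lemma open_translation:
  fixes S :: "'a::topological_ab_group_add set"
  assumes "open S" shows "open ((+) t ` S)"
proof -
  have "(+) t ` S = (\<lambda>x. x - t) -` S"
    by (auto simp: image_iff algebra_simps intro!: bexI[of _ "_ - t"])
  then show ?thesis
    using assms continuous_on_open_vimage[OF open_UNIV, of "\<lambda>x::'a. x - t"]
        by (simp add: continuous_intros)
qed

text \<open>
  Finitely many translates of the open set that witnesses translation boundedness cover \<open>K\<close>, and the
  same number covers \<open>t + K\<close>; subadditivity of the variation gives a bound independent of \<open>t\<close>.
\<close>

lemma translation_bounded_bound:
  fixes \<mu> :: "'a::{topological_ab_group_add, t2_space} functional"
  assumes lc: "locally_compact_space (euclidean :: 'a topology)"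
    and tb: "translation_bounded \<mu>" and K: "compact K"
  shows "\<exists>C\<ge>0. \<forall>\<psi>\<in>Cc. \<forall>t B. (\<forall>x. \<psi> x \<noteq> 0 \<longrightarrow> x - t \<in> K) \<longrightarrow> (\<forall>x. cmod (\<psi> x) \<le> B)
           \<longrightarrow> cmod (\<mu> \<psi>) \<le> C * B"
proof -
  have \<mu>: "is_measure \<mu>" using tb by (simp add: translation_bounded_def)
  obtain V where V: "open V" "V \<noteq> {}" "(SUP t. total_variation \<mu> ((+) t ` V)) < \<infinity>"
    using tb unfolding translation_bounded_def by blast
  obtain r where r: "r \<ge> 0" "(SUP t. total_variation \<mu> ((+) t ` V)) = ennreal r"
    using V(3) by (cases "SUP t. total_variation \<mu> ((+) t ` V)") auto
  have tr: "total_variation \<mu> ((+) t ` V) \<le> ennreal r" for t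
    unfolding r(2)[symmetric] by (rule SUP_upper) simp
  obtain v where v: "v \<in> V" using V by blast
  have "K \<subseteq> (\<Union>k\<in>K. (+) (k - v) ` V)" using v by (force simp: image_iff)
  then obtain F where F: "finite F" "K \<subseteq> (\<Union>k\<in>F. (+) (k - v) ` V)"
    using compactE_image[OF K, of K "\<lambda>k. (+) (k - v) ` V"] open_translation[OF V(1)] by metis
  show ?thesis
  proof (intro exI[of _ "card F * r"] conjI ballI allI impI)
    fix \<psi> :: "'a \<Rightarrow> complex" and t B
    assume \<psi>: "\<psi> \<in> Cc" "\<forall>x. \<psi> x \<noteq> 0 \<longrightarrow> x - t \<in> K" "\<forall>x. cmod (\<psi> x) \<le> B"
    have B: "B \<ge> 0" using \<psi>(3) norm_ge_zero order_trans by blast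
    define g where "g k x = ennreal B * indicator ((+) (t + (k - v)) ` V) x" for k x
    have lsc: "lower_semicont (g k)" for k
      unfolding lower_semicont_def
    proof
      fix c
      have "{x. c < g k x} = (if c < ennreal B then (+) (t + (k - v)) ` V else {})"
        by (auto simp: g_def indicator_def)
      then show "open {x. c < g k x}" using open_translation[OF V(1)] by auto
    qed
    have "variation_lsc \<mu> (g k) \<le> ennreal (B * r)" for k
    proof -
      have "variation_lsc \<mu> (indicator ((+) (t + (k - v)) ` V)) \<le> total_variation \<mu> ((+) (t
          + (k - v)) ` V)"
        unfolding total_variation_def by (intro variation_lsc_least variation_upper_integral_ge) auto
      then have "variation_lsc \<mu> (indicator ((+) (t + (k - v)) ` V)) \<le> ennreal r"
          using tr order_trans by blast
      then have "variation_lsc \<mu> (g k) \<le> ennreal B * ennreal r"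
        unfolding g_def by (intro order_trans[OF variation_lsc_cmult[OF \<mu> B]] mult_left_mono) auto
      then show ?thesis using B r by (simp add: ennreal_mult)
    qed
    then have "variation_lsc \<mu> (\<lambda>x. \<Sum>k\<in>F. g k x) \<le> of_nat (card F) * ennreal (B * r)"
      by (intro variation_lsc_sum_le[OF lc \<mu> F(1) lsc])
    moreover have "ennreal (cmod (\<mu> \<psi>)) \<le> variation_lsc \<mu> (\<lambda>x. \<Sum>k\<in>F. g k x)"
    proof (rule variation_lsc_upper[OF \<psi>(1)])
      fix x
      show "ennreal (cmod (\<psi> x)) \<le> (\<Sum>k\<in>F. g k x)"
      proof (cases "\<psi> x = 0")
        case False
        then obtain k where k: "k \<in> F" "x - t \<in> (+) (k - v) ` V" using \<psi>(2) F(2) by blast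
        then obtain y where y: "y \<in> V" "x - t = (k - v) + y" by auto
        then have "x = t + (k - v) + y" by (metis add.assoc add.commute diff_add_cancel)
        then have "g k x = ennreal B" using y(1) by (auto simp: g_def indicator_def)
        then have "ennreal (cmod (\<psi> x)) \<le> g k x" using \<psi>(3) by (simp add: ennreal_leI)
        also have "\<dots> \<le> (\<Sum>k\<in>F. g k x)" by (rule member_le_sum[OF k(1)]) (use F in auto)
        finally show ?thesis .
      qed simp
    qed
    ultimately have "ennreal (cmod (\<mu> \<psi>)) \<le> of_nat (card F) * ennreal (B * r)" by (rule
        order_trans[rotated])
    also have "\<dots> = ennreal (card F * r * B)"
      using B r by (simp add: ennreal_mult ennreal_of_nat_eq_real_of_nat mult.commute mult.left_commute)
    finally show "cmod (\<mu> \<psi>) \<le> card F * r * B" using B r by (simp add: ennreal_le_iff)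
  qed (use r in simp)
qed

section \<open>Interchanging a functional with an integral\<close>

text \<open>
  Curried compactly supported continuous functions on a product; the supports are kept in a
  rectangle \<open>K \<times> L\<close> because both sections are used.
\<close>

definition jointly_Cc :: "('a::t2_space \<Rightarrow> 'b::t2_space \<Rightarrow> complex) \<Rightarrow> bool" where
  "jointly_Cc \<Phi> \<longleftrightarrow> continuous_on UNIV (\<lambda>p. \<Phi> (fst p) (snd p)) \<and>
     (\<exists>K L. compact K \<and> compact L \<and> (\<forall>t s. \<Phi> t s \<noteq> 0 \<longrightarrow> t \<in> K \<and> s \<in> L))"

lemma jointly_CcI:
  assumes "continuous_on UNIV (\<lambda>p. \<Phi> (fst p) (snd p))" "compact K" "compact L"
    "\<And>t s. \<Phi> t s \<noteq> 0 \<Longrightarrow> t \<in> K" "\<And>t s. \<Phi> t s \<noteq> 0 \<Longrightarrow> s \<in> L"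
  shows "jointly_Cc \<Phi>"
  using assms unfolding jointly_Cc_def by blast

lemma jointly_Cc_swap:
  assumes "jointly_Cc \<Phi>" shows "jointly_Cc (\<lambda>s t. \<Phi> t s)"
proof -
  have c: "continuous_on UNIV (\<lambda>p. \<Phi> (fst p) (snd p))" using assms by (simp add: jointly_Cc_def)
  have "continuous_on UNIV (\<lambda>p. (\<lambda>p. \<Phi> (fst p) (snd p)) (snd p, fst p))"
    by (rule continuous_on_compose2[OF c]) (auto intro!: continuous_intros)
  then show ?thesis using assms unfolding jointly_Cc_def by auto
qed

lemma jointly_Cc_section:
  assumes "jointly_Cc \<Phi>" shows "\<Phi> t \<in> Cc"
proof -
  have c: "continuous_on UNIV (\<lambda>p. \<Phi> (fst p) (snd p))" using assms by (simp add: jointly_Cc_def)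
  have "continuous_on UNIV (\<lambda>s. (\<lambda>p. \<Phi> (fst p) (snd p)) (t, s))"
    by (rule continuous_on_compose2[OF c]) (auto intro!: continuous_intros)
  then show ?thesis using assms unfolding jointly_Cc_def Cc_iff by auto
qed

text \<open>
  The tube lemma: sections depend continuously on the parameter in the supremum norm.
\<close>

lemma section_uniformly_continuous:
  fixes \<Phi> :: "'a::topological_space \<Rightarrow> 'b::topological_space \<Rightarrow> complex"
  assumes "continuous_on UNIV (\<lambda>p. \<Phi> (fst p) (snd p))" "compact L" "\<forall>t s. \<Phi> t s \<noteq> 0 \<longrightarrow> s \<in> L" "e > 0"
  shows "\<exists>U. open U \<and> t \<in> U \<and> (\<forall>t'\<in>U. \<forall>s. cmod (\<Phi> t' s - \<Phi> t s) \<le> e)"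
proof -
  have "continuous_on (UNIV \<times> L) (\<lambda>p. \<Phi> (fst p) (snd p))"
      by (rule continuous_on_subset[OF assms(1)]) auto
  then obtain U where U: "t \<in> U" "open U"
    "\<forall>x\<in>U \<inter> UNIV. \<forall>s\<in>L. dist (\<Phi> (fst (x, s)) (snd (x, s))) (\<Phi> (fst (t, s)) (snd (t, s))) \<le> e"
    using continuous_on_prod_compactE[OF _ assms(2) UNIV_I assms(4), where fx = "\<lambda>p. \<Phi> (fst p) (snd p)"] by metis
  have "cmod (\<Phi> t' s - \<Phi> t s) \<le> e" if "t' \<in> U" for t' s
  proof (cases "s \<in> L")
    case True
    then show ?thesis using U(3) that by (auto simp: dist_norm)
  next
    case False
    then have "\<Phi> t' s = 0" "\<Phi> t s = 0" using assms(3) by blast+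
    then show ?thesis using assms(4) by simp
  qed
  then show ?thesis using U by blast
qed

lemma measure_section_Cc:
  fixes \<Phi> :: "'a::t2_space \<Rightarrow> 'b::t2_space \<Rightarrow> complex"
  assumes L: "is_measure L" and \<Phi>: "jointly_Cc \<Phi>"
  shows "(\<lambda>t. L (\<Phi> t)) \<in> Cc"
proof -
  obtain K1 K2 where K: "compact K1" "compact K2" "\<forall>t s. \<Phi> t s \<noteq> 0 \<longrightarrow> t \<in> K1" "\<forall>t s. \<Phi> t s \<noteq> 0 \<longrightarrow> s \<in> K2"
    and c: "continuous_on UNIV (\<lambda>p. \<Phi> (fst p) (snd p))"
    using \<Phi> unfolding jointly_Cc_def by metis
  obtain C where C: "C \<ge> 0" "\<And>\<phi> B. \<phi> \<in> Cc \<Longrightarrow> (\<And>x. \<phi> x \<noteq> 0 \<Longrightarrow> x \<in> K2) \<Longrightarrow>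
      (\<And>x. cmod (\<phi> x) \<le> B) \<Longrightarrow> cmod (L \<phi>) \<le> C * B"
    using is_measure_bound[OF L K(2)] by blast
  show ?thesis
  proof (rule CcI[OF _ K(1)])
    show "continuous_on UNIV (\<lambda>t. L (\<Phi> t))"
      unfolding continuous_on_def
    proof (intro ballI tendstoI)
      fix t and e :: real assume e: "e > 0"
      then have eC: "e / (C + 1) > 0" using C(1) by simp
      obtain U where U: "open U" "t \<in> U" "\<forall>t'\<in>U. \<forall>s. cmod (\<Phi> t' s - \<Phi> t s) \<le> e / (C + 1)"
        using section_uniformly_continuous[OF c K(2,4) eC] by blast
      have "dist (L (\<Phi> t')) (L (\<Phi> t)) < e" if "t' \<in> U" for t'
      proof -
        have "cmod (L (\<lambda>s. \<Phi> t' s - \<Phi> t s)) \<le> C * (e / (C + 1))"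
          by (rule C(2)[OF Cc_diff[OF jointly_Cc_section[OF \<Phi>] jointly_Cc_section[OF \<Phi>]]])
            (use K(4) U(3) that in \<open>auto, (metis diff_self)\<close>)
        also have "\<dots> < e" using C(1) e by (simp add: field_simps)
        finally show ?thesis
          by (simp add: dist_norm is_measure_diff[OF L jointly_Cc_section[OF \<Phi>] jointly_Cc_section[OF \<Phi>]])
      qed
      then show "\<forall>\<^sub>F t' in at t within UNIV. dist (L (\<Phi> t')) (L (\<Phi> t)) < e"
        unfolding eventually_at_topological using U by blast
    qed
    show "t \<in> K1" if "L (\<Phi> t) \<noteq> 0" for t
    proof (rule ccontr)
      assume "t \<notin> K1"
      then have "\<Phi> t = (\<lambda>_. 0)" using K(3) by blast
      then show False using that is_measure_zero[OF L] by simp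
    qed
  qed
qed

lemma radon_sets: "radon_measure m \<Longrightarrow> sets m = sets borel"
  by (simp add: radon_measure_def)

lemma radon_finite_compact: "radon_measure m \<Longrightarrow> compact K \<Longrightarrow> emeasure m K < \<infinity>"
  by (simp add: radon_measure_def)

lemma radon_compact_sets: "radon_measure m \<Longrightarrow> compact (K :: 'a::t2_space set) \<Longrightarrow> K \<in> sets m"
  by (simp add: radon_measure_def borel_compact)

lemma Cc_borel_measurable:
  assumes m: "radon_measure m" and \<phi>: "\<phi> \<in> Cc" shows "\<phi> \<in> borel_measurable m"
  using borel_measurable_continuous_onI[OF Cc_cont[OF \<phi>]]
  by (simp add: measurable_cong_sets[OF radon_sets[OF m] refl])

lemma Cc_integrable:
  fixes \<phi> :: "'a::t2_space \<Rightarrow> complex"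
  assumes m: "radon_measure m" and \<phi>: "\<phi> \<in> Cc"
  shows "integrable m \<phi>"
proof -
  obtain K where K: "compact K" "\<And>x. \<phi> x \<noteq> 0 \<Longrightarrow> x \<in> K" using CcE[OF \<phi>] by blast
  obtain B where B: "B \<ge> 0" "\<And>x. cmod (\<phi> x) \<le> B" using Cc_bounded[OF \<phi>] by blast
  show ?thesis
    by (rule integrableI_bounded_set[of K _ _ B])
      (use K B radon_compact_sets[OF m] radon_finite_compact[OF m] Cc_borel_measurable[OF m \<phi>] in auto)
qed

lemma integral_Cc_bound:
  fixes \<phi> :: "'a::t2_space \<Rightarrow> complex"
  assumes m: "radon_measure m" and \<phi>: "\<phi> \<in> Cc"
    and K: "compact K" "\<And>x. \<phi> x \<noteq> 0 \<Longrightarrow> x \<in> K" and B: "\<And>x. cmod (\<phi> x) \<le> B"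
  shows "cmod (integral\<^sup>L m \<phi>) \<le> measure m K * B"
proof -
  have Km: "K \<in> sets m" using K m by (simp add: radon_compact_sets)
  have i: "integrable m (\<lambda>x. indicator K x * B)"
    using Km radon_finite_compact[OF m K(1)] by (intro integrable_mult_left integrable_real_indicator) auto
  have le: "cmod (\<phi> x) \<le> indicator K x * B" for x
    using B[of x] K(2)[of x] by (cases "x \<in> K") auto
  have "cmod (integral\<^sup>L m \<phi>) \<le> (\<integral>x. indicator K x * B \<partial>m)"
    by (rule order_trans[OF integral_norm_bound integral_mono]) (use le i Cc_integrable[OF m \<phi>] in auto)
  also have "\<dots> = measure m K * B" using Km radon_finite_compact[OF m K(1)] by simp
  finally show ?thesis .
qed

lemma is_measure_integral:
  fixes m :: "'a::t2_space measure"
  assumes m: "radon_measure m"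
  shows "is_measure (\<lambda>\<phi>. integral\<^sup>L m \<phi>)"
proof (rule is_measureI)
  fix K :: "'a set" assume "compact K"
  then show "\<exists>C\<ge>0. \<forall>\<phi>\<in>Cc. \<forall>B. (\<forall>x. \<phi> x \<noteq> 0 \<longrightarrow> x \<in> K) \<longrightarrow> (\<forall>x. cmod (\<phi> x) \<le> B) \<longrightarrow> cmod (integral\<^sup>L m \<phi>)
      \<le> C * B"
    by (intro exI[of _ "measure m K"]) (auto intro!: integral_Cc_bound m)
qed (auto intro!: Bochner_Integration.integral_add Cc_integrable m)

text \<open>
  On the cell \<open>E i\<close> of the partition the integrand differs from \<open>c i\<close> by at most \<open>d\<close>, so the Riemann
  sum is off by at most \<open>d\<close> times the measure of \<open>K\<close>.
\<close>

lemma integral_step_approx: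
  fixes f :: "'a::t2_space \<Rightarrow> complex" and n :: nat
  assumes m: "radon_measure m" and f: "f \<in> Cc"
    and K: "compact K" "\<And>x. f x \<noteq> 0 \<Longrightarrow> x \<in> K"
    and E: "\<And>i. i < n \<Longrightarrow> E i \<in> sets borel" "disjoint_family_on E {..<n}" "(\<Union>i<n. E i) = K"
    and d: "\<And>i x. i < n \<Longrightarrow> x \<in> E i \<Longrightarrow> cmod (f x - c i) \<le> d"
  shows "cmod (integral\<^sup>L m f - (\<Sum>i<n. complex_of_real (measure m (E i)) * c i)) \<le> measure m K * d"
proof -
  have Km: "K \<in> sets m" using K m by (simp add: radon_compact_sets)
  have fin: "emeasure m (E i) < \<infinity>" if "i < n" for i
  proof -
    have "emeasure m (E i) \<le> emeasure m K" using E(3) that Km by (intro emeasure_mono) auto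
    then show ?thesis using radon_finite_compact[OF m K(1)] by (simp add: le_less_trans)
  qed
  let ?s = "\<lambda>x. \<Sum>i<n. indicator (E i) x *\<^sub>R c i"
  have si: "integrable m ?s"
    using fin E radon_sets[OF m] by (intro Bochner_Integration.integrable_sum integrable_scaleR_left integrable_real_indicator) auto
  have "integral\<^sup>L m ?s = (\<Sum>i<n. complex_of_real (measure m (E i)) * c i)"
  proof -
    have "integral\<^sup>L m ?s = (\<Sum>i<n. \<integral>x. indicator (E i) x *\<^sub>R c i \<partial>m)"
      using fin E radon_sets[OF m] by (intro Bochner_Integration.integral_sum) auto
    also have "\<dots> = (\<Sum>i<n. complex_of_real (measure m (E i)) * c i)"
      using fin E radon_sets[OF m] by (intro sum.cong refl) (auto simp: scaleR_conv_of_real)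
    finally show ?thesis .
  qed
  then have "integral\<^sup>L m f - (\<Sum>i<n. complex_of_real (measure m (E i)) * c i) = (\<integral>x. f x - ?s x \<partial>m)"
    using si Cc_integrable[OF m f] by simp
  also have "cmod \<dots> \<le> (\<integral>x. indicator K x * d \<partial>m)"
  proof (rule order_trans[OF integral_norm_bound integral_mono])
    show "integrable m (\<lambda>x. cmod (f x - ?s x))" using si Cc_integrable[OF m f] by simp
    show "integrable m (\<lambda>x. indicator K x * d)"
      using Km radon_finite_compact[OF m K(1)]
          by (intro integrable_mult_left integrable_real_indicator) auto
    fix x
    show "cmod (f x - ?s x) \<le> indicator K x * d"
    proof (cases "x \<in> K")
      case True
      then obtain i where i: "i < n" "x \<in> E i" using E(3) by auto
      have "indicator (E j) x = (if j = i then 1 else (0::real))" if "j < n" for j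
        using E(2) i that unfolding disjoint_family_on_def by (auto simp: indicator_def)
      then have "?s x = (\<Sum>j<n. (if j = i then c j else 0))" by (intro sum.cong) auto
      also have "\<dots> = c i" using i by simp
      finally show ?thesis using d[OF i] True by simp
    next
      case False
      then have "x \<notin> E j" if "j < n" for j using E(3) that by auto
      then have "?s x = 0" by (intro sum.neutral) auto
      then show ?thesis using K(2)[of x] False by auto
    qed
  qed
  also have "\<dots> = measure m K * d" using Km radon_finite_compact[OF m K(1)] by simp
  finally show ?thesis .
qed

text \<open>
  A functional and a Radon measure may be interchanged. As a Haar measure may fail to be \<open>\<sigma>\<close>-finite,
  product measures are of no use; instead the compact support in the first variable is partitioned
  into Borel sets on which the sections vary by at most \<open>e\<close>, and the functional is applied to the
  resulting Riemann sums.
\<close>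

lemma integral_measure_Fubini:
  fixes \<Phi> :: "'a::t2_space \<Rightarrow> 'b::t2_space \<Rightarrow> complex"
  assumes m: "radon_measure m"
    and L: "is_measure L" and \<Phi>: "jointly_Cc \<Phi>"
  shows "L (\<lambda>s. \<integral>t. \<Phi> t s \<partial>m) = (\<integral>t. L (\<Phi> t) \<partial>m)"
proof -
  obtain K1 K2 where K: "compact K1" "compact K2" "\<forall>t s. \<Phi> t s \<noteq> 0 \<longrightarrow> t \<in> K1" "\<forall>t s. \<Phi> t s \<noteq> 0 \<longrightarrow> s \<in> K2"
    and c: "continuous_on UNIV (\<lambda>p. \<Phi> (fst p) (snd p))"
    using \<Phi> unfolding jointly_Cc_def by metis
  obtain C where C: "C \<ge> 0" "\<And>\<phi> B. \<phi> \<in> Cc \<Longrightarrow> (\<And>x. \<phi> x \<noteq> 0 \<Longrightarrow> x \<in> K2) \<Longrightarrow>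
      (\<And>x. cmod (\<phi> x) \<le> B) \<Longrightarrow> cmod (L \<phi>) \<le> C * B"
    using is_measure_bound[OF L K(2)] by blast
  note sec = jointly_Cc_section[OF \<Phi>]
  have int: "(\<lambda>s. \<integral>t. \<Phi> t s \<partial>m) \<in> Cc"
    using measure_section_Cc[OF is_measure_integral[OF m] jointly_Cc_swap[OF \<Phi>]] .
  have LCc: "(\<lambda>t. L (\<Phi> t)) \<in> Cc" by (rule measure_section_Cc[OF L \<Phi>])
  have "cmod (L (\<lambda>s. \<integral>t. \<Phi> t s \<partial>m) - (\<integral>t. L (\<Phi> t) \<partial>m)) \<le> 2 * C * measure m K1 * e" if e: "e > 0" for e
  proof -
    have "\<forall>t. \<exists>U. open U \<and> t \<in> U \<and> (\<forall>t'\<in>U. \<forall>s. cmod (\<Phi> t' s - \<Phi> t s) \<le> e)"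
      using section_uniformly_continuous[OF c K(2,4) e] by blast
    then obtain U where U: "\<And>t. open (U t)" "\<And>t. t \<in> U t"
      "\<And>t t' s. t' \<in> U t \<Longrightarrow> cmod (\<Phi> t' s - \<Phi> t s) \<le> e" by metis
    have "K1 \<subseteq> (\<Union>t\<in>K1. U t)" using U(2) by blast
    then obtain F where F: "finite F" "K1 \<subseteq> (\<Union>t\<in>F. U t)"
      using compactE_image[OF K(1), of K1 U] U(1) by metis
    obtain t n where tn: "F = t ` {i::nat. i < n}" using finite_imp_nat_seg_image_inj_on[OF F(1)]
        by metis
    \<comment> \<open>a finite cover by small open sets, made disjoint\<close>
    define E where "E = disjointed (\<lambda>i. K1 \<inter> U (t i))"
    have E1: "E i \<in> sets borel" for i
    proof -
      have "range (\<lambda>i. K1 \<inter> U (t i)) \<subseteq> sets borel" using K(1) U(1) by (auto intro: borel_compact)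
      from sets.range_disjointed_sets[OF this] show ?thesis unfolding E_def by auto
    qed
    have E2: "disjoint_family_on E {..<n}"
      using disjoint_family_disjointed[of "\<lambda>i. K1 \<inter> U (t i)"]
          unfolding E_def disjoint_family_on_def by blast
    have E3: "(\<Union>i<n. E i) = K1"
      using finite_UN_disjointed_eq[of "\<lambda>i. K1 \<inter> U (t i)" n] F(2) tn unfolding E_def
      by (auto simp: atLeast0LessThan)
    have E4: "x \<in> U (t i)" if "x \<in> E i" for x i
      using that disjointed_subset[of "\<lambda>i. K1 \<inter> U (t i)" i] unfolding E_def by blast
    let ?S = "\<lambda>s. \<Sum>i<n. complex_of_real (measure m (E i)) * \<Phi> (t i) s"
    have SCc: "?S \<in> Cc" by (intro Cc_sum Cc_cmult sec)
    have LS: "L ?S = (\<Sum>i<n. complex_of_real (measure m (E i)) * L (\<Phi> (t i)))"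
      by (subst is_measure_sum[OF L]) (auto intro!: Cc_cmult sec sum.cong is_measure_cmult[OF L])
    have "cmod (L (\<lambda>s. (\<integral>t. \<Phi> t s \<partial>m) - ?S s)) \<le> C * (measure m K1 * e)"
    proof (rule C(2)[OF Cc_diff[OF int SCc]])
      fix s
      show "cmod ((\<integral>t. \<Phi> t s \<partial>m) - ?S s) \<le> measure m K1 * e"
        by (rule integral_step_approx[OF m jointly_Cc_section[OF jointly_Cc_swap[OF \<Phi>]] K(1) _ E1 E2 E3])
          (use K(3) U(3) E4 in auto)
      assume ne: "(\<integral>t. \<Phi> t s \<partial>m) - ?S s \<noteq> 0"
      show "s \<in> K2"
      proof (rule ccontr)
        assume "s \<notin> K2"
        then have "\<Phi> t s = 0" for t using K(4) by blast
        then show False using ne by simp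
      qed
    qed
    then have 1: "cmod (L (\<lambda>s. \<integral>t. \<Phi> t s \<partial>m) - L ?S) \<le> C * measure m K1 * e"
      using is_measure_diff[OF L int SCc] by simp
    have 2: "cmod ((\<integral>t. L (\<Phi> t) \<partial>m) - L ?S) \<le> measure m K1 * (C * e)"
      unfolding LS
    proof (rule integral_step_approx[OF m LCc K(1) _ E1 E2 E3])
      fix i x assume "x \<in> E i"
      then have "cmod (L (\<lambda>s. \<Phi> x s - \<Phi> (t i) s)) \<le> C * e"
        by (intro C(2) Cc_diff sec U(3) E4) (use K(4) in \<open>auto, (metis diff_self)\<close>)
      then show "cmod (L (\<Phi> x) - L (\<Phi> (t i))) \<le> C * e" by (simp add: is_measure_diff[OF L sec sec])
    next
      fix x assume ne: "L (\<Phi> x) \<noteq> 0"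
      show "x \<in> K1"
      proof (rule ccontr)
        assume "x \<notin> K1"
        then have "\<Phi> x = (\<lambda>_. 0)" using K(3) by blast
        then show False using ne is_measure_zero[OF L] by simp
      qed
    qed
    have "cmod (L (\<lambda>s. \<integral>t. \<Phi> t s \<partial>m) - (\<integral>t. L (\<Phi> t) \<partial>m))
        \<le> cmod (L (\<lambda>s. \<integral>t. \<Phi> t s \<partial>m) - L ?S) + cmod ((\<integral>t. L (\<Phi> t) \<partial>m) - L ?S)"
      using dist_triangle2[of "L (\<lambda>s. \<integral>t. \<Phi> t s \<partial>m)" "\<integral>t. L (\<Phi> t) \<partial>m" "L ?S"] by (simp only: dist_norm)
    then show ?thesis using 1 2 by (simp add: algebra_simps)
  qed
  then have "L (\<lambda>s. \<integral>t. \<Phi> t s \<partial>m) - (\<integral>t. L (\<Phi> t) \<partial>m) = 0" by (rule norm_zero_of_epsilon)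
  then show ?thesis by simp
qed

section \<open>Haar measure\<close>

lemma haar_radon: "haar_measure m \<Longrightarrow> radon_measure m"
  by (simp add: haar_measure_def)

lemma haar_distr_translate:
  fixes m :: "'a::{topological_ab_group_add, t2_space} measure"
  assumes m: "haar_measure m"
  shows "distr m m (\<lambda>u. u + s) = m"
proof (rule measure_eqI)
  have [measurable]: "(\<lambda>u. u + s) \<in> m \<rightarrow>\<^sub>M m"
    unfolding measurable_cong_sets[OF radon_sets[OF haar_radon[OF m]] radon_sets[OF haar_radon[OF m]]]
    by (intro borel_measurable_continuous_onI continuous_intros)
  show "sets (distr m m (\<lambda>u. u + s)) = sets m" by simp
  fix B assume "B \<in> sets (distr m m (\<lambda>u. u + s))"
  then have B: "B \<in> sets m" by simp
  have sp: "space m = UNIV" using radon_sets[OF haar_radon[OF m]] sets_eq_imp_space_eq by fastforce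
  have "(\<lambda>u. u + s) -` B \<inter> space m = (+) (- s) ` B"
    unfolding sp by (auto simp: image_iff algebra_simps intro!: bexI[of _ "_ + s"])
  moreover have "emeasure m ((+) (- s) ` B) = emeasure m B"
    using m B radon_sets[OF haar_radon[OF m]] unfolding haar_measure_def by blast
  ultimately show "emeasure (distr m m (\<lambda>u. u + s)) B = emeasure m B"
    using B by (simp add: emeasure_distr)
qed

lemma haar_integral_translate:
  fixes m :: "'a::{topological_ab_group_add, t2_space} measure" and \<phi> :: "'a \<Rightarrow> complex"
  assumes m: "haar_measure m" and \<phi>: "\<phi> \<in> Cc"
  shows "(\<integral>u. \<phi> (u + s) \<partial>m) = (\<integral>u. \<phi> u \<partial>m)"
proof -
  have [measurable]: "(\<lambda>u. u + s) \<in> m \<rightarrow>\<^sub>M m"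
    unfolding measurable_cong_sets[OF radon_sets[OF haar_radon[OF m]] radon_sets[OF haar_radon[OF m]]]
    by (intro borel_measurable_continuous_onI continuous_intros)
  have "(\<integral>u. \<phi> u \<partial>m) = (\<integral>u. \<phi> u \<partial>distr m m (\<lambda>u. u + s))" by (simp add: haar_distr_translate[OF m])
  also have "\<dots> = (\<integral>u. \<phi> (u + s) \<partial>m)"
    by (rule integral_distr) (use Cc_borel_measurable[OF haar_radon[OF m] \<phi>] in auto)
  finally show ?thesis ..
qed

text \<open>
  If \<open>U\<close> were a null set then so would be every compact set, being covered by finitely many
  translates of \<open>U\<close>, and the measure would vanish by inner regularity.
\<close>

lemma haar_open_pos:
  fixes m :: "'a::{topological_ab_group_add, t2_space} measure"
  assumes m: "haar_measure m" and U: "open U" "x \<in> U"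
  shows "emeasure m U > 0"
proof (rule ccontr)
  assume "\<not> emeasure m U > 0"
  then have U0: "emeasure m U = 0" by simp
  have sets: "sets m = sets borel" using radon_sets[OF haar_radon[OF m]] .
  have "emeasure m K = 0" if K: "compact K" for K
  proof -
    have "K \<subseteq> (\<Union>k\<in>K. (+) (k - x) ` U)" using U(2) by (force simp: image_iff)
    then obtain F where F: "finite F" "K \<subseteq> (\<Union>k\<in>F. (+) (k - x) ` U)"
      using compactE_image[OF K, of K "\<lambda>k. (+) (k - x) ` U"] open_translation[OF U(1)] by metis
    have "(+) (k - x) ` U \<in> null_sets m" for k
      using m U(1) U0 open_translation[OF U(1)] sets by (auto simp: null_sets_def haar_measure_def)
    then have "(\<Union>k\<in>F. (+) (k - x) ` U) \<in> null_sets m" using F(1)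
        by (intro null_sets_UN') (auto intro: countable_finite)
    then show ?thesis using F(2) null_sets_subset sets K by (metis borel_compact null_setsD1)
  qed
  then have "(SUP K\<in>{K\<in>sets borel. compact K \<and> K \<subseteq> UNIV}. emeasure m K) = 0"
    by (intro antisym SUP_least) auto
  then show False using m unfolding haar_measure_def radon_measure_def
      by (metis UNIV_I sets.top space_borel)
qed

text \<open>
  The functions \<open>g\<close> serve as an approximate identity when \<open>W\<close> shrinks to \<open>0\<close>.
\<close>

lemma haar_bump:
  fixes m :: "'a::{topological_ab_group_add, t2_space} measure"
  assumes lc: "locally_compact_space (euclidean :: 'a topology)" and m: "haar_measure m"
    and W: "open W" "0 \<in> W"
  obtains g :: "'a \<Rightarrow> real" and K where "continuous_on UNIV g" "\<And>x. 0 \<le> g x" "compact K" "K \<subseteq> W"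
    "\<And>x. g x \<noteq> 0 \<Longrightarrow> x \<in> K" "(\<integral>x. complex_of_real (g x) \<partial>m) = 1"
proof -
  note r = haar_radon[OF m]
  obtain f :: "'a \<Rightarrow> real" and K where f: "continuous_on UNIV f" "\<And>y. 0 \<le> f y" "f 0 = 1"
    "compact K" "K \<subseteq> W" "\<And>y. f y \<noteq> 0 \<Longrightarrow> y \<in> K"
    using lc_bump[OF lc W] by metis
  have Cc: "(\<lambda>x. complex_of_real (f x)) \<in> Cc"
    by (rule CcI[OF _ f(4)]) (use f in \<open>auto intro!: continuous_intros\<close>)
  have int: "integrable m f"
    using integrable_Re[OF Cc_integrable[OF r Cc]] by simp
  define U where "U = {y. 1/2 < f y}"
  have U: "open U" unfolding U_def by (intro open_Collect_less continuous_intros f)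
  have UK: "U \<subseteq> K" using f(6) unfolding U_def by force
  have fin: "emeasure m U < \<infinity>"
    using emeasure_mono[OF UK radon_compact_sets[OF r f(4)]] radon_finite_compact[OF r f(4)]
        by (rule le_less_trans)
  have "0 < measure m U"
    using haar_open_pos[OF m U, of 0] fin f(3) unfolding U_def[symmetric]
    by (simp add: measure_def enn2real_positive_iff U_def)
  moreover have "measure m U * (1/2) \<le> (\<integral>x. f x \<partial>m)"
  proof -
    have Um: "U \<in> sets m" using U radon_sets[OF r] by simp
    have "measure m U * (1/2) = (\<integral>x. indicator U x * (1/2) \<partial>m)" using Um fin by simp
    also have "\<dots> \<le> (\<integral>x. f x \<partial>m)"
    proof (rule integral_mono[OF _ int])
      show "integrable m (\<lambda>x. indicator U x * (1/2::real))"
        using Um fin by (intro integrable_mult_left integrable_real_indicator) auto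
      show "indicator U x * (1/2) \<le> f x" for x
        using f(2)[of x] by (auto simp: U_def indicator_def)
    qed
    finally show ?thesis .
  qed
  ultimately have I: "(\<integral>x. f x \<partial>m) > 0" by linarith
  show ?thesis
  proof (rule that[of "\<lambda>x. f x / (\<integral>x. f x \<partial>m)" K])
    show "(\<integral>x. complex_of_real (f x / (\<integral>x. f x \<partial>m)) \<partial>m) = 1"
      using I by (subst integral_complex_of_real) simp
  qed (use f I in \<open>auto intro!: continuous_intros\<close>)
qed

section \<open>Total mass along a van Hove net\<close>

lemma closed_diff_compact:
  fixes S K :: "'a::topological_ab_group_add set"
  assumes S: "closed S" and K: "compact K"
  shows "closed {b - k | b k. b \<in> S \<and> k \<in> K}"
proof -
  have "open {x. \<forall>k\<in>K. x + k \<notin> S}"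
  proof (subst open_subopen, safe)
    fix x assume x: "\<forall>k\<in>K. x + k \<notin> S"
    define W where "W = {p :: 'a \<times> 'a. fst p + snd p \<in> - S}"
    have "W = (\<lambda>p. fst p + snd p) -` (- S)" by (auto simp: W_def)
    moreover have "open ((\<lambda>p::'a \<times> 'a. fst p + snd p) -` (- S))"
      by (rule open_vimage) (use S in \<open>auto intro!: continuous_intros\<close>)
    ultimately have W: "open W" by simp
    have xW: "{x} \<times> K \<subseteq> W" using x by (auto simp: W_def)
    obtain X where X: "x \<in> X" "open X" "X \<times> K \<subseteq> W"
      using Elementary_Topology.tube_lemma[OF K W xW] by auto
    have "X \<subseteq> {x. \<forall>k\<in>K. x + k \<notin> S}"
    proof safe
      fix y k assume "y \<in> X" "k \<in> K" "y + k \<in> S"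
      then have "(y, k) \<in> W" using X(3) by auto
      then show False using \<open>y + k \<in> S\<close> by (simp add: W_def)
    qed
    then show "\<exists>T. open T \<and> x \<in> T \<and> T \<subseteq> {x. \<forall>k\<in>K. x + k \<notin> S}"
      using X by (intro exI[of _ X]) simp
  qed
  moreover have "- {x. \<forall>k\<in>K. x + k \<notin> S} = {b - k | b k. b \<in> S \<and> k \<in> K}"
  proof (intro set_eqI iffI)
    fix x assume "x \<in> - {x. \<forall>k\<in>K. x + k \<notin> S}"
    then obtain k where "k \<in> K" "x + k \<in> S" by auto
    moreover have "x = (x + k) - k" by simp
    ultimately show "x \<in> {b - k | b k. b \<in> S \<and> k \<in> K}" by blast
  qed (force simp: bex_simps)
  ultimately show ?thesis by (metis (no_types, lifting) closed_Compl)
qed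

lemma compact_sum_set:
  fixes S K :: "'a::topological_ab_group_add set"
  assumes "compact S" "compact K"
  shows "compact {a + k | a k. a \<in> S \<and> k \<in> K}"
proof -
  have "{a + k | a k. a \<in> S \<and> k \<in> K} = (\<lambda>p. fst p + snd p) ` (S \<times> K)" by force
  then show ?thesis
    using assms by (auto intro!: compact_continuous_image compact_Times continuous_intros)
qed

text \<open>
  The closure of \<open>A + K\<close> is covered by \<open>A\<close> and its van Hove boundary. The boundary must be shown to
  be a Borel set, since \<open>measure\<close> is \<open>0\<close> on other sets.
\<close>

lemma measure_closure_sum_le:
  fixes m :: "'a::{topological_ab_group_add, t2_space} measure"
  assumes m: "radon_measure m" and A: "open A" "compact (closure A)" and K: "compact K"
  shows "compact (closure {a + k | a k. a \<in> A \<and> k \<in> K})"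
    and "measure m (closure {a + k | a k. a \<in> A \<and> k \<in> K}) \<le> measure m A
        + measure m (van_hove_boundary K A)"
proof -
  let ?S = "{a + k | a k. a \<in> A \<and> k \<in> K}" and ?T = "{a + k | a k. a \<in> closure A \<and> k \<in> K}"
  have T: "compact ?T" by (rule compact_sum_set[OF A(2) K])
  have "?S \<subseteq> ?T" using closure_subset by blast
  then have sub: "closure ?S \<subseteq> ?T" by (rule closure_minimal) (rule compact_imp_closed[OF T])
  then have "closure ?S \<inter> ?T = closure ?S" by (rule Int_absorb2)
  then show S: "compact (closure ?S)" using closed_Int_compact[OF closed_closure[of ?S] T] by simp
  have bo: "van_hove_boundary K A \<in> sets borel"
  proof -
    have "closed {b - k | b k. b \<in> - A \<and> k \<in> K}" by (rule closed_diff_compact) (use A K in auto)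
    then have "closed {b - k | b k. b \<notin> A \<and> k \<in> K}" by simp
    then show ?thesis unfolding van_hove_boundary_def using A(1)
        by (intro sets.Un sets.Diff sets.Int) auto
  qed
  have meas: "X \<in> fmeasurable m" if "X \<in> sets borel" "X \<subseteq> C" "compact C" for X C
  proof (rule fmeasurableI)
    show "X \<in> sets m" using that radon_sets[OF m] by simp
    show "emeasure m X < \<infinity>"
      using emeasure_mono[OF that(2) radon_compact_sets[OF m that(3)]] radon_finite_compact[OF m that(3)] by (rule le_less_trans)
  qed
  have b: "van_hove_boundary K A \<in> fmeasurable m"
    by (rule meas[OF bo, of "closure ?S \<union> closure A"]) (use S A in \<open>auto simp: van_hove_boundary_def\<close>)
  have a: "A \<in> fmeasurable m" by (rule meas[OF _ closure_subset A(2)]) (use A in auto)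
  have "measure m (closure ?S) \<le> measure m (A \<union> van_hove_boundary K A)"
    by (rule measure_mono_fmeasurable)
      (use a b radon_compact_sets[OF m S] in \<open>auto simp: van_hove_boundary_def intro: fmeasurable.Un\<close>)
  also have "\<dots> \<le> measure m A + measure m (van_hove_boundary K A)"
    by (rule measure_Un_le) (use a b in \<open>auto simp: fmeasurable_def\<close>)
  finally show "measure m (closure ?S) \<le> measure m A + measure m (van_hove_boundary K A)" .
qed

lemma continuous_on_pair_args:
  fixes f :: "'a::topological_ab_group_add \<Rightarrow> 'b::topological_space"
  assumes "continuous_on UNIV f"
  shows "continuous_on UNIV (\<lambda>p. f (fst p))" "continuous_on UNIV (\<lambda>p. f (snd p))"
    "continuous_on UNIV (\<lambda>p. f (fst p - snd p))" "continuous_on UNIV (\<lambda>p. f (fst p - t))"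
    "continuous_on UNIV (\<lambda>p. f (fst p + snd p))" "continuous_on UNIV (\<lambda>p. f (snd p + fst p))"
  by (rule continuous_on_compose2[OF assms], auto intro!: continuous_intros)+

lemma jointly_Cc_mult_diff:
  fixes f g :: "'a::{topological_ab_group_add, t2_space} \<Rightarrow> complex"
  assumes f: "f \<in> Cc" and g: "g \<in> Cc"
  shows "jointly_Cc (\<lambda>u s. f u * g (u - s))"
proof -
  obtain K where K: "compact K" "\<And>x. f x \<noteq> 0 \<Longrightarrow> x \<in> K" using CcE[OF f] by blast
  obtain L where L: "compact L" "\<And>x. g x \<noteq> 0 \<Longrightarrow> x \<in> L" using CcE[OF g] by blast
  show ?thesis
  proof (rule jointly_CcI[of _ K "{a + k | a k. a \<in> K \<and> k \<in> uminus ` L}"])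
    show "compact {a + k | a k. a \<in> K \<and> k \<in> uminus ` L}"
      by (intro compact_sum_set K compact_continuous_image L continuous_intros)
    show "continuous_on UNIV (\<lambda>p. f (fst p) * g (fst p - snd p))"
      by (intro continuous_on_mult continuous_on_pair_args Cc_cont f g)
    fix u s assume "f u * g (u - s) \<noteq> 0"
    then have 1: "u \<in> K" "u - s \<in> L" using K(2) L(2) by auto
    then show "u \<in> K" by simp
    have "s = u + (- (u - s))" by simp
    then show "s \<in> {a + k | a k. a \<in> K \<and> k \<in> uminus ` L}" using 1 by blast
  qed (rule K)
qed

lemma jointly_Cc_mult_add:
  fixes f g :: "'a::{topological_ab_group_add, t2_space} \<Rightarrow> complex"
  assumes f: "f \<in> Cc" and g: "g \<in> Cc"
  shows "jointly_Cc (\<lambda>u s. f u * g (u + s))"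
proof -
  obtain K where K: "compact K" "\<And>x. f x \<noteq> 0 \<Longrightarrow> x \<in> K" using CcE[OF f] by blast
  obtain L where L: "compact L" "\<And>x. g x \<noteq> 0 \<Longrightarrow> x \<in> L" using CcE[OF g] by blast
  show ?thesis
  proof (rule jointly_CcI[of _ K "{a + k | a k. a \<in> L \<and> k \<in> uminus ` K}"])
    show "compact {a + k | a k. a \<in> L \<and> k \<in> uminus ` K}"
      by (intro compact_sum_set L compact_continuous_image K continuous_intros)
    show "continuous_on UNIV (\<lambda>p. f (fst p) * g (fst p + snd p))"
      by (intro continuous_on_mult continuous_on_pair_args Cc_cont f g)
    fix u s assume "f u * g (u + s) \<noteq> 0"
    then have 1: "u \<in> K" "u + s \<in> L" using K(2) L(2) by auto
    then show "u \<in> K" by simp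
    have "s = (u + s) + (- u)" by simp
    then show "s \<in> {a + k | a k. a \<in> L \<and> k \<in> uminus ` K}" using 1 by blast
  qed (rule K)
qed

text \<open>
  A total mass estimate by smearing: if \<open>g\<close> is a bump with integral \<open>1\<close>, then \<open>\<mu>(\<psi>)\<close> is the integral
  over \<open>t\<close> of \<open>\<mu>(\<psi> g(t - s))\<close>, the functional acting in \<open>s\<close>. By translation boundedness the
  integrand is at most a constant times the norm of \<open>\<psi>\<close>, and it vanishes unless \<open>t\<close> lies in \<open>A + K\<close>,
  where \<open>K\<close> supports \<open>g\<close>.
\<close>

lemma translation_bounded_restrict_bound:
  fixes \<mu> :: "'a::{topological_ab_group_add, t2_space} functional"
  assumes lc: "locally_compact_space (euclidean :: 'a topology)" and m: "haar_measure m"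
    and tb: "translation_bounded \<mu>"
  shows "\<exists>D\<ge>0. \<exists>K. compact K \<and> (\<forall>A. \<forall>\<psi>\<in>Cc. \<forall>B. open A \<longrightarrow> compact (closure A) \<longrightarrow> (\<forall>x. cmod (\<psi> x) \<le> B)
     \<longrightarrow> cmod (restrict_functional \<mu> A \<psi>) \<le> measure m (closure {a + k | a k. a \<in> A \<and> k \<in> K}) * (D * B))"
proof -
  have \<mu>: "is_measure \<mu>" using tb by (simp add: translation_bounded_def)
  note r = haar_radon[OF m]
  obtain g :: "'a \<Rightarrow> real" and K where g: "continuous_on UNIV g" "\<And>x. 0 \<le> g x" "compact K"
    "\<And>x. g x \<noteq> 0 \<Longrightarrow> x \<in> K" "(\<integral>x. complex_of_real (g x) \<partial>m) = 1"
    using haar_bump[OF lc m open_UNIV UNIV_I] by metis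
  have gCc: "(\<lambda>x. complex_of_real (g x)) \<in> Cc"
    by (rule CcI[OF _ g(3)]) (use g in \<open>auto intro!: continuous_intros\<close>)
  obtain G where G: "G \<ge> 0" "\<And>x. cmod (complex_of_real (g x)) \<le> G" using Cc_bounded[OF gCc] by blast
  have nK: "compact (uminus ` K)" using g(3) by (intro compact_continuous_image continuous_intros)
  obtain C where C: "C \<ge> 0" "\<forall>\<psi>\<in>Cc. \<forall>t B. (\<forall>x. \<psi> x \<noteq> 0 \<longrightarrow> x - t \<in> uminus ` K) \<longrightarrow> (\<forall>x. cmod (\<psi> x) \<le> B)
           \<longrightarrow> cmod (\<mu> \<psi>) \<le> C * B"
    using translation_bounded_bound[OF lc tb nK] by blast
  have main: "cmod (\<mu> \<psi>) \<le> measure m (closure {a + k | a k. a \<in> A \<and> k \<in> K}) * (C * G * B)"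
    if A: "open A" "compact (closure A)" and \<psi>: "\<psi> \<in> Cc" "\<And>x. cmod (\<psi> x) \<le> B" "\<And>x. \<psi> x \<noteq> 0 \<Longrightarrow> x \<in> A"
        for A \<psi> B
  proof -
    let ?S = "closure {a + k | a k. a \<in> A \<and> k \<in> K}"
    define \<Phi> where "\<Phi> t s = \<psi> s * complex_of_real (g (t - s))" for t s
    have S: "compact ?S" by (rule measure_closure_sum_le(1)[OF r A g(3)])
    have in_S: "t \<in> ?S" if "\<Phi> t s \<noteq> 0" for t s
    proof -
      have "s \<in> A" "t - s \<in> K" using that \<psi>(3) g(4) by (auto simp: \<Phi>_def)
      moreover have "t = s + (t - s)" by simp
      ultimately have "t \<in> {a + k | a k. a \<in> A \<and> k \<in> K}" by blast
      then show ?thesis by (rule subsetD[OF closure_subset])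
    qed
    have J: "jointly_Cc \<Phi>"
      using jointly_Cc_swap[OF jointly_Cc_mult_diff[OF \<psi>(1) Cc_uminus[OF gCc]]]
          by (simp add: \<Phi>_def[abs_def])
    have "(\<integral>t. \<Phi> t s \<partial>m) = \<psi> s" for s
      using haar_integral_translate[OF m gCc, of "- s"] g(5) by (simp add: \<Phi>_def)
    then have "\<mu> \<psi> = (\<integral>t. \<mu> (\<Phi> t) \<partial>m)" using integral_measure_Fubini[OF r \<mu> J] by simp
    also have "cmod \<dots> \<le> measure m ?S * (C * (G * B))"
    proof (rule integral_Cc_bound[OF r measure_section_Cc[OF \<mu> J] S])
      fix t
      show "cmod (\<mu> (\<Phi> t)) \<le> C * (G * B)"
      proof (rule C(2)[rule_format, OF jointly_Cc_section[OF J], of _ t])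
        fix s
        have "cmod (\<Phi> t s) \<le> B * G" unfolding \<Phi>_def norm_mult
          by (intro mult_mono \<psi> G order_trans[OF norm_ge_zero \<psi>(2)]) auto
        then show "cmod (\<Phi> t s) \<le> G * B" by (simp add: mult.commute)
        assume "\<Phi> t s \<noteq> 0"
        then have "t - s \<in> K" using g(4) by (auto simp: \<Phi>_def)
        then show "s - t \<in> uminus ` K" by (metis imageI minus_diff_eq)
      qed
      assume ne: "\<mu> (\<Phi> t) \<noteq> 0"
      show "t \<in> ?S"
      proof (rule ccontr)
        assume "t \<notin> ?S"
        then have "\<Phi> t = (\<lambda>_. 0)" using in_S by blast
        then show False using ne is_measure_zero[OF \<mu>] by simp
      qed
    qed
    finally show ?thesis by (simp add: mult.assoc)
  qed
  show ?thesis
  proof (rule exI[of _ "C * G"], intro conjI, use C G in simp, rule exI[of _ K], intro conjI allI ballI impI g(3))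
    fix A :: "'a set" and B and \<psi> :: "'a \<Rightarrow> complex"
    assume A: "open A" "compact (closure A)" and \<psi>: "\<psi> \<in> Cc" "\<forall>x. cmod (\<psi> x) \<le> B"
    show "cmod (restrict_functional \<mu> A \<psi>) \<le> measure m (closure {a + k | a k. a \<in> A \<and> k \<in> K}) * (C
        * G * B)"
    proof (rule restrict_functional_le[OF lc \<mu> A \<psi>(1)], rule main[OF A])
      fix h :: "'a \<Rightarrow> real" and x assume h: "continuous_on UNIV h" "\<And>x. 0 \<le> h x" "\<And>x. h x \<le> indicator A x"
      show "cutoff h \<psi> \<in> Cc" using h \<psi> by (intro Cc_mult_cont continuous_on_of_real)
      show "cmod (complex_of_real (h x) * \<psi> x) \<le> B" by (rule norm_cutoff_le[OF h(2,3) \<psi>(2)[rule_format]])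
      assume "complex_of_real (h x) * \<psi> x \<noteq> 0"
      then have "h x \<noteq> 0" by auto
      then have "0 < h x" using h(2)[of x] by linarith
      then show "x \<in> A" using h(3)[of x] by (cases "x \<in> A") auto
    qed
  qed
qed

lemma eventually_net_filter_index: "directed I le \<Longrightarrow> \<forall>\<^sub>F i in net_filter I le. i \<in> I"
proof -
  assume "directed I le"
  then obtain i where i: "i \<in> I" by (auto simp: directed_def)
  have "net_filter I le \<le> principal {j \<in> I. le i j}" unfolding net_filter_def by (rule INF_lower[OF i])
  then show ?thesis by (auto simp: le_principal elim: eventually_mono)
qed

text \<open>
  Along a van Hove net the measure of \<open>A\<^sub>i + K\<close> is eventually at most twice that of \<open>A\<^sub>i\<close>, so the
  total mass of the restrictions is of the order of \<open>|A\<^sub>i|\<close>.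
\<close>

lemma van_hove_restrict_bound:
  fixes \<mu> :: "'a::{topological_ab_group_add, t2_space} functional"
  assumes lc: "locally_compact_space (euclidean :: 'a topology)" and m: "haar_measure m"
    and tb: "translation_bounded \<mu>" and vh: "van_hove_net m I le A"
  shows "\<exists>D\<ge>0. \<forall>\<^sub>F i in net_filter I le. \<forall>\<psi>\<in>Cc. \<forall>B. (\<forall>x. cmod (\<psi> x) \<le> B)
     \<longrightarrow> cmod (restrict_functional \<mu> (A i) \<psi>) \<le> D * B * measure m (A i)"
proof -
  obtain D K where D: "D \<ge> 0" and K: "compact K" and b: "\<forall>A. \<forall>\<psi>\<in>Cc. \<forall>B. open A
      \<longrightarrow> compact (closure A) \<longrightarrow> (\<forall>x. cmod (\<psi> x) \<le> B)
     \<longrightarrow> cmod (restrict_functional \<mu> A \<psi>) \<le> measure m (closure {a + k | a k. a \<in> A \<and> k \<in> K}) * (D * B)"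
    using translation_bounded_restrict_bound[OF lc m tb] by blast
  have A: "open (A i)" "compact (closure (A i))" "measure m (A i) > 0" if "i \<in> I" for i
    using vh that by (auto simp: van_hove_net_def)
  have "((\<lambda>i. measure m (van_hove_boundary K (A i)) / measure m (A i)) \<longlongrightarrow> 0) (net_filter I le)"
    using vh K by (auto simp: van_hove_net_def)
  then have "\<forall>\<^sub>F i in net_filter I le. measure m (van_hove_boundary K (A i)) / measure m (A i) < 1"
    by (rule order_tendstoD) simp
  moreover have "\<forall>\<^sub>F i in net_filter I le. i \<in> I"
    using vh by (intro eventually_net_filter_index) (auto simp: van_hove_net_def)
  ultimately have "\<forall>\<^sub>F i in net_filter I le. \<forall>\<psi>\<in>Cc. \<forall>B. (\<forall>x. cmod (\<psi> x) \<le> B)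
     \<longrightarrow> cmod (restrict_functional \<mu> (A i) \<psi>) \<le> (2 * D) * B * measure m (A i)"
  proof eventually_elim
    case (elim i)
    have "measure m (van_hove_boundary K (A i)) < measure m (A i)" using elim A(3)[of i]
        by (simp add: field_simps)
    then have le: "measure m (closure {a + k | a k. a \<in> A i \<and> k \<in> K}) \<le> 2 * measure m (A i)"
      using measure_closure_sum_le(2)[OF haar_radon[OF m] A(1,2) K, of i] elim by linarith
    show ?case
    proof (intro ballI allI impI)
      fix \<psi> :: "'a \<Rightarrow> complex" and B assume \<psi>: "\<psi> \<in> Cc" "\<forall>x. cmod (\<psi> x) \<le> B"
      then have "B \<ge> 0" using norm_ge_zero order_trans by blast
      have "cmod (restrict_functional \<mu> (A i) \<psi>) \<le> measure m (closure {a + k | a k. a \<in> A i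
          \<and> k \<in> K}) * (D * B)"
        using b[rule_format, OF \<psi>(1) A(1,2)] elim \<psi>(2) by blast
      also have "\<dots> \<le> 2 * measure m (A i) * (D * B)" using D \<open>B \<ge> 0\<close> by (intro mult_right_mono le) auto
      finally show "cmod (restrict_functional \<mu> (A i) \<psi>) \<le> (2 * D) * B * measure m (A i)"
          by (simp add: algebra_simps)
    qed
  qed
  then show ?thesis using D by (intro exI[of _ "2 * D"]) auto
qed

section \<open>Correlations and inner products\<close>

text \<open>
  The property of the restrictions to \<open>A\<^sub>i\<close> that makes their convolutions with test functions test
  functions again.
\<close>

definition compactly_supported :: "'a::t2_space functional \<Rightarrow> bool" where
  "compactly_supported M \<longleftrightarrow> is_measure M \<and>
     (\<exists>S. compact S \<and> (\<forall>\<phi>\<in>Cc. (\<forall>x\<in>S. \<phi> x = 0) \<longrightarrow> M \<phi> = 0))"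

lemma compactly_supported_restrict:
  fixes \<mu> :: "'a::t2_space functional"
  assumes "locally_compact_space (euclidean :: 'a topology)" "is_measure \<mu>" "open A"
      "compact (closure A)"
  shows "compactly_supported (restrict_functional \<mu> A)"
  unfolding compactly_supported_def
proof (intro conjI exI[of _ "closure A"] ballI impI)
  show "is_measure (restrict_functional \<mu> A)" by (rule is_measure_restrict[OF assms])
  fix \<phi> :: "'a \<Rightarrow> complex" assume "\<phi> \<in> Cc" "\<forall>x\<in>closure A. \<phi> x = 0"
  then show "restrict_functional \<mu> A \<phi> = 0"
    using restrict_functional_zero[OF assms] closure_subset[of A] by blast
qed (rule assms)

lemma Cc_cutoff:
  fixes S :: "'a::t2_space set"
  assumes lc: "locally_compact_space (euclidean :: 'a topology)" and S: "compact S"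
  shows "\<exists>h\<in>Cc. \<forall>x\<in>S. h x = (1 :: complex)"
proof -
  have "\<exists>f K. continuous_on UNIV f \<and> (\<forall>y. 0 \<le> f y) \<and> f x = (1::real) \<and> compact K \<and> (\<forall>y. f y \<noteq> 0
      \<longrightarrow> y \<in> K)" for x :: 'a
  proof -
    obtain f :: "'a \<Rightarrow> real" and K where f: "continuous_on UNIV f" "\<And>y. 0 \<le> f y" "\<And>y. f y \<le> 1" "f x = 1"
      "compact K" "K \<subseteq> UNIV" "\<And>y. f y \<noteq> 0 \<Longrightarrow> y \<in> K"
      using lc_bump[OF lc open_UNIV UNIV_I[of x]] by metis
    then show ?thesis by (intro exI[of _ f] exI[of _ K]) auto
  qed
  then obtain f K where f: "\<And>x. continuous_on UNIV (f x)" "\<And>x y. 0 \<le> f x y" "\<And>x. f x x = (1::real)"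
    "\<And>x::'a. compact (K x)" "\<And>x y. f x y \<noteq> 0 \<Longrightarrow> y \<in> K x" by metis
  have "S \<subseteq> (\<Union>x\<in>S. {y. 1/2 < f x y})" using f(3) by auto
  then obtain F where F: "finite F" "S \<subseteq> (\<Union>x\<in>F. {y. 1/2 < f x y})"
    by (rule compactE_image[OF S, rotated]) (auto intro!: open_Collect_less continuous_intros f)
  define h where "h y = min 1 (2 * (\<Sum>x\<in>F. f x y))" for y
  have "(\<lambda>y. complex_of_real (h y)) \<in> Cc"
  proof (rule CcI[of _ "\<Union>x\<in>F. K x"])
    show "continuous_on UNIV (\<lambda>y. complex_of_real (h y))"
      unfolding h_def by (intro continuous_intros continuous_on_min f)
    show "compact (\<Union>x\<in>F. K x)" using F f by (intro compact_UN) auto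
    show "y \<in> (\<Union>x\<in>F. K x)" if "complex_of_real (h y) \<noteq> 0" for y
    proof (rule ccontr)
      assume "y \<notin> (\<Union>x\<in>F. K x)"
      then have "f x y = 0" if "x \<in> F" for x using f(5) that by auto
      then have "h y = 0" by (simp add: h_def)
      then show False using that by simp
    qed
  qed
  moreover have "h y = 1" if y: "y \<in> S" for y
  proof -
    obtain x where x: "x \<in> F" "1/2 < f x y" using F y by auto
    have "f x y \<le> (\<Sum>x\<in>F. f x y)" by (rule member_le_sum[OF x(1)]) (use F f in auto)
    then show ?thesis using x by (simp add: h_def)
  qed
  ultimately show ?thesis by (intro bexI[of _ "\<lambda>y. complex_of_real (h y)"]) auto
qed

text \<open>
  The function \<open>(s, t) \<mapsto> \<theta>(s + t)\<close> need not have compact support, but multiplying it by a cutoff in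
  \<open>s\<close> that equals \<open>1\<close> on the support of \<open>M\<close> does not change the value of \<open>M\<close>.
\<close>

lemma compactly_supported_section_Cc:
  fixes M :: "'a::{topological_ab_group_add, t2_space} functional"
  assumes lc: "locally_compact_space (euclidean :: 'a topology)"
    and M: "compactly_supported M" and \<theta>: "\<theta> \<in> Cc"
  shows "(\<lambda>t. M (\<lambda>s. \<theta> (s + t))) \<in> Cc"
proof -
  obtain S where S: "compact S" "\<And>\<phi>. \<phi> \<in> Cc \<Longrightarrow> (\<And>x. x \<in> S \<Longrightarrow> \<phi> x = 0) \<Longrightarrow> M \<phi> = 0" and m: "is_measure M"
    using M unfolding compactly_supported_def by blast
  obtain h :: "'a \<Rightarrow> complex" where h: "h \<in> Cc" "\<And>x. x \<in> S \<Longrightarrow> h x = 1" using Cc_cutoff[OF lc S(1)] by blast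
  define \<Phi> where "\<Phi> t s = h s * \<theta> (s + t)" for t s
  have J: "jointly_Cc \<Phi>"
    using jointly_Cc_swap[OF jointly_Cc_mult_add[OF h(1) \<theta>]] by (simp add: \<Phi>_def[abs_def])
  have "M (\<lambda>s. \<theta> (s + t)) = M (\<Phi> t)" for t
  proof -
    have "M (\<lambda>s. \<theta> (s + t) - \<Phi> t s) = 0"
      by (rule S(2)) (use h in \<open>auto simp: \<Phi>_def intro!: Cc_diff Cc_translate \<theta> jointly_Cc_section[OF J, unfolded \<Phi>_def]\<close>)
    then show ?thesis by (simp add: is_measure_diff[OF m Cc_translate[OF \<theta>] jointly_Cc_section[OF J]])
  qed
  then show ?thesis using measure_section_Cc[OF m J] by simp
qed

lemma conv_fun_Cc:
  fixes M :: "'a::{topological_ab_group_add, t2_space} functional"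
  assumes lc: "locally_compact_space (euclidean :: 'a topology)"
    and M: "compactly_supported M" and \<theta>: "\<theta> \<in> Cc"
  shows "conv_fun M \<theta> \<in> Cc"
proof -
  have "(\<lambda>t. M (\<lambda>s. \<theta> (- (s + - t)))) \<in> Cc"
    by (rule Cc_uminus[OF compactly_supported_section_Cc[OF lc M Cc_uminus[OF \<theta>]]])
  then show ?thesis by (simp add: conv_fun_def[abs_def])
qed

lemma conv_finite_reflect:
  fixes M N :: "'a::{topological_ab_group_add, t2_space} functional"
  assumes lc: "locally_compact_space (euclidean :: 'a topology)"
    and M: "compactly_supported M" and N: "is_measure N" and \<theta>: "\<theta> \<in> Cc"
  shows "conv_finite M (reflect_functional N) \<theta> = cnj (N (\<lambda>t. cnj (M (\<lambda>s. \<theta> (s - t)))))"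
    and "(\<lambda>t. cnj (M (\<lambda>s. \<theta> (s - t)))) \<in> Cc"
proof -
  have m: "is_measure M" using M by (simp add: compactly_supported_def)
  have sec: "(\<lambda>t. M (\<lambda>s. \<theta> (s + t))) \<in> Cc" by (rule compactly_supported_section_Cc[OF lc M \<theta>])
  have "conv_finite M (reflect_functional N) \<theta> = integral_against
      (reflect_functional N) (\<lambda>t. M (\<lambda>s. \<theta> (s + t)))"
    unfolding conv_finite_def by (simp add: integral_against_Cc[OF lc m Cc_translate[OF \<theta>]])
  also have "\<dots> = reflect_functional N (\<lambda>t. M (\<lambda>s. \<theta> (s + t)))"
    by (rule integral_against_Cc[OF lc is_measure_reflect[OF N] sec])
  finally show "conv_finite M (reflect_functional N) \<theta> = cnj (N (\<lambda>t. cnj (M (\<lambda>s. \<theta> (s - t)))))"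
    by (simp add: reflect_functional_def reflect_fun_def)
  show "(\<lambda>t. cnj (M (\<lambda>s. \<theta> (s - t)))) \<in> Cc" using Cc_reflect_fun[OF sec] by (simp add: reflect_fun_def)
qed

text \<open>
  Up to reflection this is \<open>f\<close> convolved with \<open>reflect_fun g\<close>; for \<open>f = g\<close> it is the function to
  which an autocorrelation is applied when its Fourier transform is tested.
\<close>

definition correlation :: "'a::ab_group_add measure \<Rightarrow> ('a \<Rightarrow> complex) \<Rightarrow> ('a \<Rightarrow> complex) \<Rightarrow> 'a \<Rightarrow> complex" where
  "correlation m f g s = (\<integral>u. f u * cnj (g (u + s)) \<partial>m)"

lemma correlation_Cc:
  fixes m :: "'a::{topological_ab_group_add, t2_space} measure"
  assumes m: "radon_measure m" and f: "f \<in> Cc" and g: "g \<in> Cc"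
  shows "correlation m f g \<in> Cc"
  using measure_section_Cc[OF is_measure_integral[OF m] jointly_Cc_swap[OF jointly_Cc_mult_add[OF f Cc_cnj[OF g]]]]
  by (simp add: correlation_def[abs_def])

lemma conv_fun_correlation:
  "conv_fun \<gamma> (fun_conv m \<phi> (reflect_fun \<phi>)) 0 = \<gamma> (correlation m \<phi> \<phi>)"
proof -
  have "- (- s - u) = u + s" for s u :: 'a by simp
  then show ?thesis by (simp add: conv_fun_def fun_conv_def reflect_fun_def correlation_def[abs_def])
qed

text \<open>
  The inner product in \<open>L\<^sup>2\<close> of the smoothed measures \<open>M * f\<close> and \<open>N * g\<close>.
\<close>

definition pairing ::
    "'a::ab_group_add measure \<Rightarrow> 'a functional \<Rightarrow> 'a functional \<Rightarrow> ('a \<Rightarrow> complex) \<Rightarrow> ('a \<Rightarrow> complex) \<Rightarrow> complex" where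
  "pairing m M N f g = (\<integral>u. conv_fun M f u * cnj (conv_fun N g u) \<partial>m)"

text \<open>
  The identity behind the proof. Translation of the Haar integral by \<open>-s\<close> turns the correlation at
  \<open>s - t\<close> into the integral over \<open>u\<close> of \<open>f(u - s) cnj (g(u - t))\<close>; now \<open>M\<close> in \<open>s\<close> and \<open>N\<close> in \<open>t\<close> are
  pulled under the integral.
\<close>

lemma conv_finite_correlation:
  fixes m :: "'a::{topological_ab_group_add, t2_space} measure"
  assumes lc: "locally_compact_space (euclidean :: 'a topology)" and m: "haar_measure m"
    and M: "compactly_supported M" and N: "compactly_supported N" and f: "f \<in> Cc" and g: "g \<in> Cc"
  shows "conv_finite M (reflect_functional N) (correlation m f g) = pairing m M N f g"
proof -
  note r = haar_radon[OF m]
  have mM: "is_measure M" and mN: "is_measure N" using M N by (auto simp: compactly_supported_def)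
  define P where "P = conv_fun M f"
  have P: "P \<in> Cc" unfolding P_def by (rule conv_fun_Cc[OF lc M f])
  have 1: "M (\<lambda>s. correlation m f g (s - t)) = (\<integral>u. P u * cnj (g (u - t)) \<partial>m)" for t
  proof -
    have eq: "correlation m f g (s - t) = (\<integral>u. f (u - s) * cnj (g (u - t)) \<partial>m)" for s
    proof -
      have "(\<lambda>u. f u * cnj (g (u + (s - t)))) \<in> Cc"
        by (intro Cc_mult_cont Cc_cont f Cc_cnj Cc_translate g)
      from haar_integral_translate[OF m this, of "- s"] show ?thesis
        by (simp add: correlation_def algebra_simps)
    qed
    have J: "jointly_Cc (\<lambda>u s. f (u - s) * cnj (g (u - t)))"
      using jointly_Cc_mult_diff[OF Cc_cnj[OF Cc_translate_diff[OF g]] f, of t]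
          by (simp add: mult.commute)
    have "M (\<lambda>s. correlation m f g (s - t)) = (\<integral>u. M (\<lambda>s. f (u - s) * cnj (g (u - t))) \<partial>m)"
      unfolding eq by (rule integral_measure_Fubini[OF r mM J])
    also have "\<dots> = (\<integral>u. P u * cnj (g (u - t)) \<partial>m)"
      using is_measure_cmult[OF mM Cc_reflect_translate[OF f], of "cnj (g (_ - t))"]
      by (simp add: P_def conv_fun_def mult.commute)
    finally show ?thesis .
  qed
  have J: "jointly_Cc (\<lambda>u t. cnj (P u) * g (u - t))" by (rule jointly_Cc_mult_diff[OF Cc_cnj[OF P] g])
  have "N (\<lambda>t. cnj (M (\<lambda>s. correlation m f g (s - t)))) = N (\<lambda>t. \<integral>u. cnj (P u) * g (u - t) \<partial>m)"
    unfolding 1 by (simp add: Bochner_Integration.integral_cnj[symmetric] del: Bochner_Integration.integral_cnj)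
  also have "\<dots> = (\<integral>u. N (\<lambda>t. cnj (P u) * g (u - t)) \<partial>m)" by (rule integral_measure_Fubini[OF r mN J])
  also have "\<dots> = (\<integral>u. cnj (P u) * conv_fun N g u \<partial>m)"
    by (simp add: is_measure_cmult[OF mN Cc_reflect_translate[OF g]] conv_fun_def)
  finally have "cnj (N (\<lambda>t. cnj (M (\<lambda>s. correlation m f g (s - t))))) = pairing m M N f g"
    by (simp add: pairing_def P_def Bochner_Integration.integral_cnj[symmetric] del: Bochner_Integration.integral_cnj)
  then show ?thesis
    using conv_finite_reflect(1)[OF lc M mN correlation_Cc[OF r f g]] by simp
qed

lemma pairing_integrable:
  fixes m :: "'a::{topological_ab_group_add, t2_space} measure"
  assumes lc: "locally_compact_space (euclidean :: 'a topology)" and m: "haar_measure m"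
    and M: "compactly_supported M" and N: "compactly_supported N" and f: "f \<in> Cc" and g: "g \<in> Cc"
  shows "integrable m (\<lambda>u. conv_fun M f u * cnj (conv_fun N g u))"
  by (intro Cc_integrable[OF haar_radon[OF m]] Cc_mult_cont Cc_cont Cc_cnj
      conv_fun_Cc[OF lc M f] conv_fun_Cc[OF lc N g])

lemma pairing_self:
  "pairing m M M f f = complex_of_real (\<integral>u. (cmod (conv_fun M f u))\<^sup>2 \<partial>m)"
  by (simp add: pairing_def complex_norm_square[symmetric] del: of_real_power)

text \<open>
  Cauchy--Schwarz with a parameter. The inequality is linear in the two energies, so it survives
  limits without square roots.
\<close>

lemma pairing_AM_GM:
  fixes m :: "'a::{topological_ab_group_add, t2_space} measure"
  assumes lc: "locally_compact_space (euclidean :: 'a topology)" and m: "haar_measure m"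
    and M: "compactly_supported M" and N: "compactly_supported N" and f: "f \<in> Cc" and g: "g \<in> Cc"
    and a: "a > 0"
  shows "cmod (pairing m M N f g) \<le> (a * cmod (pairing m M M f f) + cmod (pairing m N N g g) / a) / 2"
proof -
  let ?P = "conv_fun M f" and ?Q = "conv_fun N g"
  have sq: "integrable m (\<lambda>u. (cmod (conv_fun M f u))\<^sup>2)" if "compactly_supported M" "f \<in> Cc" for M
      and f :: "'a \<Rightarrow> complex"
  proof -
    have "integrable m (\<lambda>u. complex_of_real ((cmod (conv_fun M f u))\<^sup>2))"
      using pairing_integrable[OF lc m that(1) that(1) that(2) that(2)]
      by (simp add: complex_norm_square[symmetric] del: of_real_power)
    from integrable_Re[OF this] show ?thesis by simp
  qed
  have self: "cmod (pairing m M M f f) = (\<integral>u. (cmod (conv_fun M f u))\<^sup>2 \<partial>m)" for M f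
    unfolding pairing_self by (simp add: integral_nonneg_AE)
  have "cmod (pairing m M N f g) \<le> (\<integral>u. (a * (cmod (?P u))\<^sup>2 + (cmod (?Q u))\<^sup>2 / a) / 2 \<partial>m)"
    unfolding pairing_def
  proof (rule order_trans[OF integral_norm_bound integral_mono])
    show "integrable m (\<lambda>u. cmod (?P u * cnj (?Q u)))"
      by (rule integrable_norm[OF pairing_integrable[OF lc m M N f g]])
    show "integrable m (\<lambda>u. (a * (cmod (?P u))\<^sup>2 + (cmod (?Q u))\<^sup>2 / a) / 2)"
      using sq[OF M f] sq[OF N g] by auto
    fix u
    have "0 \<le> (a * cmod (?P u) - cmod (?Q u))\<^sup>2 / a" using a by simp
    also have "\<dots> = a * (cmod (?P u))\<^sup>2 + (cmod (?Q u))\<^sup>2 / a - 2 * (cmod (?P u) * cmod (?Q u))"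
      using a by (simp add: power2_eq_square field_simps)
    finally show "cmod (?P u * cnj (?Q u)) \<le> (a * (cmod (?P u))\<^sup>2 + (cmod (?Q u))\<^sup>2 / a) / 2"
      by (simp add: norm_mult)
  qed
  also have "\<dots> = (a * cmod (pairing m M M f f) + cmod (pairing m N N g g) / a) / 2"
    unfolding self using sq[OF M f] sq[OF N g] by simp
  finally show ?thesis .
qed

section \<open>Trigonometric polynomials on the dual group\<close>

lemma char_of_props:
  "continuous_on UNIV (char_of \<xi>)" "cmod (char_of \<xi> x) = 1" "char_of \<xi> (x + y) = char_of \<xi> x
      * char_of \<xi> y"
  using char_of[of \<xi>] by auto

lemma char_of_minus: "char_of \<xi> (- x) = cnj (char_of \<xi> x)"
proof -
  have nz: "char_of \<xi> x \<noteq> 0" using char_of_props(2)[of \<xi> x] by auto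
  have "char_of \<xi> 0 * char_of \<xi> x = char_of \<xi> x" using char_of_props(3)[of \<xi> 0 x] by simp
  then have "char_of \<xi> 0 = 1" using nz by simp
  then have "char_of \<xi> x * char_of \<xi> (- x) = 1" using char_of_props(3)[of \<xi> x "- x"] by simp
  moreover have "char_of \<xi> x * cnj (char_of \<xi> x) = 1"
      using char_of_props(2)[of \<xi> x] complex_norm_square[of "char_of \<xi> x"] by simp
  ultimately show ?thesis using nz by (metis mult_cancel_left)
qed

lemma open_dual_eval:
  assumes "open U" shows "open {\<xi>. char_of \<xi> x \<in> U}"
proof -
  have "open {\<xi>. char_of \<xi> ` {x} \<subseteq> U}"
    unfolding open_dual_def
    by (rule generate_topology.Basis, rule CollectI, rule exI[of _ "{x}"], rule exI[of _ U])
      (simp add: assms)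
  then show ?thesis by simp
qed

text \<open>
  Evaluations separate characters, so the dual group is Hausdorff; Stone--Weierstrass requires this.
\<close>

instance dual :: (topological_ab_group_add) t2_space
proof
  fix \<xi> \<eta> :: "'a dual" assume "\<xi> \<noteq> \<eta>"
  then obtain x where "char_of \<xi> x \<noteq> char_of \<eta> x" by (metis char_of_inject ext)
  then obtain U V where "open U" "open V" "char_of \<xi> x \<in> U" "char_of \<eta> x \<in> V" "U \<inter> V = {}"
    using hausdorff by metis
  then have "open {\<xi>. char_of \<xi> x \<in> U} \<and> open {\<xi>. char_of \<xi> x \<in> V} \<and> \<xi> \<in> {\<xi>. char_of \<xi> x \<in> U} \<and>
      \<eta> \<in> {\<xi>. char_of \<xi> x \<in> V} \<and> {\<xi>. char_of \<xi> x \<in> U} \<inter> {\<xi>. char_of \<xi> x \<in> V} = {}"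
    using open_dual_eval[of U x] open_dual_eval[of V x] by auto
  then show "\<exists>U V. open U \<and> open V \<and> \<xi> \<in> U \<and> \<eta> \<in> V \<and> U \<inter> V = {}"
    by - (rule exI[of _ "{\<xi>. char_of \<xi> x \<in> U}"], rule exI[of _ "{\<xi>. char_of \<xi> x \<in> V}"])
qed

inductive_set trig_poly :: "('a::topological_ab_group_add dual \<Rightarrow> complex) set" where
  character: "(\<lambda>\<xi>. char_of \<xi> x) \<in> trig_poly"
| const: "(\<lambda>_. c) \<in> trig_poly"
| add: "p \<in> trig_poly \<Longrightarrow> q \<in> trig_poly \<Longrightarrow> (\<lambda>\<xi>. p \<xi> + q \<xi>) \<in> trig_poly"
| mult: "p \<in> trig_poly \<Longrightarrow> q \<in> trig_poly \<Longrightarrow> (\<lambda>\<xi>. p \<xi> * q \<xi>) \<in> trig_poly"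

lemma trig_poly_continuous: "p \<in> trig_poly \<Longrightarrow> continuous_on UNIV p"
proof (induction rule: trig_poly.induct)
  case (character x)
  have "(\<lambda>\<xi>. char_of \<xi> x) -` U = {\<xi>. char_of \<xi> x \<in> U}" for U by auto
  then show ?case by (auto simp: continuous_on_open_vimage intro: open_dual_eval)
qed (auto intro: continuous_intros)

lemma trig_poly_bounded: "p \<in> trig_poly \<Longrightarrow> \<exists>b\<ge>0. \<forall>\<xi>. cmod (p \<xi>) \<le> b"
proof (induction rule: trig_poly.induct)
  case (character x)
  show ?case by (intro exI[of _ 1]) (simp add: char_of_props)
next
  case (const c)
  show ?case by (intro exI[of _ "cmod c"]) simp
next
  case (add p q)
  then obtain b c where "b \<ge> 0" "c \<ge> 0" "\<forall>\<xi>. cmod (p \<xi>) \<le> b" "\<forall>\<xi>. cmod (q \<xi>) \<le> c" by blast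
  then show ?case by (intro exI[of _ "b + c"]) (auto intro: norm_triangle_mono)
next
  case (mult p q)
  then obtain b c where "b \<ge> 0" "c \<ge> 0" "\<forall>\<xi>. cmod (p \<xi>) \<le> b" "\<forall>\<xi>. cmod (q \<xi>) \<le> c" by blast
  then show ?case by (intro exI[of _ "b * c"]) (auto simp: norm_mult intro: mult_mono)
qed

lemma trig_poly_cnj: "p \<in> trig_poly \<Longrightarrow> (\<lambda>\<xi>. cnj (p \<xi>)) \<in> trig_poly"
proof (induction rule: trig_poly.induct)
  case (character x)
  show ?case using trig_poly.character[of "- x"] by (simp add: char_of_minus)
qed (auto intro: trig_poly.intros)

lemma trig_poly_Re: "p \<in> trig_poly \<Longrightarrow> (\<lambda>\<xi>. complex_of_real (Re (p \<xi>))) \<in> trig_poly"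
proof -
  assume p: "p \<in> trig_poly"
  have "(\<lambda>\<xi>. (1/2) * (p \<xi> + cnj (p \<xi>))) \<in> trig_poly"
    by (intro trig_poly.mult trig_poly.const trig_poly.add p trig_poly_cnj)
  moreover have "(1/2) * (z + cnj z) = complex_of_real (Re z)" for z by (simp add: complex_eq_iff)
  ultimately show ?thesis by simp
qed

lemma trig_poly_Im: "p \<in> trig_poly \<Longrightarrow> (\<lambda>\<xi>. complex_of_real (Im (p \<xi>))) \<in> trig_poly"
proof -
  assume p: "p \<in> trig_poly"
  have "(\<lambda>\<xi>. complex_of_real (Re (- \<i> * p \<xi>))) \<in> trig_poly"
    by (intro trig_poly_Re trig_poly.mult trig_poly.const p)
  then show ?thesis by simp
qed

text \<open>
  Stone--Weierstrass on \<open>K \<union> L\<close> gives a real trigonometric polynomial \<open>r\<close> close to the indicator of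
  \<open>K\<close> there, but says nothing about its size elsewhere. As \<open>r\<close> is bounded, composing it with an
  ordinary polynomial that approximates the clamp to \<open>[0, 1]\<close> on the range of \<open>r\<close> yields a
  trigonometric polynomial that is also controlled globally.
\<close>

lemma trig_poly_separates_compacts:
  fixes K L :: "'a::topological_ab_group_add dual set"
  assumes K: "compact K" and L: "compact L" and disj: "K \<inter> L = {}" and \<delta>: "0 < \<delta>" "\<delta> \<le> 1"
  obtains p where "p \<in> trig_poly" "\<And>\<xi>. \<xi> \<in> K \<Longrightarrow> cmod (1 - p \<xi>) \<le> \<delta>" "\<And>\<xi>. \<xi> \<in> L \<Longrightarrow> cmod (p \<xi>) \<le> \<delta>"
    "\<And>\<xi>. cmod (p \<xi>) \<le> 2" "\<And>\<xi>. cmod (1 - p \<xi>) \<le> 2"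
proof -
  define R where "R = {r :: 'a dual \<Rightarrow> real. (\<lambda>\<xi>. complex_of_real (r \<xi>)) \<in> trig_poly}"
  interpret function_ring_on R "K \<union> L"
  proof
    show "compact (K \<union> L)" using K L by (rule compact_Un)
    show "continuous_on (K \<union> L) f" if "f \<in> R" for f
    proof -
      have "continuous_on UNIV (\<lambda>\<xi>. Re (complex_of_real (f \<xi>)))"
        by (intro continuous_on_Re trig_poly_continuous) (use that in \<open>simp add: R_def\<close>)
      then have "continuous_on UNIV f" by simp
      then show ?thesis by (rule continuous_on_subset) simp
    qed
    show "\<exists>f\<in>R. f \<xi> \<noteq> f \<eta>" if ne: "\<xi> \<noteq> \<eta>" for \<xi> \<eta>
    proof -
      obtain x where x: "char_of \<xi> x \<noteq> char_of \<eta> x" using ne by (metis char_of_inject ext)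
      have "(\<lambda>\<xi>. Re (char_of \<xi> x)) \<in> R" "(\<lambda>\<xi>. Im (char_of \<xi> x)) \<in> R"
        by (auto simp: R_def intro!: trig_poly_Re trig_poly_Im trig_poly.character)
      moreover have "Re (char_of \<xi> x) \<noteq> Re (char_of \<eta> x) \<or> Im (char_of \<xi> x) \<noteq> Im (char_of \<eta> x)"
        using x complex_eqI by blast
      ultimately show ?thesis by (elim disjE) (rule bexI, assumption+)+
    qed
  qed (auto simp: R_def intro: trig_poly.intros)
  have "continuous_on (K \<union> L) (\<lambda>\<xi>. if \<xi> \<in> K then 1 else 0 :: real)"
  proof (rule continuous_on_closed_Un)
    show "continuous_on K (\<lambda>\<xi>. if \<xi> \<in> K then 1 else 0 :: real)"
      by (rule continuous_on_eq[OF continuous_on_const[of _ 1]]) simp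
    show "continuous_on L (\<lambda>\<xi>. if \<xi> \<in> K then 1 else 0 :: real)"
      by (rule continuous_on_eq[OF continuous_on_const[of _ 0]]) (use disj in auto)
  qed (use K L in \<open>auto intro: compact_imp_closed\<close>)
  from Stone_Weierstrass_basic[OF this, of "\<delta>/2"] \<delta> obtain r where
    r: "r \<in> R" "\<forall>\<xi>\<in>K \<union> L. \<bar>(if \<xi> \<in> K then 1 else 0) - r \<xi>\<bar> < \<delta>/2" by auto
  have "(\<lambda>\<xi>. complex_of_real (r \<xi>)) \<in> trig_poly" using r(1) by (simp add: R_def)
  from trig_poly_bounded[OF this] obtain b where "\<forall>\<xi>. cmod (complex_of_real (r \<xi>)) \<le> b" by blast
  then have b: "\<bar>r \<xi>\<bar> \<le> b" for \<xi> by simp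
  define c :: "real \<Rightarrow> real" where "c t = max 0 (min 1 t)" for t
  have "continuous_on {-b..b} c" unfolding c_def by (intro continuous_intros)
  from Stone_Weierstrass_real_polynomial_function[OF compact_Icc this half_gt_zero[OF \<delta>(1)]]
  obtain q where q: "real_polynomial_function q" "\<And>t. t \<in> {-b..b} \<Longrightarrow> \<bar>c t - q t\<bar> < \<delta>/2"
    by metis
  have qR: "(\<lambda>\<xi>. q (r \<xi>)) \<in> R" using q(1)
  proof (induction rule: real_polynomial_function.induct)
    case (linear f)
    have "f (r \<xi>) = f 1 * r \<xi>" for \<xi>
      using linear_simps(5)[OF linear, of "r \<xi>" 1] by (simp add: mult.commute)
    then show ?case using mult[OF const r(1), of "f 1"] by simp
  next
    case (const c)
    show ?case by (rule function_ring_on.const[OF function_ring_on_axioms])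
  next
    case (add f g)
    then show ?case by (intro function_ring_on.add[OF function_ring_on_axioms])
  next
    case (mult f g)
    then show ?case by (intro function_ring_on.mult[OF function_ring_on_axioms])
  qed
  have qc: "\<bar>c (r \<xi>) - q (r \<xi>)\<bar> < \<delta>/2" for \<xi> using q(2) b[of \<xi>] by (auto simp: abs_le_iff)
  have norms: "cmod (complex_of_real t) = \<bar>t\<bar>" "cmod (1 - complex_of_real t) = \<bar>1 - t\<bar>" for t
    by (simp, metis norm_of_real of_real_1 of_real_diff real_norm_def)
  show ?thesis
  proof (rule that[of "\<lambda>\<xi>. complex_of_real (q (r \<xi>))"])
    show "(\<lambda>\<xi>. complex_of_real (q (r \<xi>))) \<in> trig_poly" using qR by (simp add: R_def)
    fix \<xi>
    have "0 \<le> c (r \<xi>)" "c (r \<xi>) \<le> 1" by (auto simp: c_def)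
    then show "cmod (complex_of_real (q (r \<xi>))) \<le> 2" "cmod (1 - complex_of_real (q (r \<xi>))) \<le> 2"
      unfolding norms using qc[of \<xi>] \<delta> by linarith+
  next
    fix \<xi> assume "\<xi> \<in> K"
    then have "\<bar>1 - r \<xi>\<bar> < \<delta>/2" using bspec[OF r(2), of \<xi>] by simp
    then have "\<bar>1 - c (r \<xi>)\<bar> < \<delta>/2" by (auto simp: c_def max_def min_def)
    then show "cmod (1 - complex_of_real (q (r \<xi>))) \<le> \<delta>" unfolding norms using qc[of \<xi>] by linarith
  next
    fix \<xi> assume "\<xi> \<in> L"
    moreover have "\<xi> \<notin> K" using \<open>\<xi> \<in> L\<close> disj by blast
    ultimately have "\<bar>r \<xi>\<bar> < \<delta>/2" using bspec[OF r(2), of \<xi>] by simp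
    then have "\<bar>c (r \<xi>)\<bar> < \<delta>/2" by (auto simp: c_def max_def min_def)
    then show "cmod (complex_of_real (q (r \<xi>))) \<le> \<delta>" unfolding norms using qc[of \<xi>] by linarith
  qed
qed

section \<open>Concentration on compact sets\<close>

text \<open>
  The measure with density \<open>f\<close> is finite and concentrated on \<open>A\<close>, and inner regularity of \<open>\<sigma>\<close> passes
  to it: the part where \<open>f\<close> is at most \<open>1 / (n + 1)\<close> has small integral for large \<open>n\<close>, and on the
  rest of \<open>A\<close>, which has finite measure by Markov's inequality, a compact subset of almost full
  measure is available.
\<close>

lemma radon_compact_concentration:
  fixes \<sigma> :: "'a::t2_space measure" and f :: "'a \<Rightarrow> real"
  assumes \<sigma>: "radon_measure \<sigma>" and f: "integrable \<sigma> f" "\<And>x. 0 \<le> f x" "\<And>x. f x \<le> b"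
    and A: "A \<in> sets \<sigma>" "emeasure \<sigma> (space \<sigma> - A) = 0" and e: "e > 0"
  obtains K where "compact K" "K \<subseteq> A" "(\<integral>x. indicator (- K) x * f x \<partial>\<sigma>) < e"
proof -
  have [measurable]: "f \<in> borel_measurable \<sigma>" using f(1) by simp
  have sets: "sets \<sigma> = sets borel" by (rule radon_sets[OF \<sigma>])
  have sp: "space \<sigma> = UNIV" using sets_eq_imp_space_eq[OF sets] by simp
  have b: "b \<ge> 0" using f(2,3) order_trans by blast
  define small where "small n x = indicator {x \<in> space \<sigma>. f x \<le> 1 / Suc n} x * f x" for n x
  have "(\<lambda>n. \<integral>x. small n x \<partial>\<sigma>) \<longlonglongrightarrow> (\<integral>x. 0 \<partial>\<sigma>)"
  proof (rule integral_dominated_convergence[where w = f])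
    show "AE x in \<sigma>. (\<lambda>n. small n x) \<longlonglongrightarrow> 0"
    proof (rule AE_I2)
      fix x
      show "(\<lambda>n. small n x) \<longlonglongrightarrow> 0"
      proof (cases "f x = 0")
        case False
        then have "f x > 0" using f(2)[of x] by simp
        then obtain N where N: "1 / Suc N < f x" using nat_approx_posE by blast
        have "small n x = 0" if "n \<ge> N" for n
        proof -
          have "1 / real (Suc n) \<le> 1 / real (Suc N)" using that by (intro divide_left_mono) auto
          then show ?thesis using N by (simp add: small_def indicator_def)
        qed
        then show ?thesis by (intro tendsto_eventually) (auto simp: eventually_sequentially)
      qed (simp add: small_def)
    qed
    show "AE x in \<sigma>. norm (small n x) \<le> f x" for n
      using f(2) by (intro AE_I2) (auto simp: small_def indicator_def)
  qed (use f in \<open>auto simp: small_def[abs_def]\<close>)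
  then have "\<forall>\<^sub>F n in sequentially. (\<integral>x. small n x \<partial>\<sigma>) < e/2"
    using e by (intro order_tendstoD) auto
  then obtain n where n: "(\<integral>x. small n x \<partial>\<sigma>) < e/2" by (auto simp: eventually_sequentially)
  define B where "B = A \<inter> {x \<in> space \<sigma>. f x > 1 / Suc n}"
  have B: "B \<in> sets \<sigma>" unfolding B_def using A(1) by measurable
  have Bfin: "emeasure \<sigma> B < \<infinity>"
  proof -
    have "emeasure \<sigma> B \<le> emeasure \<sigma> {x \<in> space \<sigma>. f x \<ge> 1 / Suc n}"
      by (rule emeasure_mono) (auto simp: B_def)
    also have "\<dots> \<le> (1 / (1 / Suc n)) * (\<integral>x. f x \<partial>\<sigma>)"
      by (rule integral_Markov_inequality[OF f(1)]) (use f in auto)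
    also have "\<dots> < \<infinity>" by (rule ennreal_less_top[folded infinity_ennreal_def])
    finally show ?thesis .
  qed
  define d where "d = e / (2 * (b + 1))"
  have d: "d > 0" using e b by (simp add: d_def)
  obtain K where K: "compact K" "K \<subseteq> B" "measure \<sigma> B < measure \<sigma> K + d"
  proof (rule ccontr)
    assume "\<not> thesis"
    then have no: "measure \<sigma> K \<le> measure \<sigma> B - d" if "compact K" "K \<subseteq> B" for K
      using that \<open>\<And>K. compact K \<Longrightarrow> K \<subseteq> B \<Longrightarrow> measure \<sigma> B < measure \<sigma> K + d \<Longrightarrow> thesis\<close> by force
    have nn: "0 \<le> measure \<sigma> B - d" using no[of "{}"] by simp
    have "emeasure \<sigma> B = (SUP K\<in>{K\<in>sets borel. compact K \<and> K \<subseteq> B}. emeasure \<sigma> K)"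
      using \<sigma> B sets by (auto simp: radon_measure_def)
    also have "\<dots> \<le> ennreal (measure \<sigma> B - d)"
    proof (rule SUP_least)
      fix K assume K: "K \<in> {K\<in>sets borel. compact K \<and> K \<subseteq> B}"
      then have "emeasure \<sigma> K = ennreal (measure \<sigma> K)"
        using radon_finite_compact[OF \<sigma>, of K] by (simp add: emeasure_eq_ennreal_measure)
      then show "emeasure \<sigma> K \<le> ennreal (measure \<sigma> B - d)" using no K by (simp add: ennreal_leI)
    qed
    finally have "ennreal (measure \<sigma> B) \<le> ennreal (measure \<sigma> B - d)"
      using Bfin by (simp add: emeasure_eq_ennreal_measure)
    then show False using d nn by (simp add: ennreal_le_iff)
  qed
  have Ks: "K \<in> sets \<sigma>" by (rule radon_compact_sets[OF \<sigma> K(1)])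
  have Kfin: "emeasure \<sigma> K < \<infinity>" by (rule radon_finite_compact[OF \<sigma> K(1)])
  have BK: "measure \<sigma> (B - K) < d"
    using measure_Diff[of \<sigma> B K] Ks B K Bfin by (simp add: less_top)
  have BKfin: "emeasure \<sigma> (B - K) < \<infinity>"
    using emeasure_mono[of "B - K" B \<sigma>] B Bfin by (meson Diff_subset le_less_trans)
  have "(\<integral>x. indicator (- K) x * f x \<partial>\<sigma>) \<le> (\<integral>x. small n x + indicator (B - K) x * b \<partial>\<sigma>)"
  proof (rule integral_mono_AE)
    have "- K \<in> sets \<sigma>" using Ks sets.compl_sets[OF Ks] sp by (simp add: Compl_eq_Diff_UNIV)
    then show "integrable \<sigma> (\<lambda>x. indicator (- K) x * f x)"
      using integrable_mult_indicator[OF _ f(1), of "- K"] by simp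
    have "integrable \<sigma> (small n)"
      unfolding small_def[abs_def]
      using integrable_mult_indicator[OF _ f(1), of "{x \<in> space \<sigma>. f x \<le> 1 / Suc n}"] by simp
    then show "integrable \<sigma> (\<lambda>x. small n x + indicator (B - K) x * b)"
      using Ks B BKfin by (intro Bochner_Integration.integrable_add integrable_mult_left integrable_real_indicator) auto
    have "space \<sigma> - A \<in> null_sets \<sigma>" using A by (auto simp: null_sets_def)
    then have "AE x in \<sigma>. x \<in> A"
      by (rule AE_I') (auto simp: sp)
    then show "AE x in \<sigma>. indicator (- K) x * f x \<le> small n x + indicator (B - K) x * b"
    proof (rule AE_mp, intro AE_I2 impI)
      fix x assume "x \<in> A"
      show "indicator (- K) x * f x \<le> small n x + indicator (B - K) x * b"
      proof (cases "x \<in> K")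
        case False
        show ?thesis
        proof (cases "f x \<le> 1 / Suc n")
          case True
          then show ?thesis using False b by (simp add: small_def sp indicator_def)
        next
          case False
          then show ?thesis using \<open>x \<in> A\<close> \<open>x \<notin> K\<close> f(3)[of x] f(2)[of x] by (simp add: small_def sp B_def)
        qed
      qed (use b f(2)[of x] in \<open>simp add: small_def\<close>)
    qed
  qed
  also have "\<dots> = (\<integral>x. small n x \<partial>\<sigma>) + measure \<sigma> (B - K) * b"
  proof -
    have "integrable \<sigma> (small n)"
      unfolding small_def[abs_def]
      using integrable_mult_indicator[OF _ f(1), of "{x \<in> space \<sigma>. f x \<le> 1 / Suc n}"] by simp
    then show ?thesis using Ks B BKfin by (subst Bochner_Integration.integral_add) auto
  qed
  also have "\<dots> < e"
  proof -
    have "measure \<sigma> (B - K) * b \<le> d * b" using BK b by (intro mult_right_mono) auto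
    also have "\<dots> \<le> e/2" using b e by (simp add: d_def field_simps)
    finally show ?thesis using n by simp
  qed
  finally show ?thesis using that[OF K(1)] K(2) by (auto simp: B_def)
qed

section \<open>Fourier transforms and multipliers\<close>

lemma char_mult_Cc:
  fixes \<phi> :: "'a::{topological_ab_group_add, t2_space} \<Rightarrow> complex"
  shows "\<phi> \<in> Cc \<Longrightarrow> (\<lambda>t. cnj (char_of \<xi> t) * \<phi> t) \<in> Cc"
  by (intro Cc_mult_cont continuous_on_cnj char_of_props(1))

lemma fourier_add:
  fixes m :: "'a::{topological_ab_group_add, t2_space} measure"
  assumes "radon_measure m" "f \<in> Cc" "g \<in> Cc"
  shows "fourier m (\<lambda>x. f x + g x) \<xi> = fourier m f \<xi> + fourier m g \<xi>"
  using Cc_integrable[OF assms(1) char_mult_Cc[OF assms(2)]]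
      Cc_integrable[OF assms(1) char_mult_Cc[OF assms(3)]]
  by (simp add: fourier_def distrib_left)

lemma fourier_diff:
  fixes m :: "'a::{topological_ab_group_add, t2_space} measure"
  assumes "radon_measure m" "f \<in> Cc" "g \<in> Cc"
  shows "fourier m (\<lambda>x. f x - g x) \<xi> = fourier m f \<xi> - fourier m g \<xi>"
  using Cc_integrable[OF assms(1) char_mult_Cc[OF assms(2)]]
      Cc_integrable[OF assms(1) char_mult_Cc[OF assms(3)]]
  by (simp add: fourier_def right_diff_distrib)

lemma fourier_cmult: "fourier m (\<lambda>x. c * f x) \<xi> = c * fourier m f \<xi>"
proof -
  have "(\<lambda>t. cnj (char_of \<xi> t) * (c * f t)) = (\<lambda>t. c * (cnj (char_of \<xi> t) * f t))"
      by (simp add: ac_simps)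
  then show ?thesis by (simp add: fourier_def)
qed

lemma fourier_translate:
  fixes m :: "'a::{topological_ab_group_add, t2_space} measure"
  assumes m: "haar_measure m" and f: "f \<in> Cc"
  shows "fourier m (\<lambda>t. f (t + x)) \<xi> = char_of \<xi> x * fourier m f \<xi>"
proof -
  have shift: "cnj (char_of \<xi> t) = char_of \<xi> x * cnj (char_of \<xi> (t + x))" for t
  proof -
    have "char_of \<xi> x * cnj (char_of \<xi> x) = 1"
      using char_of_props(2)[of \<xi> x] complex_norm_square[of "char_of \<xi> x"] by simp
    then show ?thesis by (simp add: char_of_props(3) mult.left_commute)
  qed
  have "fourier m (\<lambda>t. f (t + x)) \<xi> = (\<integral>t. char_of \<xi> x * (cnj (char_of \<xi> (t + x)) * f (t + x)) \<partial>m)"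
    unfolding fourier_def by (subst shift) (simp only: mult.assoc)
  also have "\<dots> = char_of \<xi> x * (\<integral>t. cnj (char_of \<xi> (t + x)) * f (t + x) \<partial>m)"
    by (rule integral_mult_right_zero)
  also have "(\<integral>t. cnj (char_of \<xi> (t + x)) * f (t + x) \<partial>m) = fourier m f \<xi>"
    unfolding fourier_def by (rule haar_integral_translate[OF m char_mult_Cc[OF f]])
  finally show ?thesis .
qed

lemma fourier_bounded:
  fixes m :: "'a::{topological_ab_group_add, t2_space} measure"
  assumes m: "radon_measure m" and f: "f \<in> Cc"
  obtains b where "\<And>\<xi>. cmod (fourier m f \<xi>) \<le> b"
proof -
  obtain K where K: "compact K" "\<And>x. f x \<noteq> 0 \<Longrightarrow> x \<in> K" using CcE[OF f] by blast
  obtain B where B: "B \<ge> 0" "\<And>x. cmod (f x) \<le> B" using Cc_bounded[OF f] by blast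
  have "cmod (fourier m f \<xi>) \<le> measure m K * B" for \<xi>
    unfolding fourier_def
    by (rule integral_Cc_bound[OF m char_mult_Cc[OF f] K(1)]) (use K B
        in \<open>auto simp: norm_mult char_of_props\<close>)
  then show ?thesis by (rule that)
qed

lemma conv_fun_add:
  fixes M :: "'a::{topological_ab_group_add, t2_space} functional"
  shows "is_measure M \<Longrightarrow> f \<in> Cc \<Longrightarrow> g \<in> Cc \<Longrightarrow> conv_fun M (\<lambda>x. f x + g x) u = conv_fun M f u + conv_fun M g u"
  unfolding conv_fun_def by (rule is_measure_add) (auto intro: Cc_reflect_translate)

lemma conv_fun_cmult:
  fixes M :: "'a::{topological_ab_group_add, t2_space} functional"
  shows "is_measure M \<Longrightarrow> f \<in> Cc \<Longrightarrow> conv_fun M (\<lambda>x. c * f x) u = c * conv_fun M f u"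
  unfolding conv_fun_def by (rule is_measure_cmult) (auto intro: Cc_reflect_translate)

lemma conv_fun_translate: "conv_fun M (\<lambda>t. f (t + x)) u = conv_fun M f (u + x)"
  by (simp add: conv_fun_def algebra_simps)

text \<open>
  \<open>S\<close> multiplies the Fourier transform by \<open>p\<close>, and \<open>T\<close> multiplies it by the conjugate of \<open>p\<close> and is
  the adjoint of \<open>S\<close> for all pairings at once; thus the same \<open>S\<close> and \<open>T\<close> can be used along the whole
  net.
\<close>

definition adjoint_multipliers ::
    "'a::{topological_ab_group_add, t2_space} measure \<Rightarrow> ('a dual \<Rightarrow> complex)
      \<Rightarrow> (('a \<Rightarrow> complex) \<Rightarrow> 'a \<Rightarrow> complex) \<Rightarrow> (('a \<Rightarrow> complex) \<Rightarrow> 'a \<Rightarrow> complex) \<Rightarrow> bool" where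
  "adjoint_multipliers m p S T \<longleftrightarrow>
     (\<forall>f\<in>Cc. S f \<in> Cc \<and> T f \<in> Cc \<and>
        (\<forall>\<xi>. fourier m (S f) \<xi> = p \<xi> * fourier m f \<xi>) \<and>
        (\<forall>\<xi>. fourier m (T f) \<xi> = cnj (p \<xi>) * fourier m f \<xi>) \<and>
        (\<forall>M N. \<forall>g\<in>Cc. compactly_supported M \<longrightarrow> compactly_supported N \<longrightarrow>
           pairing m M N (S f) g = pairing m M N f (T g)))"

lemma adjoint_multipliersI:
  assumes "\<And>f. f \<in> Cc \<Longrightarrow> S f \<in> Cc" "\<And>f. f \<in> Cc \<Longrightarrow> T f \<in> Cc"
    and "\<And>f \<xi>. f \<in> Cc \<Longrightarrow> fourier m (S f) \<xi> = p \<xi> * fourier m f \<xi>"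
    and "\<And>f \<xi>. f \<in> Cc \<Longrightarrow> fourier m (T f) \<xi> = cnj (p \<xi>) * fourier m f \<xi>"
    and "\<And>f g M N. f \<in> Cc \<Longrightarrow> g \<in> Cc \<Longrightarrow> compactly_supported M \<Longrightarrow> compactly_supported N \<Longrightarrow>
           pairing m M N (S f) g = pairing m M N f (T g)"
  shows "adjoint_multipliers m p S T"
  unfolding adjoint_multipliers_def using assms by (intro ballI conjI allI impI) assumption+

lemma adjoint_multipliersD:
  assumes "adjoint_multipliers m p S T"
  shows "f \<in> Cc \<Longrightarrow> S f \<in> Cc" and "f \<in> Cc \<Longrightarrow> T f \<in> Cc"
    and "f \<in> Cc \<Longrightarrow> fourier m (S f) \<xi> = p \<xi> * fourier m f \<xi>"
    and "f \<in> Cc \<Longrightarrow> fourier m (T f) \<xi> = cnj (p \<xi>) * fourier m f \<xi>"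
    and "f \<in> Cc \<Longrightarrow> g \<in> Cc \<Longrightarrow> compactly_supported M \<Longrightarrow> compactly_supported N \<Longrightarrow>
           pairing m M N (S f) g = pairing m M N f (T g)"
  using assms unfolding adjoint_multipliers_def by blast+

context
  fixes m :: "'a::{topological_ab_group_add, t2_space} measure"
  assumes lc: "locally_compact_space (euclidean :: 'a topology)" and m: "haar_measure m"
begin

lemma pairing_add_left:
  assumes M: "compactly_supported M" and N: "compactly_supported N" and f: "f \<in> Cc" "g \<in> Cc" "h \<in> Cc"
  shows "pairing m M N (\<lambda>x. f x + g x) h = pairing m M N f h + pairing m M N g h"
proof -
  have "is_measure M" using M by (simp add: compactly_supported_def)
  from conv_fun_add[OF this f(1,2)] show ?thesis
    using pairing_integrable[OF lc m M N f(1,3)] pairing_integrable[OF lc m M N f(2,3)]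
    by (simp add: pairing_def distrib_right)
qed

lemma pairing_add_right:
  assumes M: "compactly_supported M" and N: "compactly_supported N" and f: "f \<in> Cc" "g \<in> Cc" "h \<in> Cc"
  shows "pairing m M N h (\<lambda>x. f x + g x) = pairing m M N h f + pairing m M N h g"
proof -
  have "is_measure N" using N by (simp add: compactly_supported_def)
  from conv_fun_add[OF this f(1,2)] show ?thesis
    using pairing_integrable[OF lc m M N f(3,1)] pairing_integrable[OF lc m M N f(3,2)]
    by (simp add: pairing_def distrib_left)
qed

lemma pairing_cmult_left:
  assumes M: "compactly_supported M" and f: "f \<in> Cc"
  shows "pairing m M N (\<lambda>x. c * f x) h = c * pairing m M N f h"
proof -
  have "is_measure M" using M by (simp add: compactly_supported_def)
  from conv_fun_cmult[OF this f] show ?thesis by (simp add: pairing_def mult.assoc)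
qed

lemma pairing_cmult_right:
  assumes N: "compactly_supported N" and f: "f \<in> Cc"
  shows "pairing m M N h (\<lambda>x. c * f x) = cnj c * pairing m M N h f"
proof -
  have "is_measure N" using N by (simp add: compactly_supported_def)
  from conv_fun_cmult[OF this f] show ?thesis by (simp add: pairing_def mult.left_commute)
qed

lemma pairing_translate:
  assumes M: "compactly_supported M" and N: "compactly_supported N" and f: "f \<in> Cc" and g: "g \<in> Cc"
  shows "pairing m M N (\<lambda>t. f (t + x)) g = pairing m M N f (\<lambda>t. g (t - x))"
proof -
  have Cc: "(\<lambda>u. conv_fun M f u * cnj (conv_fun N g (u + - x))) \<in> Cc"
    by (intro Cc_mult_cont Cc_cont[OF conv_fun_Cc[OF lc M f]] Cc_cnj Cc_translate conv_fun_Cc[OF lc N g])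
  show ?thesis
    using haar_integral_translate[OF m Cc, of x] conv_fun_translate[of N g "- x"] conv_fun_translate[of M f x]
    by (simp add: pairing_def)
qed

text \<open>
  Evaluation at \<open>x\<close> is the multiplier of a translation, whose adjoint is the inverse translation
  because Haar measure is invariant. Sums and products of multipliers are multipliers.
\<close>

lemma trig_poly_multiplier:
  assumes "p \<in> trig_poly"
  shows "\<exists>S T. adjoint_multipliers m p S T"
  using assms
proof (induction rule: trig_poly.induct)
  case (character x)
  have T: "fourier m (\<lambda>t. f (t - x)) \<xi> = cnj (char_of \<xi> x) * fourier m f \<xi>" if "f \<in> Cc" for f \<xi>
    using fourier_translate[OF m that, of "- x" \<xi>] by (simp add: char_of_minus)
  have "adjoint_multipliers m (\<lambda>\<xi>. char_of \<xi> x) (\<lambda>f t. f (t + x)) (\<lambda>f t. f (t - x))"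
    by (rule adjoint_multipliersI)
      (simp_all add: Cc_translate Cc_translate_diff fourier_translate[OF m] T pairing_translate)
  then show ?case by blast
next
  case (const c)
  have "adjoint_multipliers m (\<lambda>\<xi>. c) (\<lambda>f t. c * f t) (\<lambda>f t. cnj c * f t)"
    by (rule adjoint_multipliersI)
      (simp_all add: Cc_cmult fourier_cmult pairing_cmult_left pairing_cmult_right)
  then show ?case by blast
next
  case (add p q)
  then obtain S1 T1 S2 T2 where "adjoint_multipliers m p S1 T1" "adjoint_multipliers m q S2 T2" by blast
  note 1 = adjoint_multipliersD[OF this(1)] and 2 = adjoint_multipliersD[OF this(2)]
  have "adjoint_multipliers m (\<lambda>\<xi>. p \<xi> + q \<xi>) (\<lambda>f t. S1 f t + S2 f t) (\<lambda>f t. T1 f t + T2 f t)"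
    by (rule adjoint_multipliersI)
      (simp_all add: Cc_add 1 2 fourier_add[OF haar_radon[OF m]] pairing_add_left pairing_add_right distrib_right)
  then show ?case by blast
next
  case (mult p q)
  then obtain S1 T1 S2 T2 where "adjoint_multipliers m p S1 T1" "adjoint_multipliers m q S2 T2" by blast
  note 1 = adjoint_multipliersD[OF this(1)] and 2 = adjoint_multipliersD[OF this(2)]
  have "adjoint_multipliers m (\<lambda>\<xi>. p \<xi> * q \<xi>) (\<lambda>f. S1 (S2 f)) (\<lambda>f. T2 (T1 f))"
    by (rule adjoint_multipliersI) (simp_all add: 1 2)
  then show ?case by blast
qed

text \<open>
  Mutual singularity in the form in which it is used: a multiplier that is nearly the identity for
  the first measure and nearly zero for the second one.
\<close>

lemma singular_multiplier:
  fixes \<rho> \<sigma> :: "'a dual measure"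
  assumes \<rho>: "radon_measure \<rho>" and \<sigma>: "radon_measure \<sigma>" and sing: "mutually_singular \<rho> \<sigma>"
    and f: "f \<in> Cc" "integrable \<rho> (\<lambda>\<xi>. (cmod (fourier m f \<xi>))\<^sup>2)"
    and g: "g \<in> Cc" "integrable \<sigma> (\<lambda>\<xi>. (cmod (fourier m g \<xi>))\<^sup>2)"
    and e: "e > 0"
  obtains p where "p \<in> trig_poly"
    "(\<integral>\<xi>. (cmod (1 - p \<xi>))\<^sup>2 * (cmod (fourier m f \<xi>))\<^sup>2 \<partial>\<rho>) < e"
    "(\<integral>\<xi>. (cmod (p \<xi>))\<^sup>2 * (cmod (fourier m g \<xi>))\<^sup>2 \<partial>\<sigma>) < e"
proof -
  note r = haar_radon[OF m]
  have conc: "\<exists>K. compact K \<and> K \<subseteq> A \<and> (\<integral>\<xi>. indicator (- K) \<xi> * (cmod (fourier m f \<xi>))\<^sup>2 \<partial>\<rho>) < e / 8"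
    if \<rho>: "radon_measure \<rho>" and f: "f \<in> Cc" "integrable \<rho> (\<lambda>\<xi>. (cmod (fourier m f \<xi>))\<^sup>2)"
      and A: "A \<in> sets \<rho>" "emeasure \<rho> (space \<rho> - A) = 0" for \<rho> :: "'a dual measure" and f A
  proof -
    obtain b where b: "\<And>\<xi>. cmod (fourier m f \<xi>) \<le> b" using fourier_bounded[OF r f(1)] by blast
    have b2: "(cmod (fourier m f \<xi>))\<^sup>2 \<le> b\<^sup>2" for \<xi> by (rule power_mono[OF b]) simp
    have e8: "e / 8 > 0" using e by simp
    show ?thesis by (rule radon_compact_concentration[OF \<rho> f(2) zero_le_power2 b2 A e8]) blast
  qed
  \<comment> \<open>\<open>w\<close> is small on \<open>K\<close>, bounded by \<open>2\<close> elsewhere, and little of \<open>F\<close> is outside \<open>K\<close>\<close>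
  have est: "(\<integral>\<xi>. (cmod (w \<xi>))\<^sup>2 * F \<xi> \<partial>\<rho>) < e"
    if \<rho>: "radon_measure \<rho>" and F: "integrable \<rho> F" "\<And>\<xi>. F \<xi> \<ge> 0" and w: "continuous_on UNIV w"
      and K: "compact K" "(\<integral>\<xi>. indicator (- K) \<xi> * F \<xi> \<partial>\<rho>) < e / 8"
      and d: "d\<^sup>2 * (\<integral>\<xi>. F \<xi> \<partial>\<rho>) \<le> e / 2"
      and wK: "\<And>\<xi>. \<xi> \<in> K \<Longrightarrow> cmod (w \<xi>) \<le> d" and w2: "\<And>\<xi>. cmod (w \<xi>) \<le> 2"
    for \<rho> :: "'a dual measure" and F :: "'a dual \<Rightarrow> real" and w :: "'a dual \<Rightarrow> complex" and K d
  proof -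
    have [measurable]: "w \<in> borel_measurable \<rho>"
      using borel_measurable_continuous_onI[OF w]
          by (simp add: measurable_cong_sets[OF radon_sets[OF \<rho>] refl])
    have [measurable]: "F \<in> borel_measurable \<rho>" using F by simp
    have "- K \<in> sets \<rho>" using radon_sets[OF \<rho>] compact_imp_closed[OF K(1)] by auto
    then have iK: "integrable \<rho> (\<lambda>\<xi>. indicator (- K) \<xi> * F \<xi>)"
      using integrable_mult_indicator[OF _ F(1), of "- K"] by simp
    have le: "(cmod (w \<xi>))\<^sup>2 * F \<xi> \<le> d\<^sup>2 * F \<xi> + 4 * (indicator (- K) \<xi> * F \<xi>)" for \<xi>
    proof (cases "\<xi> \<in> K")
      case True
      then show ?thesis using power_mono[OF wK norm_ge_zero, of \<xi> 2] F(2) by (simp add: mult_right_mono)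
    next
      case False
      have "(cmod (w \<xi>))\<^sup>2 \<le> 2\<^sup>2" by (rule power_mono[OF w2]) simp
      then have "(cmod (w \<xi>))\<^sup>2 * F \<xi> \<le> 4 * F \<xi>" using F(2) by (intro mult_right_mono) auto
      moreover have "0 \<le> d\<^sup>2 * F \<xi>" using F(2) by simp
      ultimately show ?thesis using False by simp
    qed
    have "(\<integral>\<xi>. (cmod (w \<xi>))\<^sup>2 * F \<xi> \<partial>\<rho>) \<le> (\<integral>\<xi>. d\<^sup>2 * F \<xi> + 4 * (indicator (- K) \<xi> * F \<xi>) \<partial>\<rho>)"
    proof (rule integral_mono)
      show i: "integrable \<rho> (\<lambda>\<xi>. d\<^sup>2 * F \<xi> + 4 * (indicator (- K) \<xi> * F \<xi>))"
        using F(1) iK by (intro Bochner_Integration.integrable_add integrable_mult_right)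
      show "integrable \<rho> (\<lambda>\<xi>. (cmod (w \<xi>))\<^sup>2 * F \<xi>)"
      proof (rule Bochner_Integration.integrable_bound[OF i])
        show "AE \<xi> in \<rho>. norm ((cmod (w \<xi>))\<^sup>2 * F \<xi>) \<le> norm (d\<^sup>2 * F \<xi> + 4 * (indicator (- K) \<xi> * F \<xi>))"
        proof (rule AE_I2)
          fix \<xi>
          have "0 \<le> (cmod (w \<xi>))\<^sup>2 * F \<xi>" using F(2) by simp
          then show "norm ((cmod (w \<xi>))\<^sup>2 * F \<xi>) \<le> norm (d\<^sup>2 * F \<xi> + 4 * (indicator (- K) \<xi> * F \<xi>))"
            using le[of \<xi>] by simp
        qed
      qed measurable
    qed (rule le)
    also have "\<dots> = d\<^sup>2 * (\<integral>\<xi>. F \<xi> \<partial>\<rho>) + 4 * (\<integral>\<xi>. indicator (- K) \<xi> * F \<xi> \<partial>\<rho>)"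
      using F(1) iK by (subst Bochner_Integration.integral_add) auto
    also have "\<dots> < e" using d K(2) by linarith
    finally show ?thesis .
  qed
  obtain A B where AB: "A \<in> sets \<rho>" "B \<in> sets \<sigma>" "A \<inter> B = {}" "emeasure \<rho> (space \<rho> - A) = 0"
      "emeasure \<sigma> (space \<sigma> - B) = 0"
    using sing unfolding mutually_singular_def by blast
  obtain K where K: "compact K" "K \<subseteq> A" "(\<integral>\<xi>. indicator (- K) \<xi> * (cmod (fourier m f \<xi>))\<^sup>2 \<partial>\<rho>) < e / 8"
    using conc[OF \<rho> f AB(1,4)] by blast
  obtain L where L: "compact L" "L \<subseteq> B" "(\<integral>\<xi>. indicator (- L) \<xi> * (cmod (fourier m g \<xi>))\<^sup>2 \<partial>\<sigma>) < e / 8"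
    using conc[OF \<sigma> g AB(2,5)] by blast
  define c where "c = (\<integral>\<xi>. (cmod (fourier m f \<xi>))\<^sup>2 \<partial>\<rho>) + (\<integral>\<xi>. (cmod (fourier m g \<xi>))\<^sup>2 \<partial>\<sigma>)"
  have nn: "0 \<le> (\<integral>\<xi>. (cmod (fourier m f \<xi>))\<^sup>2 \<partial>\<rho>)" "0 \<le> (\<integral>\<xi>. (cmod (fourier m g \<xi>))\<^sup>2 \<partial>\<sigma>)" by simp_all
  define d where "d = min 1 (e / (2 * (c + 1)))"
  have c: "c \<ge> 0" using nn by (simp add: c_def)
  have d: "0 < d" "d \<le> 1" using e c by (auto simp: d_def)
  have d2: "d\<^sup>2 * x \<le> e / 2" if "0 \<le> x" "x \<le> c" for x
  proof -
    have "d\<^sup>2 \<le> d" using d by (simp add: power2_eq_square mult_left_le)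
    also have "d \<le> e / (2 * (c + 1))" by (simp add: d_def)
    finally have "d\<^sup>2 * x \<le> e / (2 * (c + 1)) * (c + 1)" using that e c by (intro mult_mono) auto
    also have "\<dots> = e / 2" using c by (simp add: field_simps)
    finally show ?thesis .
  qed
  have disj: "K \<inter> L = {}" using K L AB by blast
  obtain p where p: "p \<in> trig_poly" "\<And>\<xi>. \<xi> \<in> K \<Longrightarrow> cmod (1 - p \<xi>) \<le> d" "\<And>\<xi>. \<xi> \<in> L \<Longrightarrow> cmod (p \<xi>) \<le> d"
    "\<And>\<xi>. cmod (p \<xi>) \<le> 2" "\<And>\<xi>. cmod (1 - p \<xi>) \<le> 2"
    using trig_poly_separates_compacts[OF K(1) L(1) disj d] by metis
  show ?thesis
  proof (rule that[OF p(1)])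
    show "(\<integral>\<xi>. (cmod (1 - p \<xi>))\<^sup>2 * (cmod (fourier m f \<xi>))\<^sup>2 \<partial>\<rho>) < e"
      by (rule est[OF \<rho> f(2) _ _ K(1,3), of "\<lambda>\<xi>. 1 - p \<xi>" d])
        (use p nn d2 in \<open>auto simp: c_def intro!: continuous_on_diff continuous_on_const
            trig_poly_continuous[OF p(1)]\<close>)
    show "(\<integral>\<xi>. (cmod (p \<xi>))\<^sup>2 * (cmod (fourier m g \<xi>))\<^sup>2 \<partial>\<sigma>) < e"
      by (rule est[OF \<sigma> g(2) _ _ L(1,3), of p d])
        (use p nn d2 in \<open>auto simp: c_def intro!: trig_poly_continuous\<close>)
  qed
qed

end

section \<open>Vanishing of the Eberlein convolution\<close>

lemma conv_finite_diff:
  fixes f g :: "'a::{topological_ab_group_add, t2_space} \<Rightarrow> complex"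
  assumes lc: "locally_compact_space (euclidean :: 'a topology)"
    and M: "compactly_supported M" and N: "is_measure N" and f: "f \<in> Cc" and g: "g \<in> Cc"
  shows "conv_finite M (reflect_functional N) (\<lambda>x. f x - g x)
       = conv_finite M (reflect_functional N) f - conv_finite M (reflect_functional N) g"
proof -
  have "is_measure M" using M by (simp add: compactly_supported_def)
  from is_measure_diff[OF this Cc_translate_diff[OF f] Cc_translate_diff[OF g]]
  have "(\<lambda>t. cnj (M (\<lambda>s. f (s - t) - g (s - t))))
      = (\<lambda>t. cnj (M (\<lambda>s. f (s - t))) - cnj (M (\<lambda>s. g (s - t))))"
    by simp
  then show ?thesis
    unfolding conv_finite_reflect(1)[OF lc M N Cc_diff[OF f g]] conv_finite_reflect(1)[OF lc M N f]
        conv_finite_reflect(1)[OF lc M N g]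
    by (simp add: is_measure_diff[OF N conv_finite_reflect(2)[OF lc M N f] conv_finite_reflect(2)[OF lc M N g]])
qed

context
  fixes m :: "'a::{topological_ab_group_add, t2_space} measure"
  assumes lc: "locally_compact_space (euclidean :: 'a topology)" and m: "haar_measure m"
begin

text \<open>
  The Fourier transform of an autocorrelation is tested on correlations of a function with itself.
\<close>

lemma has_fourier_transform_correlation:
  assumes ft: "has_fourier_transform m \<gamma> \<sigma>" and f: "f \<in> Cc"
  shows "integrable \<sigma> (\<lambda>\<xi>. (cmod (fourier m f \<xi>))\<^sup>2)"
    and "\<gamma> (correlation m f f) = complex_of_real (\<integral>\<xi>. (cmod (fourier m f \<xi>))\<^sup>2 \<partial>\<sigma>)"
proof -
  have hb: "has_bochner_integral \<sigma> (\<lambda>\<xi>. complex_of_real ((cmod (fourier m f \<xi>))\<^sup>2)) (\<gamma> (correlation m f f))"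
    using ft f unfolding has_fourier_transform_def conv_fun_correlation by blast
  from integrable_Re[OF integrable.intros[OF hb]]
  show "integrable \<sigma> (\<lambda>\<xi>. (cmod (fourier m f \<xi>))\<^sup>2)" by simp
  show "\<gamma> (correlation m f f) = complex_of_real (\<integral>\<xi>. (cmod (fourier m f \<xi>))\<^sup>2 \<partial>\<sigma>)"
    using has_bochner_integral_integral_eq[OF hb]
        by (simp add: integral_complex_of_real del: of_real_power)
qed

text \<open>
  The diffraction measure records the limits of the normalised energies of \<open>M * f\<close>.
\<close>

lemma autocorrelation_energy:
  assumes \<mu>: "is_measure \<mu>" and vh: "van_hove_net m I le A"
    and ac: "has_autocorrelation m I le A \<mu> \<gamma>" and ft: "has_fourier_transform m \<gamma> \<sigma>" and f: "f \<in> Cc"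
  shows "((\<lambda>i. cmod (pairing m (restrict_functional \<mu> (A i)) (restrict_functional \<mu> (A i)) f f)
      / measure m (A i))
           \<longlongrightarrow> (\<integral>\<xi>. (cmod (fourier m f \<xi>))\<^sup>2 \<partial>\<sigma>)) (net_filter I le)"
proof -
  let ?M = "\<lambda>i. restrict_functional \<mu> (A i)"
  have c: "correlation m f f \<in> Cc" by (rule correlation_Cc[OF haar_radon[OF m] f f])
  have "((\<lambda>i. complex_of_real (1 / measure m (A i)) * conv_finite (?M i)
      (reflect_functional (?M i)) (correlation m f f))
      \<longlongrightarrow> \<gamma> (correlation m f f)) (net_filter I le)"
    using ac c unfolding has_autocorrelation_def has_reflected_eberlein_def by blast
  from tendsto_norm[OF this] have "((\<lambda>i. cmod (complex_of_real (1 / measure m (A i))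
      * conv_finite (?M i) (reflect_functional (?M i)) (correlation m f f)))
      \<longlongrightarrow> (\<integral>\<xi>. (cmod (fourier m f \<xi>))\<^sup>2 \<partial>\<sigma>)) (net_filter I le)"
    unfolding has_fourier_transform_correlation(2)[OF ft f] by simp
  moreover have "\<forall>\<^sub>F i in net_filter I le. i \<in> I"
    using vh by (intro eventually_net_filter_index) (auto simp: van_hove_net_def)
  then have "\<forall>\<^sub>F i in net_filter I le. cmod (complex_of_real (1 / measure m (A i))
      * conv_finite (?M i) (reflect_functional (?M i)) (correlation m f f))
      = cmod (pairing m (?M i) (?M i) f f) / measure m (A i)"
  proof eventually_elim
    case (elim i)
    then have "open (A i)" "compact (closure (A i))" using vh by (auto simp: van_hove_net_def)
    then have "compactly_supported (?M i)" by (rule compactly_supported_restrict[OF lc \<mu>])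
    from conv_finite_correlation[OF lc m this this f f] show ?case by (simp add: norm_mult norm_divide)
  qed
  ultimately show ?thesis by (rule Lim_transform_eventually)
qed

text \<open>
  With \<open>S\<close> and \<open>T\<close> adjoint multipliers for \<open>p\<close>, the pairing of \<open>f\<close> and \<open>g\<close> is the pairing of
  \<open>f - S f\<close> and \<open>g\<close> plus the pairing of \<open>f\<close> and \<open>T g\<close>. In the first summand the energy of the left
  factor tends to the integral of \<open>|1 - p|\<^sup>2 |f^|\<^sup>2\<close> for the first diffraction measure, in the
  second summand the energy of the right factor tends to the integral of \<open>|p|\<^sup>2 |g^|\<^sup>2\<close> for the
  second one, and \<open>p\<close> can be chosen such that both are small.
\<close>

lemma pairing_singular_tendsto_0:
  assumes \<mu>: "is_measure \<mu>" and \<nu>: "is_measure \<nu>" and vh: "van_hove_net m I le A"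
    and ac: "has_autocorrelation m I le A \<mu> \<gamma>\<^sub>\<mu>" "has_autocorrelation m I le A \<nu> \<gamma>\<^sub>\<nu>"
    and ft: "has_fourier_transform m \<gamma>\<^sub>\<mu> \<sigma>\<^sub>\<mu>" "has_fourier_transform m \<gamma>\<^sub>\<nu> \<sigma>\<^sub>\<nu>"
    and sing: "mutually_singular \<sigma>\<^sub>\<mu> \<sigma>\<^sub>\<nu>" and f: "f \<in> Cc" and g: "g \<in> Cc"
  shows "((\<lambda>i. cmod (pairing m (restrict_functional \<mu> (A i)) (restrict_functional \<nu> (A i)) f g)
      / measure m (A i))
           \<longlongrightarrow> 0) (net_filter I le)"
proof (rule tendstoI)
  fix e :: real assume e: "e > 0"
  let ?F = "net_filter I le"
  define M N where "M i = restrict_functional \<mu> (A i)" and "N i = restrict_functional \<nu> (A i)" for i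
  define E\<^sub>\<mu> where "E\<^sub>\<mu> f = (\<integral>\<xi>. (cmod (fourier m f \<xi>))\<^sup>2 \<partial>\<sigma>\<^sub>\<mu>)" for f
  define E\<^sub>\<nu> where "E\<^sub>\<nu> f = (\<integral>\<xi>. (cmod (fourier m f \<xi>))\<^sup>2 \<partial>\<sigma>\<^sub>\<nu>)" for f
  have nn: "0 \<le> E\<^sub>\<mu> f" "0 \<le> E\<^sub>\<nu> g" unfolding E\<^sub>\<mu>_def E\<^sub>\<nu>_def by simp_all
  \<comment> \<open>the weight in Cauchy--Schwarz: \<open>1 / a\<close> makes the fixed energies small, and \<open>p\<close> then beats the factor \<open>a\<close>\<close>
  define a where "a = 2 * (E\<^sub>\<mu> f + E\<^sub>\<nu> g + 1) / e"
  have a: "a > 0" using nn e by (auto simp: a_def)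
  have r: "radon_measure \<sigma>\<^sub>\<mu>" "radon_measure \<sigma>\<^sub>\<nu>" using ft by (auto simp: has_fourier_transform_def)
  have ea: "e / (4 * a) > 0" using e a by simp
  obtain p where p: "p \<in> trig_poly"
    "(\<integral>\<xi>. (cmod (1 - p \<xi>))\<^sup>2 * (cmod (fourier m f \<xi>))\<^sup>2 \<partial>\<sigma>\<^sub>\<mu>) < e / (4 * a)"
    "(\<integral>\<xi>. (cmod (p \<xi>))\<^sup>2 * (cmod (fourier m g \<xi>))\<^sup>2 \<partial>\<sigma>\<^sub>\<nu>) < e / (4 * a)"
    by (rule singular_multiplier[OF lc m r sing f has_fourier_transform_correlation(1)[OF ft(1) f]
          g has_fourier_transform_correlation(1)[OF ft(2) g] ea])
  obtain S T where ST: "adjoint_multipliers m p S T" using trig_poly_multiplier[OF lc m p(1)] by blast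
  note ST = adjoint_multipliersD[OF ST]
  define f' where "f' = (\<lambda>x. f x - S f x)"
  have f': "f' \<in> Cc" unfolding f'_def by (intro Cc_diff f ST)
  have "fourier m f' \<xi> = (1 - p \<xi>) * fourier m f \<xi>" for \<xi>
    unfolding f'_def fourier_diff[OF haar_radon[OF m] f ST(1)[OF f]] ST(3)[OF f]
        by (simp add: left_diff_distrib)
  then have 1: "E\<^sub>\<mu> f' < e / (4 * a)" using p(2) by (simp add: E\<^sub>\<mu>_def norm_mult power_mult_distrib)
  have 2: "E\<^sub>\<nu> (T g) < e / (4 * a)" using p(3)
      by (simp add: E\<^sub>\<nu>_def ST(4)[OF g] norm_mult power_mult_distrib)
  define bound where "bound i = (a * (cmod (pairing m (M i) (M i) f' f') / measure m (A i))
      + (cmod (pairing m (N i) (N i) g g) / measure m (A i)) / a) / 2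
      + ((1 / a) * (cmod (pairing m (M i) (M i) f f) / measure m (A i))
          + (cmod (pairing m (N i) (N i) (T g) (T g)) / measure m (A i)) / (1 / a)) / 2" for i
  have "(bound \<longlongrightarrow> (a * E\<^sub>\<mu> f' + E\<^sub>\<nu> g / a) / 2 + ((1 / a) * E\<^sub>\<mu> f + E\<^sub>\<nu> (T g) / (1 / a)) / 2) ?F"
    unfolding bound_def[abs_def] M_def N_def E\<^sub>\<mu>_def E\<^sub>\<nu>_def using a
    by (intro tendsto_add tendsto_mult tendsto_divide tendsto_const
        autocorrelation_energy[OF \<mu> vh ac(1) ft(1)] autocorrelation_energy[OF \<nu> vh ac(2) ft(2)] f f' g ST) auto
  moreover have "(a * E\<^sub>\<mu> f' + E\<^sub>\<nu> g / a) / 2 + ((1 / a) * E\<^sub>\<mu> f + E\<^sub>\<nu> (T g) / (1 / a)) / 2 < e"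
  proof -
    have "a * E\<^sub>\<mu> f' < e / 4" "a * E\<^sub>\<nu> (T g) < e / 4" using 1 2 a by (simp_all add: field_simps)
    moreover have "(E\<^sub>\<mu> f + E\<^sub>\<nu> g) / a \<le> e / 2"
    proof -
      have "(E\<^sub>\<mu> f + E\<^sub>\<nu> g) / a \<le> (E\<^sub>\<mu> f + E\<^sub>\<nu> g + 1) / a" using a by (intro divide_right_mono) auto
      also have "\<dots> = e / 2"
      proof -
        have "e / 2 * a = E\<^sub>\<mu> f + E\<^sub>\<nu> g + 1" using e by (simp add: a_def)
        then show ?thesis using a by (metis less_irrefl nonzero_mult_div_cancel_right)
      qed
      finally show ?thesis .
    qed
    ultimately show ?thesis using e by (simp add: add_divide_distrib mult.commute)
  qed
  ultimately have "\<forall>\<^sub>F i in ?F. bound i < e" by (rule order_tendstoD)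
  moreover have "\<forall>\<^sub>F i in ?F. i \<in> I"
    using vh by (intro eventually_net_filter_index) (auto simp: van_hove_net_def)
  ultimately show "\<forall>\<^sub>F i in ?F. dist (cmod (pairing m (restrict_functional \<mu> (A i)) (restrict_functional \<nu> (A i)) f g) / measure m (A i)) 0 < e"
  proof eventually_elim
    case (elim i)
    have A: "open (A i)" "compact (closure (A i))" "measure m (A i) > 0" using vh elim
        by (auto simp: van_hove_net_def)
    have c: "compactly_supported (M i)" "compactly_supported (N i)"
      unfolding M_def N_def by (intro compactly_supported_restrict[OF lc] \<mu> \<nu> A)+
    have "pairing m (M i) (N i) f g = pairing m (M i) (N i) (\<lambda>x. f' x + S f x) g" by (simp add: f'_def)
    also have "\<dots> = pairing m (M i) (N i) f' g + pairing m (M i) (N i) f (T g)"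
      using pairing_add_left[OF lc m c f' ST(1)[OF f] g] ST(5)[OF f g c] by simp
    finally have "cmod (pairing m (M i) (N i) f g) \<le> cmod (pairing m (M i) (N i) f' g)
        + cmod (pairing m (M i) (N i) f (T g))"
      by (simp add: norm_triangle_ineq)
    also have "\<dots> \<le> (a * cmod (pairing m (M i) (M i) f' f') + cmod (pairing m (N i) (N i) g g) / a) / 2
        + ((1 / a) * cmod (pairing m (M i) (M i) f f) + cmod (pairing m (N i) (N i) (T g) (T g))
            / (1 / a)) / 2"
      using a by (intro add_mono pairing_AM_GM[OF lc m c] f f' g ST) auto
    also have "\<dots> = bound i * measure m (A i)" using A(3) by (simp add: bound_def field_simps)
    finally have "cmod (pairing m (M i) (N i) f g) / measure m (A i) \<le> bound i" using A(3)
        by (simp add: field_simps)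
    then show ?case using elim(1) A(3) by (simp add: M_def N_def)
  qed
qed

text \<open>
  The normalised convolutions are equicontinuous on test functions with support in \<open>K\<close>: translation
  boundedness of \<open>\<mu>\<close> bounds the inner integral, and the total mass of the restriction of \<open>\<nu>\<close> is of
  the order of \<open>|A\<^sub>i|\<close>.
\<close>

lemma conv_finite_uniform_bound:
  assumes tb: "translation_bounded \<mu>" "translation_bounded \<nu>" and vh: "van_hove_net m I le A"
      and K: "compact K"
  shows "\<exists>C\<ge>0. \<forall>\<^sub>F i in net_filter I le. \<forall>\<theta>\<in>Cc. \<forall>B. (\<forall>x. \<theta> x \<noteq> 0 \<longrightarrow> x \<in> K) \<longrightarrow> (\<forall>x. cmod (\<theta> x) \<le> B) \<longrightarrow>
     cmod (conv_finite (restrict_functional \<mu> (A i))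
         (reflect_functional (restrict_functional \<nu> (A i))) \<theta>) \<le> C * B * measure m (A i)"
proof -
  have \<mu>: "is_measure \<mu>" "is_measure \<nu>" using tb by (auto simp: translation_bounded_def)
  obtain C where C: "C \<ge> 0" "\<forall>\<psi>\<in>Cc. \<forall>t B. (\<forall>x. \<psi> x \<noteq> 0 \<longrightarrow> x - t \<in> K) \<longrightarrow> (\<forall>x. cmod (\<psi> x) \<le> B)
      \<longrightarrow> cmod (\<mu> \<psi>) \<le> C * B"
    using translation_bounded_bound[OF lc tb(1) K] by blast
  obtain D where D: "D \<ge> 0" and ev: "\<forall>\<^sub>F i in net_filter I le. \<forall>\<psi>\<in>Cc. \<forall>B. (\<forall>x. cmod (\<psi> x) \<le> B)
     \<longrightarrow> cmod (restrict_functional \<nu> (A i) \<psi>) \<le> D * B * measure m (A i)"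
    using van_hove_restrict_bound[OF lc m tb(2) vh] by blast
  have "\<forall>\<^sub>F i in net_filter I le. i \<in> I"
    using vh by (intro eventually_net_filter_index) (auto simp: van_hove_net_def)
  with ev have "\<forall>\<^sub>F i in net_filter I le. \<forall>\<theta>\<in>Cc. \<forall>B. (\<forall>x. \<theta> x \<noteq> 0 \<longrightarrow> x \<in> K) \<longrightarrow> (\<forall>x. cmod (\<theta> x) \<le> B) \<longrightarrow>
     cmod (conv_finite (restrict_functional \<mu> (A i))
         (reflect_functional (restrict_functional \<nu> (A i))) \<theta>) \<le> (D * C) * B * measure m (A i)"
  proof eventually_elim
    case (elim i)
    have A: "open (A i)" "compact (closure (A i))" using vh elim by (auto simp: van_hove_net_def)
    show ?case
    proof (intro ballI allI impI)
      fix \<theta> :: "'a \<Rightarrow> complex" and B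
      assume \<theta>: "\<theta> \<in> Cc" "\<forall>x. \<theta> x \<noteq> 0 \<longrightarrow> x \<in> K" "\<forall>x. cmod (\<theta> x) \<le> B"
      have B: "cmod (cnj (restrict_functional \<mu> (A i) (\<lambda>s. \<theta> (s - t)))) \<le> C * B" for t
        unfolding complex_mod_cnj
      proof (rule restrict_functional_le[OF lc \<mu>(1) A Cc_translate_diff[OF \<theta>(1)]])
        fix h :: "'a \<Rightarrow> real" assume h: "continuous_on UNIV h" "\<And>x. 0 \<le> h x" "\<And>x. h x \<le> indicator (A i) x"
        show "cmod (\<mu> (\<lambda>x. complex_of_real (h x) * \<theta> (x - t))) \<le> C * B"
        proof (rule C(2)[rule_format, of _ t])
          show "(\<lambda>x. complex_of_real (h x) * \<theta> (x - t)) \<in> Cc"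
            by (intro Cc_mult_cont continuous_on_of_real h(1) Cc_translate_diff \<theta>(1))
          fix x
          show "complex_of_real (h x) * \<theta> (x - t) \<noteq> 0 \<Longrightarrow> x - t \<in> K" using \<theta>(2) by auto
          show "cmod (complex_of_real (h x) * \<theta> (x - t)) \<le> B"
            by (rule norm_cutoff_le[OF h(2,3) \<theta>(3)[rule_format]])
        qed
      qed
      note c = compactly_supported_restrict[OF lc \<mu>(1) A] and n = is_measure_restrict[OF lc \<mu>(2) A]
      have "cmod (restrict_functional \<nu> (A i) (\<lambda>t. cnj (restrict_functional \<mu> (A i) (\<lambda>s. \<theta> (s - t))))) \<le> D * (C * B) * measure m (A i)"
        by (rule elim(1)[rule_format, OF conv_finite_reflect(2)[OF lc c n \<theta>(1)] B])
      then show "cmod (conv_finite (restrict_functional \<mu> (A i))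
          (reflect_functional (restrict_functional \<nu> (A i))) \<theta>) \<le> (D * C) * B * measure m (A i)"
        unfolding conv_finite_reflect(1)[OF lc c n \<theta>(1)] by (simp add: mult.assoc)
    qed
  qed
  then show ?thesis using C(1) D by (intro exI[of _ "D * C"]) simp
qed

text \<open>
  Correlations exhaust the test functions approximately: the correlation of a bump \<open>g\<close> near \<open>0\<close> with
  the conjugate of \<open>\<theta>\<close> is an average of translates of \<open>\<theta>\<close> by small amounts. The compact set \<open>K\<close> that
  contains the support of the error does not depend on the accuracy.
\<close>

lemma correlation_approximation:
  fixes \<theta> :: "'a \<Rightarrow> complex"
  assumes \<theta>: "\<theta> \<in> Cc"
  shows "\<exists>K. compact K \<and> (\<forall>e>0. \<exists>g\<in>Cc. \<forall>s. cmod (\<theta> s - correlation m g (\<lambda>x. cnj (\<theta> x)) s) \<le> e \<and>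
     (\<theta> s - correlation m g (\<lambda>x. cnj (\<theta> x)) s \<noteq> 0 \<longrightarrow> s \<in> K))"
proof -
  note r = haar_radon[OF m]
  obtain V C :: "'a set" where VC: "open V" "compact C" "0 \<in> V" "V \<subseteq> C"
    using lc unfolding locally_compact_space_def by (auto dest: spec[of _ 0])
  obtain L where L: "compact L" "\<And>x. \<theta> x \<noteq> 0 \<Longrightarrow> x \<in> L" using CcE[OF \<theta>] by blast
  obtain h :: "'a \<Rightarrow> complex" where h: "h \<in> Cc" "\<And>x. x \<in> C \<Longrightarrow> h x = 1" using Cc_cutoff[OF lc VC(2)]
      by blast
  obtain H where H: "compact H" "\<And>x. h x \<noteq> 0 \<Longrightarrow> x \<in> H" using CcE[OF h(1)] by blast
  define K where "K = {a + k | a k. a \<in> L \<and> k \<in> uminus ` H}"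
  have K: "compact K" unfolding K_def by (intro compact_sum_set L compact_continuous_image H continuous_intros)
  have in_K: "s \<in> K" if "u + s \<in> L" "u \<in> H" for u s
  proof -
    have "s = (u + s) + (- u)" by simp
    then show ?thesis unfolding K_def using that by blast
  qed
  \<comment> \<open>the cutoff \<open>h\<close> makes the supports of the translates stay in a compact set; it is \<open>1\<close> near \<open>0\<close>\<close>
  define \<Phi> where "\<Phi> u s = h u * \<theta> (u + s)" for u s
  have \<Phi>K: "\<forall>u s. \<Phi> u s \<noteq> 0 \<longrightarrow> s \<in> K" using in_K H(2) L(2) by (auto simp: \<Phi>_def)
  have cont: "continuous_on UNIV (\<lambda>p. \<Phi> (fst p) (snd p))"
    unfolding \<Phi>_def by (intro continuous_on_mult continuous_on_pair_args Cc_cont h(1) \<theta>)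
  have h0: "h 0 = 1" using h(2) VC by blast
  have "\<exists>g\<in>Cc. \<forall>s. cmod (\<theta> s - correlation m g (\<lambda>x. cnj (\<theta> x)) s) \<le> e \<and>
     (\<theta> s - correlation m g (\<lambda>x. cnj (\<theta> x)) s \<noteq> 0 \<longrightarrow> s \<in> K)" if e: "e > 0" for e :: real
  proof -
    obtain U where U: "open U" "0 \<in> U" "\<forall>u\<in>U. \<forall>s. cmod (\<Phi> u s - \<Phi> 0 s) \<le> e"
      using section_uniformly_continuous[OF cont K \<Phi>K e, of 0] by blast
    have W: "open (U \<inter> V)" "0 \<in> U \<inter> V" using U VC by auto
    obtain g :: "'a \<Rightarrow> real" and G where g: "continuous_on UNIV g" "\<And>x. 0 \<le> g x" "compact G" "G \<subseteq> U \<inter> V"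
      "\<And>x. g x \<noteq> 0 \<Longrightarrow> x \<in> G" "(\<integral>x. complex_of_real (g x) \<partial>m) = 1"
      using haar_bump[OF lc m W] by metis
    have gCc: "(\<lambda>x. complex_of_real (g x)) \<in> Cc"
      by (rule CcI[OF _ g(3)]) (use g in \<open>auto intro!: continuous_intros\<close>)
    have int: "integrable m g" using integrable_Re[OF Cc_integrable[OF r gCc]] by simp
    have I: "(\<integral>x. g x \<partial>m) = 1" using g(6) by (simp add: integral_complex_of_real)
    have in_C: "u \<in> C" "u \<in> U" "u \<in> H" if "g u \<noteq> 0" for u
    proof -
      show C: "u \<in> C" "u \<in> U" using g(4) g(5)[OF that] VC by auto
      show "u \<in> H" using h(2)[OF C(1)] H(2)[of u] by simp
    qed
    show ?thesis
    proof (rule bexI[OF _ gCc], intro allI conjI impI)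
      fix s
      let ?c = "correlation m (\<lambda>x. complex_of_real (g x)) (\<lambda>x. cnj (\<theta> x)) s"
      have Cc1: "(\<lambda>u. complex_of_real (g u) * \<theta> (u + s)) \<in> Cc"
        by (intro Cc_mult_cont Cc_cont[OF gCc] Cc_translate \<theta>)
      have c: "?c = (\<integral>u. complex_of_real (g u) * \<theta> (u + s) \<partial>m)" by (simp add: correlation_def)
      have "\<theta> s - ?c = (\<integral>u. complex_of_real (g u) * \<theta> s - complex_of_real (g u) * \<theta> (u + s) \<partial>m)"
        unfolding c using g(6) Cc_integrable[OF r gCc] Cc_integrable[OF r Cc1]
        by (subst Bochner_Integration.integral_diff) auto
      also have "cmod \<dots> \<le> (\<integral>u. g u * e \<partial>m)"
      proof (rule order_trans[OF integral_norm_bound integral_mono])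
        show "integrable m (\<lambda>u. cmod (complex_of_real (g u) * \<theta> s - complex_of_real (g u) * \<theta> (u + s)))"
          using Cc_integrable[OF r gCc] Cc_integrable[OF r Cc1] by auto
        show "integrable m (\<lambda>u. g u * e)" using int by simp
        fix u
        have "cmod (complex_of_real (g u) * \<theta> s - complex_of_real (g u) * \<theta> (u + s)) = g u
            * cmod (\<theta> (u + s) - \<theta> s)"
          using g(2)[of u] by (simp add: right_diff_distrib[symmetric] norm_mult norm_minus_commute)
        also have "\<dots> \<le> g u * e"
        proof (cases "g u = 0")
          case False
          then have "\<Phi> u s = \<theta> (u + s)" "\<Phi> 0 s = \<theta> s" "u \<in> U" using in_C[of u] h h0 by (auto simp: \<Phi>_def)
          then have "cmod (\<theta> (u + s) - \<theta> s) \<le> e" using U(3) by metis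
          then show ?thesis using g(2)[of u] by (rule mult_left_mono)
        qed simp
        finally show "cmod (complex_of_real (g u) * \<theta> s - complex_of_real (g u) * \<theta> (u + s)) \<le> g u * e" .
      qed
      also have "\<dots> = e" using I by simp
      finally show "cmod (\<theta> s - ?c) \<le> e" .
      assume ne: "\<theta> s - ?c \<noteq> 0"
      show "s \<in> K"
      proof (rule ccontr)
        assume s: "s \<notin> K"
        have "\<theta> s = 0" using in_K[of 0 s] L(2)[of s] H(2)[of 0] h0 s by auto
        moreover have zero: "complex_of_real (g u) * \<theta> (u + s) = 0" for u
          using in_K[of u s] L(2)[of "u + s"] in_C(3)[of u] s by auto
        ultimately show False using ne unfolding c zero by simp
      qed
    qed
  qed
  then show ?thesis using K by blast
qed

end

theorem theorem6p1:
  fixes m :: "'g::{topological_ab_group_add, t2_space} measure"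
    and \<mu> \<nu> \<gamma>\<^sub>\<mu> \<gamma>\<^sub>\<nu> :: "'g functional"
    and I :: "'i set" and le :: "'i \<Rightarrow> 'i \<Rightarrow> bool" and A :: "'i \<Rightarrow> 'g set"
    and \<sigma>\<^sub>\<mu> \<sigma>\<^sub>\<nu> :: "'g dual measure"
  assumes "locally_compact_space (euclidean :: 'g topology)"
    and "haar_measure m"
    and "translation_bounded \<mu>" and "translation_bounded \<nu>"
    and "van_hove_net m I le A"
    and "has_autocorrelation m I le A \<mu> \<gamma>\<^sub>\<mu>" and "has_autocorrelation m I le A \<nu> \<gamma>\<^sub>\<nu>"
    and "has_fourier_transform m \<gamma>\<^sub>\<mu> \<sigma>\<^sub>\<mu>" and "has_fourier_transform m \<gamma>\<^sub>\<nu> \<sigma>\<^sub>\<nu>"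
    and "mutually_singular \<sigma>\<^sub>\<mu> \<sigma>\<^sub>\<nu>"
  shows "has_reflected_eberlein m I le A \<mu> \<nu> (\<lambda>_. 0)"
  unfolding has_reflected_eberlein_def
proof (intro conjI ballI)
  show "is_measure (\<lambda>_ :: 'g \<Rightarrow> complex. 0)" by (rule is_measureI) (auto intro!: exI[of _ 0])
  note lc = assms(1) and m = assms(2)
  have \<mu>: "is_measure \<mu>" "is_measure \<nu>" using assms(3,4) by (auto simp: translation_bounded_def)
  fix \<theta> :: "'g \<Rightarrow> complex" assume \<theta>: "\<theta> \<in> Cc"
  define D where "D i = conv_finite (restrict_functional \<mu> (A i))
      (reflect_functional (restrict_functional \<nu> (A i)))" for i
  obtain K where K: "compact K" and approx: "\<forall>e>0. \<exists>g\<in>Cc. \<forall>s. cmod (\<theta> s - correlation m g (\<lambda>x. cnj (\<theta> x)) s) \<le> e \<and>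
     (\<theta> s - correlation m g (\<lambda>x. cnj (\<theta> x)) s \<noteq> 0 \<longrightarrow> s \<in> K)"
    using correlation_approximation[OF lc m \<theta>] by blast
  obtain C where C: "C \<ge> 0" and ev: "\<forall>\<^sub>F i in net_filter I le. \<forall>\<theta>\<in>Cc. \<forall>B. (\<forall>x. \<theta> x \<noteq> 0 \<longrightarrow> x \<in> K)
      \<longrightarrow> (\<forall>x. cmod (\<theta> x) \<le> B) \<longrightarrow>
     cmod (D i \<theta>) \<le> C * B * measure m (A i)"
    using conv_finite_uniform_bound[OF lc m assms(3-5) K] unfolding D_def by blast
  have "((\<lambda>i. complex_of_real (1 / measure m (A i)) * D i \<theta>) \<longlongrightarrow> 0) (net_filter I le)"
  proof (rule tendstoI)
    fix e :: real assume e: "e > 0"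
    define d where "d = e / (2 * (C + 1))"
    have d: "d > 0" using e C by (simp add: d_def)
    obtain g where g: "g \<in> Cc" "\<And>s. cmod (\<theta> s - correlation m g (\<lambda>x. cnj (\<theta> x)) s) \<le> d"
      "\<And>s. \<theta> s - correlation m g (\<lambda>x. cnj (\<theta> x)) s \<noteq> 0 \<Longrightarrow> s \<in> K"
      using approx[rule_format, OF d] by blast
    let ?c = "correlation m g (\<lambda>x. cnj (\<theta> x))"
    have c: "?c \<in> Cc" by (intro correlation_Cc[OF haar_radon[OF m]] g(1) Cc_cnj \<theta>)
    have "((\<lambda>i. cmod (pairing m (restrict_functional \<mu> (A i)) (restrict_functional \<nu> (A i)) g (\<lambda>x. cnj (\<theta> x))) / measure m (A i))
           \<longlongrightarrow> 0) (net_filter I le)"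
      by (rule pairing_singular_tendsto_0[OF lc m \<mu> assms(5-10) g(1) Cc_cnj[OF \<theta>]])
    then have "\<forall>\<^sub>F i in net_filter I le. cmod (pairing m (restrict_functional \<mu> (A i)) (restrict_functional \<nu> (A i)) g (\<lambda>x. cnj (\<theta> x))) / measure m (A i) < e / 2"
      using e by (intro order_tendstoD) auto
    moreover have "\<forall>\<^sub>F i in net_filter I le. i \<in> I"
      using assms(5) by (intro eventually_net_filter_index) (auto simp: van_hove_net_def)
    ultimately show "\<forall>\<^sub>F i in net_filter I le. dist (complex_of_real (1 / measure m (A i))
        * D i \<theta>) 0 < e"
      using ev
    proof eventually_elim
      case (elim i)
      have A: "open (A i)" "compact (closure (A i))" "measure m (A i) > 0"
        using assms(5) elim by (auto simp: van_hove_net_def)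
      note M = compactly_supported_restrict[OF lc \<mu>(1) A(1,2)] and N
          = compactly_supported_restrict[OF lc \<mu>(2) A(1,2)]
      have N': "is_measure (restrict_functional \<nu> (A i))" using N by (simp add: compactly_supported_def)
      have "cmod (D i (\<lambda>s. \<theta> s - ?c s)) \<le> C * d * measure m (A i)"
        using elim(3)[rule_format, OF Cc_diff[OF \<theta> c] g(3) g(2)] by simp
      then have 1: "cmod (D i \<theta> - D i ?c) \<le> C * d * measure m (A i)"
        using conv_finite_diff[OF lc M N' \<theta> c] by (simp add: D_def)
      have "D i ?c = pairing m (restrict_functional \<mu> (A i)) (restrict_functional \<nu> (A i)) g (\<lambda>x. cnj (\<theta> x))"
        unfolding D_def by (rule conv_finite_correlation[OF lc m M N g(1) Cc_cnj[OF \<theta>]])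
      then have 2: "cmod (D i ?c) < e / 2 * measure m (A i)" using elim(1) A(3)
          by (simp add: field_simps)
      have "C * d \<le> e / 2" using C e by (simp add: d_def field_simps)
      then have "C * d * measure m (A i) \<le> e / 2 * measure m (A i)"
          by (rule mult_right_mono) (use A in auto)
      then have "cmod (D i \<theta>) < e * measure m (A i)"
        using 1 2 norm_triangle_sub[of "D i \<theta>" "D i ?c"] by linarith
      then show ?case using A(3) by (simp add: norm_mult norm_divide field_simps)
    qed
  qed
  then show "((\<lambda>i. complex_of_real (1 / measure m (A i)) *
                  conv_finite (restrict_functional \<mu> (A i))
                    (reflect_functional (restrict_functional \<nu> (A i))) \<theta>)
               \<longlongrightarrow> 0) (net_filter I le)" by (simp add: D_def)
qed

end
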